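(* Let a dynamic programming problem with value functions $V_{t_u}$, $u=0,\ldots,n$, and its Dynamic Chebyshev approximations $\widehat{V}_{t_u}$ be given as in the context, with $f$ Lipschitz continuous with constant $L_f$. Assume: (1) (Analyticity) for each $u=1,\ldots,n$ the function $\mathcal{X}\ni x\mapsto V_{t_u}(x)$ is real valued and has an analytic extension to a generalized Bernstein ellipse $\mathcal{B}(\mathcal{X},\varrho_{t_u})$ with $\varrho_{t_u}\in(1,\infty)^D$ and $\sup_{x\in\mathcal{B}(\mathcal{X},\varrho_{t_u})}|V_{t_u}(x)|\le B_{t_u}$; (2) (Truncation) there is a constant $\varepsilon_{tr}\ge0$ with $\big|\mathbb{E}[V_{t_{u+1}}(X_{t_{u+1}})\mathbf{1}_{\mathbb{R}^D\setminus\mathcal{X}}(X_{t_{u+1}})\mid X_{t_u}=x^k]\big|\le\varepsilon_{tr}$ for all $u=0,\ldots,n-1$ and $k\in\mathcal{J}$; (3) (Generalized moments) the approximations $\widehat{\Gamma}^k_{t_u}$ of the conditional expectation operators $\Gamma^k_{t_u}$ satisfy either the deterministic condition (GM) with constant $\overline{\delta}$, in which case put $\varepsilon_{gm}=\overline{\delta}$, or the stochastic condition (GM$^*$) with bound $\delta^\star(M)$, in which case put $\varepsilon_{gm}=\delta^\star(M)$. Let $\varepsilon_{t_u}:=\max_{x\in\mathcal{X}}\mathbb{E}\big[|V_{t_u}(x)-\widehat{V}_{t_u}(x)|\big]$ (in the deterministic case simply $\max_{x\in\mathcal{X}}|V_{t_u}(x)-\widehat{V}_{t_u}(x)|$). Then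 for every $u=1,\ldots,n$, $$\varepsilon_{t_u}\le\big(\varepsilon_{int}(\underline{\varrho},N,D,\overline{B})+\varepsilon_{tr}+\varepsilon_{gm}\overline{V}\big)\,\tilde{C}^{\,n+1-u},$$ where $\tilde{C}=\max\{2,C\}$, $C=\Lambda_{\overline{N}}L_f(1+\varepsilon_{gm})$, $\underline{\varrho}=\min_{1\le v\le n}\varrho_{t_v}$ (componentwise minimum), $\overline{B}=\max_{1\le v\le n}B_{t_v}$ and $\overline{V}=\max_{u\le j\le n}\max_{x\in\mathcal{X}}|V_{t_j}(x)|$. Moreover, suppose $\varepsilon_{tr}=0$, $L_f=1$ and $N_1=\ldots=N_D=N$ with $N\ge2$, and put $\varrho=\min_{1\le i\le D}\underline{\varrho}_i$. If (GM$^*$) holds with $\delta^\star(M)\le c/\sqrt{M}$ for a constant $c>0$ (independent of $N$ and $M$), then there are constants $\tilde{c}_1,\tilde{c}_2>0$, independent of $N$ and $M$, such that for all $u=1,\ldots,n$ $$\varepsilon_{t_u}\le\tilde{c}_1\,\varrho^{-N}\log(N)^{Dn}+\tilde{c}_2\,\log(N)^{Dn}M^{-0.5}.$$ If instead (GM) holds, then the same bound holds with $M^{-0.5}$ replaced by $\overline{\delta}$, with constants $\tilde c_1,\tilde c_2>0$ independent of $N$ and uniform for $\overline{\delta}$ in bounded sets.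
   Context: **Dynamic programming problem.** $X=(X_t)_{0\le t\le T}$ is a Markov process with state space $\mathbb{R}^D$, and conditional expectations $\mathbb{E}[\,\cdot\mid X_{t_u}=x]$ are understood through its transition kernels. Let $t_0<\ldots<t_n=T$ be time points, $g:[0,T]\times\mathbb{R}^D\to\mathbb{R}$ continuous with $\mathbb{E}[\sup_{0\le t\le T}|g(t,X_t)|]<\infty$, and $f:\mathbb{R}\times\mathbb{R}\to\mathbb{R}$ Lipschitz continuous with constant $L_f$ in the sense $|f(x_1,y_1)-f(x_2,y_2)|\le L_f(|x_1-x_2|+|y_1-y_2|)$. The value functions are $$V_T(x)=g(T,x),\qquad V_{t_u}(x)=f\big(g(t_u,x),\mathbb{E}[V_{t_{u+1}}(X_{t_{u+1}})\mid X_{t_u}=x]\big),\quad u=n-1,\ldots,0,$$ the conditional expectations being assumed to exist. **Chebyshev interpolation.** $\mathcal{X}=[\underline{x}_1,\overline{x}_1]\times\ldots\times[\underline{x}_D,\overline{x}_D]$, $\overline{N}=(N_1,\ldots,N_D)$ with integers $N_i\ge1$, $\mathcal{J}=\{j\in\mathbb{N}_0^D:0\le j_i\le N_i\}$. The affine map $\tau_{\mathcal{X}}:[-1,1]^D\to\mathcal{X}$ acts componentwise by $z_i\mapsto\overline{x}_i+\tfrac12(\underline{x}_i-\overline{x}_i)(1-z_i)$. $T_j(z)=\prod_iT_{j_i}(z_i)$, $T_m(y)=\cos(m\arccos y)$; $p_j(x)=T_j(\tau_{\mathcal{X}}^{-1}(x))\mathbf{1}_{\mathcal{X}}(x)$ (extended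 by $0$ outside $\mathcal{X}$). Nodes: $z^k=(\cos(\pi k_i/N_i))_{i=1}^D$, $x^k=\tau_{\mathcal{X}}(z^k)$, $k\in\mathcal{J}$. For values $h(x^k)$, $k\in\mathcal{J}$, the interpolant is $I_{\overline{N}}(h)=\sum_{j\in\mathcal{J}}c_jp_j$ with $c_j=\big(\prod_{i=1}^D\frac{2^{\mathbf{1}_{\{0<j_i<N_i\}}}}{N_i}\big)\sum_{k\in\mathcal{J}}''h(x^k)T_j(z^k)$, where $\sum''$ means the summand is multiplied by $1/2$ for each $i$ with $k_i\in\{0,N_i\}$; on $\mathcal{X}$ it is the unique tensor polynomial of degree $\le N_i$ in $x_i$ interpolating the values $h(x^k)$. Lebesgue constant: $\Lambda_{\overline{N}}=\max_{x\in\mathcal{X}}\sum_{j\in\mathcal{J}}|\lambda^j(x)|$, where $\lambda^j$ are the tensor-product Lagrange polynomials for the nodes $x^k$ (i.e. $\lambda^j(x^k)=1$ if $j=k$, $0$ otherwise). **Bernstein ellipses and interpolation bound.** For $r>1$, $\mathcal{B}([-1,1],r)\subset\mathbb{C}$ is the open region bounded by the ellipse with foci $\pm1$ whose semiaxis lengths sum to $r$; $\mathcal{B}([\underline{x},\overline{x}],r)$ is its image under $z\mapsto\overline{x}+\tfrac12(\underline{x}-\overline{x})(1-z)$; for $\varrho\in(1,\infty)^D$, $\mathcal{B}(\mathcal{X},\varrho)=\prod_{i=1}^D\mathcal{B}([\underline{x}_i,\overline{x}_i],\varrho_i)$. Further $$\varepsilon_{int}(\varrho,N,D,B):=2^{\frac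 D2+1}\cdot B\cdot\Big(\sum_{i=1}^D\varrho_i^{-2N_i}\prod_{j=1}^D\frac{1}{1-\varrho_j^{-2}}\Big)^{1/2}.$$ **Generalized moments.** $\Gamma^k_{t_u}(h):=\mathbb{E}[h(X_{t_{u+1}})\mid X_{t_u}=x^k]$, $u=0,\ldots,n-1$, $k\in\mathcal{J}$. Let $\mathcal{P}_{\overline{N}}(\mathcal{X})=\mathrm{span}\{p_j:j\in\mathcal{J}\}$ with norm $\|p\|_\infty=\max_{x\in\mathcal{X}}|p(x)|$. The operator $\Gamma^k_{t_u}$ is approximated on $\mathcal{P}_{\overline{N}}(\mathcal{X})$ by a linear operator $\widehat{\Gamma}^k_{t_u}:\mathcal{P}_{\overline{N}}(\mathcal{X})\to\mathbb{R}$, for which one of the following holds. (GM) The approximation is deterministic and for all $u=0,\ldots,n-1$, $k\in\mathcal{J}$: $\sup_{p\in\mathcal{P}_{\overline{N}}(\mathcal{X}),\,\|p\|_\infty=1}|\Gamma^k_{t_u}(p)-\widehat{\Gamma}^k_{t_u}(p)|\le\overline{\delta}$. (GM$^*$) The approximation is stochastic: $\widehat{\Gamma}^k_{t_u}$ is random (it uses $M\ge1$ samples of the underlying process), and the polynomials $p\in\mathcal{P}_{\overline{N}}(\mathcal{X})$ to which it is applied may have random coefficients; operators are applied to such $p$ realization-wise, by linearity in the coefficients ($\Gamma^k_{t_u}$ itself integrating only over the transition law of $X$). For all $u=0,\ldots,n-1$, $k\in\mathcal{J}$: $\sup_{p,\,\|p\|_\infty^\star=1}\mathbb{E}[|\Gamma^k_{t_u}(p)-\widehat{\Gamma}^k_{t_u}(p)|]\le\delta^\star(M)$,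 where $\|p\|_\infty^\star=\max_{x\in\mathcal{X}}\mathbb{E}[|p(x)|]$ and the supremum is over all polynomials in $\mathcal{P}_{\overline{N}}(\mathcal{X})$ with possibly random coefficients. **Dynamic Chebyshev method.** $\widehat{V}_T=I_{\overline{N}}(g(T,\cdot))$, and for $u=n-1,\ldots,0$ one sets the nodal values $\widehat{V}_{t_u}(x^k)=f\big(g(t_u,x^k),\widehat{\Gamma}^k_{t_u}(\widehat{V}_{t_{u+1}})\big)$, $k\in\mathcal{J}$, and lets $\widehat{V}_{t_u}\in\mathcal{P}_{\overline{N}}(\mathcal{X})$ be the Chebyshev interpolant of these nodal values. In the stochastic case $\widehat{V}_{t_u}$ is a polynomial with random coefficients. In the asymptotic statement, the problem data ($X$, $f$, $g$, $\mathcal{X}$, $D$, $n$, the time points, and the $\varrho_{t_u}$, $B_{t_u}$) are fixed while $N$ (and $M$, respectively $\overline{\delta}$) vary. *)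

theory Defs
  imports "HOL-Probability.Probability"
begin

section \<open>The dynamic programming problem\<close>

definition past_algebra :: "'p measure \<Rightarrow> (real \<Rightarrow> 'p \<Rightarrow> 'a::topological_space) \<Rightarrow> real \<Rightarrow> 'p measure" where
  "past_algebra P X s = sigma (space P) (\<Union>r\<in>{0..s}. {X r -` A \<inter> space P | A. A \<in> sets borel})"

text \<open>
  \<open>K s t x\<close> is the law of \<open>X t\<close> given \<open>X s = x\<close>. It is defined for every \<open>x\<close>, so conditional
  expectations given \<open>X s = x\<close> are integrals with respect to \<open>K s t x\<close>, with no null set left out.
\<close>

locale markov_process = prob_space P
  for P :: "'p measure" +
  fixes X :: "real \<Rightarrow> 'p \<Rightarrow> real^'d"
    and T :: real
    and K :: "real \<Rightarrow> real \<Rightarrow> real^'d \<Rightarrow> (real^'d) measure"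
  assumes X_measurable: "\<And>s. 0 \<le> s \<Longrightarrow> s \<le> T \<Longrightarrow> X s \<in> borel_measurable P"
    and K_kernel: "\<And>s t. 0 \<le> s \<Longrightarrow> s \<le> t \<Longrightarrow> t \<le> T \<Longrightarrow> K s t \<in> borel \<rightarrow>\<^sub>M prob_algebra borel"
    and markov: "\<And>s t A. 0 \<le> s \<Longrightarrow> s \<le> t \<Longrightarrow> t \<le> T \<Longrightarrow> A \<in> sets borel \<Longrightarrow>
      AE w in P. real_cond_exp P (past_algebra P X s) (indicator (X t -` A \<inter> space P)) w
                 = measure (K s t (X s w)) A"

locale dp_problem = markov_process P X T K
  for P :: "'p measure" and X :: "real \<Rightarrow> 'p \<Rightarrow> real^'d" and T K +
  fixes n :: nat
    and t :: "nat \<Rightarrow> real"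
    and g :: "real \<Rightarrow> real^'d \<Rightarrow> real"
    and f :: "real \<Rightarrow> real \<Rightarrow> real"
    and Lf :: real
    and V :: "nat \<Rightarrow> real^'d \<Rightarrow> real"
  assumes time_0: "0 \<le> t 0"
    and time_mono: "strict_mono_on {0..n} t"
    and time_n: "t n = T"
    and g_continuous: "continuous_on ({0..T} \<times> UNIV) (\<lambda>(s, x). g s x)"
    and g_sup_measurable: "(\<lambda>w. SUP s\<in>{0..T}. ennreal \<bar>g s (X s w)\<bar>) \<in> borel_measurable P"
    and g_sup_finite: "(\<integral>\<^sup>+w. (SUP s\<in>{0..T}. ennreal \<bar>g s (X s w)\<bar>) \<partial>P) < \<infinity>"
    and f_lipschitz: "\<And>x1 y1 x2 y2. \<bar>f x1 y1 - f x2 y2\<bar> \<le> Lf * (\<bar>x1 - x2\<bar> + \<bar>y1 - y2\<bar>)"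
    and V_integrable: "\<And>u x. u < n \<Longrightarrow> integrable (K (t u) (t (Suc u)) x) (V (Suc u))"
    and V_terminal: "\<And>x. V n x = g T x"
    and V_step: "\<And>u x. u < n \<Longrightarrow>
      V u x = f (g (t u) x) (\<integral>y. V (Suc u) y \<partial>K (t u) (t (Suc u)) x)"


section \<open>Chebyshev interpolation on a box\<close>

text \<open>
  The box is \<open>cbox lo hi\<close>. Multi-indices and degree vectors are functions \<open>'d \<Rightarrow> nat\<close>.
\<close>

definition multi_indices :: "('d::finite \<Rightarrow> nat) \<Rightarrow> ('d \<Rightarrow> nat) set" where
  "multi_indices N = {j. \<forall>i. j i \<le> N i}"

definition box_map :: "real^'d \<Rightarrow> real^'d \<Rightarrow> real^'d \<Rightarrow> real^'d" where
  "box_map lo hi z = (\<chi> i. hi $ i + 1/2 * (lo $ i - hi $ i) * (1 - z $ i))"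

definition cheb_poly :: "nat \<Rightarrow> real \<Rightarrow> real" where
  "cheb_poly m y = cos (real m * arccos y)"

definition cheb_tensor :: "('d::finite \<Rightarrow> nat) \<Rightarrow> real^'d \<Rightarrow> real" where
  "cheb_tensor j z = (\<Prod>i\<in>UNIV. cheb_poly (j i) (z $ i))"

definition cheb_basis :: "real^'d \<Rightarrow> real^'d \<Rightarrow> ('d \<Rightarrow> nat) \<Rightarrow> real^'d \<Rightarrow> real" where
  "cheb_basis lo hi j x =
     cheb_tensor j (inv_into (cbox (-1) 1) (box_map lo hi) x) * indicator (cbox lo hi) x"

definition ref_node :: "('d::finite \<Rightarrow> nat) \<Rightarrow> ('d \<Rightarrow> nat) \<Rightarrow> real^'d" where
  "ref_node N k = (\<chi> i. cos (pi * real (k i) / real (N i)))"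

definition cheb_node :: "real^'d \<Rightarrow> real^'d \<Rightarrow> ('d \<Rightarrow> nat) \<Rightarrow> ('d \<Rightarrow> nat) \<Rightarrow> real^'d" where
  "cheb_node lo hi N k = box_map lo hi (ref_node N k)"

text \<open>
  Coefficients and interpolant take the family of nodal values \<open>v k = h (cheb_node lo hi N k)\<close>
  instead of the function \<open>h\<close>.
\<close>

definition cheb_coeff :: "('d::finite \<Rightarrow> nat) \<Rightarrow> (('d \<Rightarrow> nat) \<Rightarrow> real) \<Rightarrow> ('d \<Rightarrow> nat) \<Rightarrow> real" where
  "cheb_coeff N v j =
     (\<Prod>i\<in>UNIV. (if 0 < j i \<and> j i < N i then 2 else 1) / real (N i)) *
     (\<Sum>k\<in>multi_indices N.
        (\<Prod>i\<in>UNIV. if k i = 0 \<or> k i = N i then 1/2 else 1) * (v k * cheb_tensor j (ref_node N k)))"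

definition cheb_interp ::
  "real^'d \<Rightarrow> real^'d \<Rightarrow> ('d \<Rightarrow> nat) \<Rightarrow> (('d \<Rightarrow> nat) \<Rightarrow> real) \<Rightarrow> real^'d \<Rightarrow> real" where
  "cheb_interp lo hi N v = (\<lambda>x. \<Sum>j\<in>multi_indices N. cheb_coeff N v j * cheb_basis lo hi j x)"

text \<open>The linear span of the functions \<open>cheb_basis lo hi j\<close>, \<open>j \<in> multi_indices N\<close>.\<close>

definition cheb_space :: "real^'d \<Rightarrow> real^'d \<Rightarrow> ('d \<Rightarrow> nat) \<Rightarrow> (real^'d \<Rightarrow> real) set" where
  "cheb_space lo hi N = {\<lambda>x. \<Sum>j\<in>multi_indices N. c j * cheb_basis lo hi j x | c. True}"

definition lagrange_poly ::
  "real^'d \<Rightarrow> real^'d \<Rightarrow> ('d \<Rightarrow> nat) \<Rightarrow> ('d \<Rightarrow> nat) \<Rightarrow> real^'d \<Rightarrow> real" where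
  "lagrange_poly lo hi N j x =
     (\<Prod>i\<in>UNIV. \<Prod>m\<in>{..N i} - {j i}.
        (x $ i - cheb_node lo hi N (\<lambda>_. m) $ i) /
        (cheb_node lo hi N j $ i - cheb_node lo hi N (\<lambda>_. m) $ i))"

definition lebesgue_const :: "real^'d \<Rightarrow> real^'d \<Rightarrow> ('d \<Rightarrow> nat) \<Rightarrow> real" where
  "lebesgue_const lo hi N =
     (SUP x\<in>cbox lo hi. \<Sum>j\<in>multi_indices N. \<bar>lagrange_poly lo hi N j x\<bar>)"

definition box_sup :: "real^'d \<Rightarrow> real^'d \<Rightarrow> (real^'d \<Rightarrow> real) \<Rightarrow> real" where
  "box_sup lo hi h = (SUP x\<in>cbox lo hi. \<bar>h x\<bar>)"

text \<open>
  The expectation is an extended nonnegative integral, so a non-integrable argument yields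
  \<open>\<infinity>\<close>, not the default value \<open>0\<close> of the Bochner integral.
\<close>

definition box_sup_mean ::
  "'w measure \<Rightarrow> real^'d \<Rightarrow> real^'d \<Rightarrow> ('w \<Rightarrow> real^'d \<Rightarrow> real) \<Rightarrow> ennreal" where
  "box_sup_mean Q lo hi h = (SUP x\<in>cbox lo hi. \<integral>\<^sup>+w. ennreal \<bar>h w x\<bar> \<partial>Q)"


section \<open>Analyticity on generalized Bernstein ellipses\<close>

text \<open>
  Semiaxes \<open>a > b\<close> with foci \<open>\<plusminus>1\<close> and \<open>a + b = r\<close> satisfy \<open>a\<^sup>2 - b\<^sup>2 = 1\<close>, hence
  \<open>2 * a = r + 1 / r\<close>, the sum of the distances of a boundary point to the foci.
\<close>

definition bernstein_ellipse :: "real \<Rightarrow> complex set" where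
  "bernstein_ellipse r = {z. cmod (z - 1) + cmod (z + 1) < r + 1 / r}"

definition bernstein_box :: "real^'d \<Rightarrow> real^'d \<Rightarrow> real^'d \<Rightarrow> (complex^'d) set" where
  "bernstein_box lo hi \<rho> =
     {z. \<forall>i. z $ i \<in> (\<lambda>w. of_real (hi $ i) + 1/2 * of_real (lo $ i - hi $ i) * (1 - w))
                      ` bernstein_ellipse (\<rho> $ i)}"

text \<open>
  Analyticity in several complex variables: near every point of \<open>S\<close> the function is the sum of a
  power series. The sum over multi-indices is unconditional, hence absolute.
\<close>

definition multi_analytic_on :: "(complex^'d \<Rightarrow> complex) \<Rightarrow> (complex^'d) set \<Rightarrow> bool" where
  "multi_analytic_on F S \<longleftrightarrow>
     (\<forall>w\<in>S. \<exists>r>0. \<exists>a :: ('d \<Rightarrow> nat) \<Rightarrow> complex. \<forall>z\<in>ball w r.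
        ((\<lambda>k. a k * (\<Prod>i\<in>UNIV. (z $ i - w $ i) ^ k i)) has_sum F z) UNIV)"

definition bounded_analytic_extension ::
  "real^'d \<Rightarrow> real^'d \<Rightarrow> real^'d \<Rightarrow> real \<Rightarrow> (real^'d \<Rightarrow> real) \<Rightarrow> bool" where
  "bounded_analytic_extension lo hi \<rho> B h \<longleftrightarrow>
     (\<exists>F. multi_analytic_on F (bernstein_box lo hi \<rho>) \<and>
          (\<forall>x\<in>cbox lo hi. F (\<chi> i. of_real (x $ i)) = of_real (h x)) \<and>
          (\<forall>z\<in>bernstein_box lo hi \<rho>. cmod (F z) \<le> B))"

definition eps_int :: "real^'d \<Rightarrow> ('d \<Rightarrow> nat) \<Rightarrow> real \<Rightarrow> real" where
  "eps_int \<rho> N B =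
     2 powr (real CARD('d) / 2 + 1) * B *
     sqrt (\<Sum>i\<in>UNIV. (\<rho> $ i) powr (- 2 * real (N i)) * (\<Prod>j\<in>UNIV. 1 / (1 - (\<rho> $ j) powr (- 2))))"


section \<open>Generalized moments and the dynamic Chebyshev approximation\<close>

definition gen_moment ::
  "(real \<Rightarrow> real \<Rightarrow> real^'d \<Rightarrow> (real^'d) measure) \<Rightarrow> (nat \<Rightarrow> real) \<Rightarrow> real^'d \<Rightarrow> real^'d \<Rightarrow> ('d \<Rightarrow> nat) \<Rightarrow>
   nat \<Rightarrow> ('d \<Rightarrow> nat) \<Rightarrow> (real^'d \<Rightarrow> real) \<Rightarrow> real" where
  "gen_moment K t lo hi N u k h = (\<integral>y. h y \<partial>K (t u) (t (Suc u)) (cheb_node lo hi N k))"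

definition truncation_bound ::
  "(real \<Rightarrow> real \<Rightarrow> real^'d \<Rightarrow> (real^'d) measure) \<Rightarrow> nat \<Rightarrow> (nat \<Rightarrow> real) \<Rightarrow> real^'d \<Rightarrow> real^'d \<Rightarrow> ('d \<Rightarrow> nat) \<Rightarrow>
   (nat \<Rightarrow> real^'d \<Rightarrow> real) \<Rightarrow> real \<Rightarrow> bool" where
  "truncation_bound K n t lo hi N V \<epsilon> \<longleftrightarrow>
     0 \<le> \<epsilon> \<and>
     (\<forall>u<n. \<forall>k\<in>multi_indices N.
        \<bar>gen_moment K t lo hi N u k (\<lambda>y. V (Suc u) y * indicator (UNIV - cbox lo hi) y)\<bar> \<le> \<epsilon>)"

definition linear_functional_on :: "('a \<Rightarrow> real) set \<Rightarrow> (('a \<Rightarrow> real) \<Rightarrow> real) \<Rightarrow> bool" where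
  "linear_functional_on S \<Phi> \<longleftrightarrow>
     (\<forall>p\<in>S. \<forall>q\<in>S. \<forall>a b. \<Phi> (\<lambda>x. a * p x + b * q x) = a * \<Phi> p + b * \<Phi> q)"

definition GM ::
  "(real \<Rightarrow> real \<Rightarrow> real^'d \<Rightarrow> (real^'d) measure) \<Rightarrow> nat \<Rightarrow> (nat \<Rightarrow> real) \<Rightarrow> real^'d \<Rightarrow> real^'d \<Rightarrow> ('d \<Rightarrow> nat) \<Rightarrow>
   (nat \<Rightarrow> ('d \<Rightarrow> nat) \<Rightarrow> (real^'d \<Rightarrow> real) \<Rightarrow> real) \<Rightarrow> real \<Rightarrow> bool" where
  "GM K n t lo hi N \<Gamma>h \<delta> \<longleftrightarrow>
     (\<forall>u<n. \<forall>k\<in>multi_indices N.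
        linear_functional_on (cheb_space lo hi N) (\<Gamma>h u k) \<and>
        (\<forall>p\<in>cheb_space lo hi N. box_sup lo hi p = 1 \<longrightarrow>
           \<bar>gen_moment K t lo hi N u k p - \<Gamma>h u k p\<bar> \<le> \<delta>))"

definition random_cheb_space ::
  "'w measure \<Rightarrow> real^'d \<Rightarrow> real^'d \<Rightarrow> ('d \<Rightarrow> nat) \<Rightarrow> ('w \<Rightarrow> real^'d \<Rightarrow> real) set" where
  "random_cheb_space Q lo hi N =
     {\<lambda>w x. \<Sum>j\<in>multi_indices N. c j w * cheb_basis lo hi j x | c.
        \<forall>j\<in>multi_indices N. c j \<in> borel_measurable Q}"

text \<open>
  \<open>Q\<close> carries the randomness of the samples. The requirement \<open>0 \<le> \<delta>\<close> is needed because
  \<open>ennreal\<close> maps negative numbers to \<open>0\<close>.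
\<close>

definition GM_star ::
  "'w measure \<Rightarrow> (real \<Rightarrow> real \<Rightarrow> real^'d \<Rightarrow> (real^'d) measure) \<Rightarrow> nat \<Rightarrow> (nat \<Rightarrow> real) \<Rightarrow> real^'d \<Rightarrow> real^'d \<Rightarrow>
   ('d \<Rightarrow> nat) \<Rightarrow> (nat \<Rightarrow> ('d \<Rightarrow> nat) \<Rightarrow> 'w \<Rightarrow> (real^'d \<Rightarrow> real) \<Rightarrow> real) \<Rightarrow> real \<Rightarrow> bool" where
  "GM_star Q K n t lo hi N \<Gamma>h \<delta> \<longleftrightarrow>
     prob_space Q \<and> 0 \<le> \<delta> \<and>
     (\<forall>u<n. \<forall>k\<in>multi_indices N.
        (\<forall>w\<in>space Q. linear_functional_on (cheb_space lo hi N) (\<Gamma>h u k w)) \<and>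
        (\<forall>p\<in>cheb_space lo hi N. (\<lambda>w. \<Gamma>h u k w p) \<in> borel_measurable Q) \<and>
        (\<forall>p\<in>random_cheb_space Q lo hi N. box_sup_mean Q lo hi p = 1 \<longrightarrow>
           (\<integral>\<^sup>+w. ennreal \<bar>gen_moment K t lo hi N u k (p w) - \<Gamma>h u k w (p w)\<bar> \<partial>Q) \<le> ennreal \<delta>))"

definition dynamic_chebyshev ::
  "nat \<Rightarrow> (nat \<Rightarrow> real) \<Rightarrow> (real \<Rightarrow> real^'d \<Rightarrow> real) \<Rightarrow> (real \<Rightarrow> real \<Rightarrow> real) \<Rightarrow>
   real^'d \<Rightarrow> real^'d \<Rightarrow> ('d \<Rightarrow> nat) \<Rightarrow> (nat \<Rightarrow> ('d \<Rightarrow> nat) \<Rightarrow> (real^'d \<Rightarrow> real) \<Rightarrow> real) \<Rightarrow>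
   (nat \<Rightarrow> real^'d \<Rightarrow> real) \<Rightarrow> bool" where
  "dynamic_chebyshev n t g f lo hi N \<Gamma>h Vh \<longleftrightarrow>
     Vh n = cheb_interp lo hi N (\<lambda>k. g (t n) (cheb_node lo hi N k)) \<and>
     (\<forall>u<n. Vh u = cheb_interp lo hi N
        (\<lambda>k. f (g (t u) (cheb_node lo hi N k)) (\<Gamma>h u k (Vh (Suc u)))))"

definition random_dynamic_chebyshev ::
  "'w measure \<Rightarrow> nat \<Rightarrow> (nat \<Rightarrow> real) \<Rightarrow> (real \<Rightarrow> real^'d \<Rightarrow> real) \<Rightarrow> (real \<Rightarrow> real \<Rightarrow> real) \<Rightarrow>
   real^'d \<Rightarrow> real^'d \<Rightarrow> ('d \<Rightarrow> nat) \<Rightarrow> (nat \<Rightarrow> ('d \<Rightarrow> nat) \<Rightarrow> 'w \<Rightarrow> (real^'d \<Rightarrow> real) \<Rightarrow> real) \<Rightarrow>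
   (nat \<Rightarrow> 'w \<Rightarrow> real^'d \<Rightarrow> real) \<Rightarrow> bool" where
  "random_dynamic_chebyshev Q n t g f lo hi N \<Gamma>h Vh \<longleftrightarrow>
     (\<forall>w\<in>space Q. dynamic_chebyshev n t g f lo hi N (\<lambda>u k. \<Gamma>h u k w) (\<lambda>u. Vh u w))"


section \<open>Constants of the error bound\<close>

definition rho_min :: "nat \<Rightarrow> (nat \<Rightarrow> real^'d) \<Rightarrow> real^'d" where
  "rho_min n \<rho> = (\<chi> i. Min ((\<lambda>v. \<rho> v $ i) ` {1..n}))"

definition B_max :: "nat \<Rightarrow> (nat \<Rightarrow> real) \<Rightarrow> real" where
  "B_max n B = Max (B ` {1..n})"

definition V_max :: "real^'d \<Rightarrow> real^'d \<Rightarrow> nat \<Rightarrow> (nat \<Rightarrow> real^'d \<Rightarrow> real) \<Rightarrow> nat \<Rightarrow> real" where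
  "V_max lo hi n V u = Max ((\<lambda>j. box_sup lo hi (V j)) ` {u..n})"

definition C_tilde :: "real^'d \<Rightarrow> real^'d \<Rightarrow> ('d \<Rightarrow> nat) \<Rightarrow> real \<Rightarrow> real \<Rightarrow> real" where
  "C_tilde lo hi N Lf \<epsilon>gm = max 2 (lebesgue_const lo hi N * Lf * (1 + \<epsilon>gm))"

end

theory Submission
  imports Defs "HOL-Complex_Analysis.Cauchy_Integral_Formula" "HOL-Computational_Algebra.Polynomial"
begin

text \<open>
  Write \<open>q = \<rho>\<^sup>-\<^sup>2\<close>. Let \<open>f\<close> be holomorphic and bounded by \<open>B\<close> on the Bernstein ellipse with parameter
  \<open>\<rho>\<close>. Cauchy's formula, transported to a circle by the Joukowski map, represents the error of the
  one-dimensional interpolant as an integral of \<open>f\<close> against a kernel whose Fourier coefficients are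
  the aliasing errors of the functions \<open>cos (m \<theta>)\<close>. These obey a recursion with step \<open>2 N\<close>, so that
  their square sum with weights \<open>q ^ m\<close> can be evaluated, and Cauchy--Schwarz gives
  \<open>\<bar>f - I f\<bar> \<le> 2 B sqrt (q ^ N (1 + q) / (1 - q))\<close>. Moreover \<open>\<bar>I f\<bar> \<le> B sqrt (2 / (1 - q))\<close>. As
  \<open>2 / (1 - q) = 1 + (1 + q) / (1 - q)\<close>, telescoping over the coordinates and applying Cauchy--Schwarz
  at each step reproduces \<open>\<epsilon>_int\<close> exactly, without losing a constant.

  Going back one time step multiplies the error by at most \<open>C\<close> and adds the interpolation error \<open>e\<close> and
  a multiple of \<open>A = \<epsilon>_tr + \<epsilon>_gm V_max\<close>; the invariant
  \<open>e (c ^ k - 1) + A (c ^ k - c)\<close> with \<open>c = C_tilde \<ge> 2\<close> absorbs both. A deterministic scheme is a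
  random one over a one-point probability space. Finally, the one-dimensional Lebesgue constant is
  at most a mean of cotangents, hence \<open>O(log N)\<close>.
\<close>

section \<open>Energy of the aliasing errors\<close>

text \<open>The obstacle is that the constant in \<open>eps_int\<close> is prescribed. It equals
  \<open>2 * B\<close> times the product of \<open>sqrt (2 / (1 - q_i))\<close> times the square
  root of the sum of \<open>q_i ^ N_i\<close>, so each coordinate already interpolated may cost
  exactly \<open>sqrt (2 / (1 - q_i))\<close>. The Lebesgue constant cannot be used for this cost,
  since it grows with the degree and no such growth occurs in \<open>eps_int\<close>; a norm bound
  uniform in the degree is needed, and its sharp form is what forces the numerical inequalities for
  exponentials and cotangents. For the same reason the aliasing errors are not summed in absolute
  value: for \<rho> near 1 this costs a factor of order \<open>1 / (\<rho> - 1)\<close>, whereas the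
  square sum costs only its square root. All one-dimensional work is done in the angle \<theta> with
  \<open>x = cos \<theta>\<close>, where interpolation becomes a cosine sum and the nodes form an
  equidistant grid.\<close>

lemma abs_sin_mult_le: "\<bar>sin (real n * x)\<bar> \<le> real n * \<bar>sin x\<bar>"
proof (induction n)
  case (Suc n)
  have "\<bar>sin (real (Suc n) * x)\<bar> = \<bar>sin (real n * x) * cos x + cos (real n * x) * sin x\<bar>"
    by (simp add: algebra_simps sin_add)
  also have "\<dots> \<le> \<bar>sin (real n * x)\<bar> * \<bar>cos x\<bar> + \<bar>cos (real n * x)\<bar> * \<bar>sin x\<bar>"
    by (metis abs_mult abs_triangle_ineq)
  also have "\<dots> \<le> \<bar>sin (real n * x)\<bar> * 1 + 1 * \<bar>sin x\<bar>"
    by (intro add_mono mult_mono) auto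
  also have "\<dots> \<le> real (Suc n) * \<bar>sin x\<bar>"
    using Suc by (simp add: algebra_simps)
  finally show ?case .
qed simp

text \<open>In the geometric sum of \<open>(p^2)^i\<close> over \<open>i < 2*N\<close>, the terms
  with indices i and 2N-1-i have product \<open>p ^ (2*(2*N-1))\<close>, so each such pair is at
  least twice \<open>p ^ (2*N-1)\<close>. The purpose is to cancel a factor N that arises from
  estimating sin(N\<theta>) by N |sin \<theta>|.\<close>

lemma geometric_am_gm:
  fixes p :: real
  assumes p: "0 \<le> p" "p \<le> 1"
  shows "2 * real N * p ^ (2 * N-1) * (1 - p^2) \<le> 1 - p ^ (4 * N)"
proof -
  have g: "(1 - p^2) * (\<Sum>i<2 * N. (p^2)^i) = 1 - (p^2)^(2 * N)"
    by (rule one_diff_power_eq[symmetric])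
  have "(\<Sum>i<2 * N. (p^2)^i) = (\<Sum>i<2 * N. (p^2)^(2 * N - Suc i))"
    by (rule sum.nat_diff_reindex[symmetric])
  then have "2 * (\<Sum>i<2 * N. (p^2)^i) = (\<Sum>i<2 * N. (p^2)^i + (p^2)^(2 * N - Suc i))"
    by (simp add: sum.distrib)
  also have "\<dots> \<ge> (\<Sum>i<2 * N. 2 * p ^ (2 * N-1))"
  proof (rule sum_mono)
    fix i assume "i \<in> {..<2 * N}"
    then have "i + (2 * N - Suc i) = 2 * N-1" by auto
    then have "p ^ (2 * N-1) = p^i * p^(2 * N - Suc i)" by (metis power_add)
    then show "2 * p ^ (2 * N-1) \<le> (p^2)^i + (p^2)^(2 * N - Suc i)"
      using sum_squares_bound[of "p^i" "p^(2 * N - Suc i)"]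
      by (simp add: power_mult[symmetric] mult.commute)
  qed
  finally have "2 * real N * p ^ (2 * N-1) \<le> (\<Sum>i<2 * N. (p^2)^i)" by simp
  then have "2 * real N * p ^ (2 * N-1) * (1 - p^2) \<le> (1 - p^2) * (\<Sum>i<2 * N. (p^2)^i)"
    using p by (subst mult.commute) (intro mult_left_mono, auto simp: power_le_one)
  also have "\<dots> = 1 - p ^ (4 * N)" unfolding g by (simp add: power_mult[symmetric])
  finally show ?thesis .
qed

text \<open>Right side minus left side is
  \<open>(h-Q)^2*(1+Q*h) + Q*(1-Q^2)*h - Q^2*(h+Q)*(h-Q)\<close>. Only the last term can be
  negative, for h > Q, and the middle one then dominates it. In the application h is
  |cos(N\<theta>)| and Q is \<open>q ^ N\<close>.\<close>

lemma poly_Q_eta: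
  fixes Q h :: real
  assumes "0 \<le> Q" "Q \<le> 1" "0 \<le> h" "h \<le> 1"
  shows "(1 - h^2) * (1 + Q^2 + Q * h) \<le> (1 - Q^2)^2 + 4 * Q^2 * (1 - h^2)"
proof -
  have "Q^2 * ((h+Q) * (h-Q)) \<le> Q * (1-Q^2) * h"
  proof (cases "h \<le> Q")
    case True
    then have "Q^2 * ((h+Q) * (h-Q)) \<le> 0"
      using assms by (intro mult_nonneg_nonpos) auto
    also have "0 \<le> Q * (1-Q^2) * h" using assms by (simp add: power_le_one)
    finally show ?thesis .
  next
    case False
    have "(h+Q) * (h-Q) \<le> 1 - Q^2" using assms by (simp add: algebra_simps power2_eq_square mult_le_one)
    then have "(Q * Q) * ((h+Q) * (h-Q)) \<le> (Q * h) * (1-Q^2)"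
      using assms False by (intro mult_mono) auto
    then show ?thesis by (simp add: power2_eq_square algebra_simps)
  qed
  moreover have "0 \<le> (h-Q)^2 * (1 + Q * h)" using assms by simp
  moreover have "(1 - Q^2)^2 + 4 * Q^2 * (1 - h^2) - (1 - h^2) * (1 + Q^2 + Q * h)
      = (h-Q)^2 * (1 + Q * h) + Q * (1-Q^2) * h - Q^2 * ((h+Q) * (h-Q))"
    by (simp add: algebra_simps power2_eq_square power4_eq_xxxx power3_eq_cube)
  ultimately show ?thesis by linarith
qed

text \<open>The bound on the energy of the aliasing errors comes down to this inequality. Here p is
  the square root of q, so that odd powers of p are available. The cross term is estimated through
  |sin(N\<theta>)| \<le> N |sin \<theta>|, the factor N is removed by
  \<open>geometric_am_gm\<close>, and \<open>4*q*s^2 \<le> d\<close> removes the remaining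
  dependence on \<theta>; a polynomial inequality in Q and |cos(N\<theta>)| is left.\<close>

lemma kernel_trig_bound:
  fixes p \<theta> :: real and N :: nat
  assumes p: "0 < p" "p < 1" and N: "0 < N"
  defines "q \<equiv> p^2" and "Q \<equiv> p^(2 * N)" and "s \<equiv> sin \<theta>" and "S \<equiv> sin (real N * \<theta>)"
    and "c \<equiv> cos \<theta>" and "C \<equiv> cos (real N * \<theta>)"
  defines "y \<equiv> Q^2" and "d \<equiv> (1 - q)^2 + 4 * q * s^2"
  shows "2 * S^2 * (2 * q * (1+q) * (1+y) * s^2/((1-q) * d) + 8 * q * y * s * c * S * C/((1-y) * d))
       \<le> (1+q)/(1-q) * ((1-y)^2 + 4 * y * S^2)"
proof -
  have q: "0 < q" "q < 1" unfolding q_def using p by (auto simp: power_less_one_iff)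
  have Q: "0 < Q" "Q < 1" unfolding Q_def using p N by (auto simp: power_less_one_iff)
  have y: "0 < y" "y < 1" unfolding y_def using Q by (auto simp: power_less_one_iff)
  have d: "0 < d" unfolding d_def using q by (intro add_pos_nonneg) auto
  have d2: "4 * q * s^2 \<le> d" unfolding d_def by simp
  define h where "h = \<bar>C\<bar>"
  have h: "0 \<le> h" "h \<le> 1" "S^2 = 1 - h^2" unfolding h_def C_def S_def by (auto simp: sin_squared_eq)
  have amgm: "2 * real N * p^(2 * N-1) * (1-q) \<le> 1 - y"
    using geometric_am_gm[of p N] p unfolding q_def y_def Q_def by (simp add: power_mult[symmetric] mult.commute)
  have pQ: "p * p^(2 * N-1) = Q" unfolding Q_def using N by (cases N) auto
  have "(1-q) * (s * c * S * C) \<le> (1-q) * (\<bar>s\<bar> * 1 * (real N * \<bar>s\<bar>) * h)"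
  proof -
    have "s * c * S * C \<le> \<bar>s\<bar> * \<bar>c\<bar> * \<bar>S\<bar> * \<bar>C\<bar>"
      by (metis abs_ge_self abs_mult)
    also have "\<dots> \<le> \<bar>s\<bar> * 1 * (real N * \<bar>s\<bar>) * h"
      unfolding h_def s_def S_def c_def
      by (intro mult_mono abs_sin_mult_le) auto
    finally show ?thesis using q by simp
  qed
  then have "2 * p^(2 * N-1) * ((1-q) * (s * c * S * C)) \<le> 2 * p^(2 * N-1) * ((1-q) * (\<bar>s\<bar> * 1 * (real N * \<bar>s\<bar>) * h))"
    using p by simp
  also have "\<dots> = (2 * real N * p^(2 * N-1) * (1-q)) * (s^2 * h)"
    by (simp add: power2_eq_square)
  also have "\<dots> \<le> (1-y) * (s^2 * h)"
    using amgm h by (intro mult_right_mono) auto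
  finally have "2 * Q * ((1-q) * (s * c * S * C)) \<le> p * ((1-y) * (s^2 * h))"
    unfolding pQ[symmetric] using p by simp
  \<comment> \<open>The odd power of p is traded for a polynomial in q by p \<le> (1 +
    p^2)/2.\<close>
  also have "\<dots> \<le> (1+q)/2 * ((1-y) * (s^2 * h))"
  proof (rule mult_right_mono)
    show "p \<le> (1+q)/2" unfolding q_def using sum_squares_bound[of p 1] by simp
  qed (use y h in auto)
  finally have "4 * Q * (1-q) * (s * c * S * C) \<le> (1+q) * (1-y) * (s^2 * h)"
    by simp
  from mult_left_mono[OF this, of "2 * Q * q"]
  have key: "8 * q * y * s * c * S * C * (1-q) \<le> 2 * q * (1+q) * (Q * h) * s^2 * (1-y)"
    using q Q unfolding y_def by (simp add: power2_eq_square algebra_simps)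
  then have "8 * q * y * s * c * S * C/((1-y) * d) \<le> 2 * q * (1+q) * (Q * h) * s^2/((1-q) * d)"
    using q y d by (simp add: divide_simps)
  then have "2 * q * (1+q) * (1+y) * s^2/((1-q) * d) + 8 * q * y * s * c * S * C/((1-y) * d)
      \<le> 2 * q * (1+q) * (1+y) * s^2/((1-q) * d) + 2 * q * (1+q) * (Q * h) * s^2/((1-q) * d)" by simp
  also have "\<dots> = (4 * q * s^2) * ((1+q) * (1+y+Q * h)) / (2 * (1-q) * d)"
  proof -
    have "1 - q \<noteq> 0" "d \<noteq> 0" using q d by auto
    then show ?thesis by (simp add: add_divide_distrib[symmetric] frac_eq_eq) algebra
  qed
  also have "\<dots> \<le> d * ((1+q) * (1+y+Q * h)) / (2 * (1-q) * d)"
    using q d d2 y Q h by (intro divide_right_mono mult_right_mono) auto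
  also have "\<dots> = (1+q)/(1-q) * (1+y+Q * h) / 2" using d q by (simp add: field_simps)
  finally have "2 * S^2 * (2 * q * (1+q) * (1+y) * s^2/((1-q) * d) + 8 * q * y * s * c * S * C/((1-y) * d))
      \<le> 2 * S^2 * ((1+q)/(1-q) * (1+y+Q * h) / 2)"
    by (rule mult_left_mono) auto
  also have "\<dots> = (1+q)/(1-q) * ((1 - h^2) * (1 + Q^2 + Q * h))"
    using q unfolding h(3) y_def by (simp add: field_simps)
  also have "\<dots> \<le> (1+q)/(1-q) * ((1-y)^2 + 4 * y * S^2)"
    unfolding h(3) y_def using q Q h by (intro mult_left_mono poly_Q_eta) auto
  finally show ?thesis .
qed

section \<open>Closed form of the weighted square sum\<close>

lemma sums_shift_if:
  fixes f :: "nat \<Rightarrow> 'a::real_normed_vector"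
  assumes "(\<lambda>i. f (i + n)) sums l"
  shows "(\<lambda>i. if n \<le> i then f i else 0) sums l"
  using assms sums_zero_iff_shift[of n "\<lambda>i. if n \<le> i then f i else 0" l] by simp

lemma summable_bounded_geometric:
  fixes f :: "nat \<Rightarrow> 'a::banach"
  assumes "\<And>i. norm (f i) \<le> K * q ^ i" "0 \<le> q" "q < 1"
  shows "summable f"
  by (rule summable_comparison_test'[of "\<lambda>i. K * q ^ i" 0])
     (use assms in \<open>auto intro!: summable_mult summable_geometric\<close>)

text \<open>Squaring the recursion turns the shift by 2N into a factor \<open>y = q ^ (2*N)\<close>,
  so the square sum W satisfies a linear equation. Its cross term is the imaginary part of
  \<open>w * Y\<close>, where Y is the generating series of b along
  \<open>cis (i * \<theta>)\<close>; Y satisfies a linear equation of its own by the same recursion.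
  Both can be solved explicitly. The uniform bound K serves convergence only and leaves no trace in
  the estimate.\<close>

lemma aliasing_energy_bound:
  fixes b :: "nat \<Rightarrow> real" and N :: nat and q \<theta> K :: real
  assumes N: "0 < N" and q: "0 < q" "q < 1" and bd: "\<And>i. \<bar>b i\<bar> \<le> K"
    and rec: "\<And>i. b i = (if 2 * N \<le> i then b (i - 2 * N) else 0)
                        - 2 * sin (real N * \<theta>) * sin (real i * \<theta>)"
  shows "summable (\<lambda>i. (b i)\<^sup>2 * q ^ i)" "(\<Sum>i. (b i)\<^sup>2 * q ^ i) \<le> (1 + q) / (1 - q)"
proof -
  define S where "S = sin (real N * \<theta>)"
  define C where "C = cos (real N * \<theta>)"
  define s where "s = sin \<theta>"
  define c where "c = cos \<theta>"
  define Q where "Q = q ^ N"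
  define y where "y = Q^2"
  define w where "w = cis (2 * real N * \<theta>)"
  define \<omega> where "\<omega> = cis (2 * \<theta>)"
  define G where "G = 1 / (1 - of_real q) - 1 / (1 - of_real q * \<omega>)"
  define a where "a i = (if 2 * N \<le> i then b (i - 2 * N) else 0)" for i
  have Q: "0 < Q" "Q < 1" unfolding Q_def using q N by (auto simp: power_less_one_iff)
  have y: "0 < y" "y < 1" unfolding y_def using Q by (auto simp: power_less_one_iff)
  have qy: "q ^ (2 * N) = y" unfolding y_def Q_def by (simp add: power_mult[symmetric] mult.commute)
  have K: "0 \<le> K" using bd[of 0] by linarith
  have b: "b i = a i - 2 * S * sin (real i * \<theta>)" for i
    unfolding a_def S_def by (rule rec)
  \<comment> \<open>One geometric series serves twice: its real part is twice the series of
    \<open>sin^2\<close>, and multiplied by \<i>/2 it is the series of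
    \<open>sin x * cis x\<close>.\<close>
  have Gs: "(\<lambda>i. of_real q ^ i * (1 - cis (2 * (real i * \<theta>)))) sums G"
  proof -
    have "(\<lambda>i. of_real q ^ i - (of_real q * \<omega>) ^ i) sums G"
      unfolding G_def \<omega>_def using q
      by (intro sums_diff geometric_sums) (auto simp: norm_mult)
    moreover have "of_real q ^ i - (of_real q * \<omega>) ^ i = of_real q ^ i * (1 - cis (2 * (real i * \<theta>)))" for i
      unfolding \<omega>_def by (simp add: power_mult_distrib Complex.DeMoivre algebra_simps)
    ultimately show ?thesis by simp
  qed
  have s2: "(\<lambda>i. (sin (real i * \<theta>))\<^sup>2 * q ^ i) sums (Re G / 2)"
  proof -
    have "(\<lambda>i. Re (of_real q ^ i * (1 - cis (2 * (real i * \<theta>)))) / 2) sums (Re G / 2)"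
      by (intro sums_divide sums_Re Gs)
    moreover have "Re (of_real q ^ i * (1 - cis (2 * (real i * \<theta>)))) / 2 = (sin (real i * \<theta>))\<^sup>2 * q ^ i" for i
      by (simp add: cos_double_sin)
    ultimately show ?thesis by (simp only:)
  qed
  have sc: "(\<lambda>i. of_real (sin (real i * \<theta>) * q ^ i) * cis (real i * \<theta>)) sums (\<i> / 2 * G)"
  proof -
    have "of_real (sin (real i * \<theta>) * q ^ i) * cis (real i * \<theta>)
        = \<i> / 2 * (of_real q ^ i * (1 - cis (2 * (real i * \<theta>))))" for i
      by (rule complex_eqI; simp add: sin_double cos_double_sin power2_eq_square)
    then show ?thesis using sums_mult[OF Gs, of "\<i> / 2"] by (simp only:)
  qed
  define Y where "Y = (\<Sum>i. of_real (b i * q ^ i) * cis (real i * \<theta>))"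
  have Ys: "(\<lambda>i. of_real (b i * q ^ i) * cis (real i * \<theta>)) sums Y"
    unfolding Y_def
    by (intro summable_sums summable_bounded_geometric[of _ K q])
       (use q bd in \<open>auto simp: norm_mult norm_power abs_mult intro!: mult_right_mono\<close>)
  have cis_shift: "cis (real (i + 2 * N) * \<theta>) = w * cis (real i * \<theta>)" for i
    unfolding w_def cis_mult by (simp add: algebra_simps)
  have aYs: "(\<lambda>i. of_real (a i * q ^ i) * cis (real i * \<theta>)) sums (of_real y * w * Y)"
  proof -
    have "(\<lambda>i. of_real (b (i + 2 * N - 2 * N) * q ^ (i + 2 * N)) * cis (real (i + 2 * N) * \<theta>)) sums (of_real y * w * Y)"
    proof -
      have "of_real (b (i + 2 * N - 2 * N) * q ^ (i + 2 * N)) * cis (real (i + 2 * N) * \<theta>)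
          = of_real y * w * (of_real (b i * q ^ i) * cis (real i * \<theta>))" for i
        unfolding cis_shift power_add qy by simp
      then show ?thesis using sums_mult[OF Ys, of "of_real y * w"] by (simp only:)
    qed
    from sums_shift_if[where f = "\<lambda>i. of_real (b (i - 2 * N) * q ^ i) * cis (real i * \<theta>)", OF this]
    show ?thesis unfolding a_def by (rule sums_cong[THEN iffD1, rotated]) auto
  qed
  have "Y = of_real y * w * Y - 2 * of_real S * (\<i> / 2 * G)"
  proof (rule sums_unique2[OF Ys])
    have "of_real (b i * q ^ i) * cis (real i * \<theta>) = of_real (a i * q ^ i) * cis (real i * \<theta>)
        - 2 * of_real S * (of_real (sin (real i * \<theta>) * q ^ i) * cis (real i * \<theta>))" for i
      unfolding b[of i] by (simp add: algebra_simps)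
    then show "(\<lambda>i. of_real (b i * q ^ i) * cis (real i * \<theta>)) sums (of_real y * w * Y - 2 * of_real S * (\<i> / 2 * G))"
      using sums_diff[OF aYs sums_mult[OF sc, of "2 * of_real S"]] by (simp only:)
  qed
  then have Y1: "Y * (1 - of_real y * w) = - \<i> * of_real S * G" by (simp add: algebra_simps)
  have ny: "1 - of_real y * w \<noteq> 0"
  proof
    assume "1 - of_real y * w = 0"
    then have "norm (of_real y * w) = 1" by (metis eq_iff_diff_eq_0 norm_one)
    then show False unfolding w_def using y by (simp add: norm_mult)
  qed
  have aS: "(\<lambda>i. a i * sin (real i * \<theta>) * q ^ i) sums (y * Im (w * Y))"
    using sums_Im[OF aYs] by (simp add: mult_ac algebra_simps)
  define W where "W = (\<Sum>i. (b i)\<^sup>2 * q ^ i)"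
  show sm: "summable (\<lambda>i. (b i)\<^sup>2 * q ^ i)"
  proof (rule summable_bounded_geometric[of _ "K^2" q])
    fix i show "norm ((b i)\<^sup>2 * q ^ i) \<le> K\<^sup>2 * q ^ i"
      using q bd[of i] K by (auto simp: abs_le_square_iff[symmetric] abs_mult intro!: mult_right_mono)
  qed (use q in auto)
  then have Ws: "(\<lambda>i. (b i)\<^sup>2 * q ^ i) sums W" unfolding W_def by (rule summable_sums)
  have aWs: "(\<lambda>i. (a i)\<^sup>2 * q ^ i) sums (y * W)"
  proof -
    have "(\<lambda>i. (b (i + 2 * N - 2 * N))\<^sup>2 * q ^ (i + 2 * N)) sums (y * W)"
    proof -
      have "(b (i + 2 * N - 2 * N))\<^sup>2 * q ^ (i + 2 * N) = y * ((b i)\<^sup>2 * q ^ i)" for i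
        unfolding power_add qy by simp
      then show ?thesis using sums_mult[OF Ws, of y] by (simp only:)
    qed
    from sums_shift_if[where f = "\<lambda>i. (b (i - 2 * N))\<^sup>2 * q ^ i", OF this]
    show ?thesis unfolding a_def by (rule sums_cong[THEN iffD1, rotated]) auto
  qed
  have "W = y * W - 4 * S * (y * Im (w * Y)) + 4 * S^2 * (Re G / 2)"
  proof (rule sums_unique2[OF Ws])
    have "(b i)\<^sup>2 * q ^ i = (a i)\<^sup>2 * q ^ i - 4 * S * (a i * sin (real i * \<theta>) * q ^ i)
        + 4 * S^2 * ((sin (real i * \<theta>))\<^sup>2 * q ^ i)" for i
      unfolding b[of i] by (simp add: algebra_simps power2_eq_square)
    then show "(\<lambda>i. (b i)\<^sup>2 * q ^ i) sums (y * W - 4 * S * (y * Im (w * Y)) + 4 * S^2 * (Re G / 2))"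
      using sums_add[OF sums_diff[OF aWs sums_mult[OF aS, of "4 * S"]] sums_mult[OF s2, of "4 * S^2"]] by (simp only:)
  qed
  then have W1: "W * (1 - y) = 2 * S^2 * Re G - 4 * S * (y * Im (w * Y))" by (simp add: algebra_simps)
  define d where "d = (1 - q)^2 + 4 * q * s^2"
  define D where "D = (1 - y)^2 + 4 * y * S^2"
  have d0: "0 < d" unfolding d_def using q by (intro add_pos_nonneg) auto
  have D0: "0 < D" unfolding D_def using y by (intro add_pos_nonneg) auto
  have \<omega>_ReIm: "Re \<omega> = 1 - 2 * s^2" "Im \<omega> = 2 * s * c"
    unfolding \<omega>_def s_def c_def by (simp_all add: cos_double_sin sin_double)
  have w_ReIm: "Re w = 1 - 2 * S^2" "Im w = 2 * S * C"
    unfolding w_def S_def C_def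
    by (simp_all add: cos_double_sin[of "real N * \<theta>", folded mult.assoc] sin_double[of "real N * \<theta>", folded mult.assoc])
  have sc1: "s^2 + c^2 = 1" "S^2 + C^2 = 1" unfolding s_def c_def S_def C_def by simp_all
  \<comment> \<open>d and D are the squared moduli of the denominators
    \<open>1 - q * \<omega>\<close> and \<open>1 - y * w\<close>; multiplying with the conjugates
    makes G and Y rational in the trigonometric values.\<close>
  have d_cmod: "(1 - of_real q * \<omega>) * cnj (1 - of_real q * \<omega>) = of_real d"
    unfolding complex_mult_cnj d_def of_real_eq_iff
    by (simp add: \<omega>_ReIm) (use sc1(1) in algebra)
  have D_cmod: "(1 - of_real y * w) * cnj (1 - of_real y * w) = of_real D"
    unfolding complex_mult_cnj D_def of_real_eq_iff
    by (simp add: w_ReIm) (use sc1(2) in algebra)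
  have n\<omega>: "1 - of_real q * \<omega> \<noteq> 0" using d_cmod d0 by force
  have recip: "1 / z = cnj z / (z * cnj z)" if "z \<noteq> 0" for z :: complex
    using that by simp
  have G1: "G = of_real (1 / (1 - q)) - cnj (1 - of_real q * \<omega>) / of_real d"
    unfolding G_def d_cmod[symmetric] recip[OF n\<omega>] by (simp only: of_real_divide of_real_diff of_real_1)
  have ReG: "Re G = 2 * q * (1 + q) * s^2 / ((1 - q) * d)"
  proof -
    have "Re G = 1 / (1 - q) - (1 - q * (1 - 2 * s^2)) / d"
      unfolding G1 by (simp add: \<omega>_ReIm Re_divide_of_real del: of_real_divide of_real_diff)
    also have "\<dots> = (d - (1 - q * (1 - 2 * s^2)) * (1 - q)) / ((1 - q) * d)"
      using q d0 by (simp add: field_simps)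
    also have "d - (1 - q * (1 - 2 * s^2)) * (1 - q) = 2 * q * (1 + q) * s^2"
      unfolding d_def by algebra
    finally show ?thesis .
  qed
  have ImG: "Im G = - 2 * q * s * c / d"
    unfolding G1
    by (simp add: \<omega>_ReIm Im_divide_of_real del: of_real_divide of_real_diff)
  have "Im (w * Y) = - S * ((Re G * (Re w - y) - Im G * Im w) / D)"
  proof -
    have "w * Y = - \<i> * of_real S * (G * w / (1 - of_real y * w))"
    proof -
      have "w * Y = w * (Y * (1 - of_real y * w)) / (1 - of_real y * w)" using ny by simp
      also have "\<dots> = - \<i> * of_real S * (G * w / (1 - of_real y * w))" unfolding Y1 by simp
      finally show ?thesis .
    qed
    also have "G * w / (1 - of_real y * w) = G * w * (1 / (1 - of_real y * w))" by simp
    also have "\<dots> = G * (w * cnj (1 - of_real y * w)) / of_real D"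
      unfolding D_cmod[symmetric] recip[OF ny] by (simp only: times_divide_eq_right mult.assoc)
    also have "w * cnj (1 - of_real y * w) = w - of_real y"
      unfolding w_def by (simp add: algebra_simps cis_cnj cis_mult)
    finally have e: "w * Y = - \<i> * of_real S * (G * (w - of_real y) / of_real D)" .
    show ?thesis unfolding e by (simp add: Re_divide_of_real Im_divide_of_real)
  qed
  then have "Im (w * Y) * D = - S * (Re G * (Re w - y) - Im G * Im w)"
    using D0 by (simp only: times_divide_eq_right nonzero_divide_eq_eq mult.assoc) simp
  then have "W * (1 - y) * D = 2 * S^2 * (Re G * (D + 2 * y * (1 - 2 * S^2 - y)) - 2 * y * Im G * (2 * S * C))"
    unfolding W1 w_ReIm by algebra
  \<comment> \<open>This factorisation cancels the factor \<open>1 - y\<close> in the main term, so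
    that division by \<open>1 - y\<close> leaves it regular.\<close>
  also have "D + 2 * y * (1 - 2 * S^2 - y) = (1 + y) * (1 - y)"
    unfolding D_def by algebra
  finally have WD: "W * (1 - y) * D = 2 * S^2 * (Re G * ((1 + y) * (1 - y)) - 2 * y * Im G * (2 * S * C))" .
  have y0: "1 - y \<noteq> 0" using y by simp
  have "W * D = (W * (1 - y) * D) / (1 - y)" using y0 by simp
  also have "\<dots> = 2 * S^2 * (Re G * (1 + y) - 2 * y * Im G * (2 * S * C) / (1 - y))"
  proof -
    have "k * (R * (v * u) - x) / u = k * (R * v - x / u)" if "u \<noteq> 0" for k R v u x :: real
      using that by (simp add: field_simps)
    then show ?thesis unfolding WD using y0 by blast
  qed
  also have "\<dots> = 2 * S^2 * (2 * q * (1+q) * (1+y) * s^2/((1-q) * d) + 8 * q * y * s * c * S * C/((1-y) * d))"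
    unfolding ReG ImG by (simp add: mult_ac)
  also have "\<dots> \<le> (1+q)/(1-q) * D"
  proof -
    have sq: "sqrt q ^ 2 = q" "sqrt q ^ (2 * N) = Q" unfolding Q_def using q by (simp_all add: power_mult)
    have "0 < sqrt q" "sqrt q < 1" using q by auto
    from kernel_trig_bound[OF this N, of \<theta>] show ?thesis
      unfolding sq unfolding D_def d_def y_def s_def c_def S_def C_def .
  qed
  finally show "(\<Sum>i. (b i)\<^sup>2 * q ^ i) \<le> (1 + q) / (1 - q)"
    unfolding W_def[symmetric] by (rule mult_right_le_imp_le[OF _ D0])
qed

section \<open>The Lobatto kernel and the Lebesgue constant\<close>

text \<open>These are the trapezoidal weights on the angle grid. They encode the halving in the
  double-primed sum over nodes and, when doubled, the factor that distinguishes inner from extreme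
  coefficients.\<close>

definition lobatto_weight :: "nat \<Rightarrow> nat \<Rightarrow> real" where
  "lobatto_weight N j = (if j = 0 \<or> j = N then 1/2 else 1)"

text \<open>The modified Dirichlet kernel: away from multiples of 2\<pi> it equals
  \<open>sin (N*x) * cot (x/2) / (2*N)\<close>. On the grid of spacing \<pi>/N it takes the value 1
  at multiples of 2\<pi> and 0 elsewhere.\<close>

definition lobatto_kernel :: "nat \<Rightarrow> real \<Rightarrow> real" where
  "lobatto_kernel N x = (\<Sum>j\<le>N. lobatto_weight N j * cos (real j * x)) / real N"

definition lobatto_angle :: "nat \<Rightarrow> nat \<Rightarrow> real" where
  "lobatto_angle N k = pi * real k / real N"

text \<open>This is the one-dimensional coefficient formula applied to the unit vector at node k and
  evaluated at \<open>cos \<theta>\<close>: the Lagrange basis polynomial in the angle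
  variable.\<close>

definition lobatto_cardinal :: "nat \<Rightarrow> nat \<Rightarrow> real \<Rightarrow> real" where
  "lobatto_cardinal N k \<theta> = lobatto_weight N k * (2 / real N) *
     (\<Sum>j\<le>N. lobatto_weight N j * cos (real j * lobatto_angle N k) * cos (real j * \<theta>))"

text \<open>Written as averages over neighbouring points, the trapezoidal sum telescopes against the
  kernel, and the Lebesgue sum below splits into two full sums displaced by one grid step.\<close>

lemma sum_lobatto_weight:
  assumes "0 < N"
  shows "(\<Sum>j\<le>N. lobatto_weight N j * f j) = (\<Sum>j<N. (f j + f (Suc j)) / 2)"
proof -
  obtain n where N: "N = Suc n" using assms by (cases N) auto
  have "(\<Sum>j\<le>N. lobatto_weight N j * f j) = f 0 / 2 + (\<Sum>j<n. f (Suc j)) + f N / 2"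
  proof -
    have "(\<Sum>j<n. lobatto_weight N (Suc j) * f (Suc j)) = (\<Sum>j<n. f (Suc j))"
      by (intro sum.cong) (auto simp: lobatto_weight_def N)
    then show ?thesis unfolding N sum.atMost_Suc sum.atMost_shift by (simp add: lobatto_weight_def)
  qed
  also have "(\<Sum>j<n. f (Suc j)) = (\<Sum>j<n. f (Suc j)) / 2 + (\<Sum>j<n. f (Suc j)) / 2" by simp
  also have "f 0 / 2 + \<dots> + f N / 2 = ((\<Sum>j<N. f j) + (\<Sum>j<N. f (Suc j))) / 2"
    unfolding N sum.lessThan_Suc[of "\<lambda>j. f (Suc j)"] sum.lessThan_Suc_shift[of f] by (simp add: field_simps)
  finally show ?thesis by (simp only: sum.distrib sum_divide_distrib[symmetric])
qed

text \<open>After multiplication by 2 sin(x/2), each average of neighbouring cosines becomes a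
  difference of sines and the sum telescopes. The identity is kept free of division so that it
  covers the multiples of 2\<pi>.\<close>

lemma lobatto_kernel_eq:
  assumes "0 < N"
  shows "2 * real N * sin (x / 2) * lobatto_kernel N x = sin (real N * x) * cos (x / 2)"
proof -
  have "2 * sin (x/2) * ((cos (real j * x) + cos (real (Suc j) * x)) / 2)
      = cos (x/2) * (sin (real (Suc j) * x) - sin (real j * x))" for j
    unfolding cos_plus_cos sin_diff_sin by (simp add: field_simps)
  then have "2 * sin (x/2) * (\<Sum>j\<le>N. lobatto_weight N j * cos (real j * x))
      = cos (x/2) * (\<Sum>j<N. sin (real (Suc j) * x) - sin (real j * x))"
    unfolding sum_lobatto_weight[OF assms] sum_distrib_left by (intro sum.cong refl)
  also have "(\<Sum>j<N. sin (real (Suc j) * x) - sin (real j * x)) = sin (real N * x)"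
    using sum_lessThan_telescope[of "\<lambda>j. sin (real j * x)" N] by simp
  finally show ?thesis using assms unfolding lobatto_kernel_def by (simp add: mult_ac)
qed

lemma sum_lobatto_weight_one: "0 < N \<Longrightarrow> (\<Sum>j\<le>N. lobatto_weight N j) = real N"
  using sum_lobatto_weight[of N "\<lambda>_. 1"] by simp

lemma lobatto_kernel_0: "0 < N \<Longrightarrow> lobatto_kernel N 0 = 1"
  unfolding lobatto_kernel_def by (simp add: sum_lobatto_weight_one)

lemma lobatto_kernel_minus: "lobatto_kernel N (- x) = lobatto_kernel N x"
  unfolding lobatto_kernel_def by simp

lemma lobatto_kernel_periodic: "lobatto_kernel N (x + 2 * pi) = lobatto_kernel N x"
proof -
  have "cos (real j * (x + 2 * pi)) = cos (real j * x)" for j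
    using cos_eq_periodic_intro[of "real j * (x + 2 * pi)" "real j * x" "int j"] by (simp add: algebra_simps)
  then show ?thesis unfolding lobatto_kernel_def by simp
qed

lemma lobatto_kernel_grid:
  assumes "0 < N" "\<bar>l\<bar> < 2 * int N" "l \<noteq> 0"
  shows "lobatto_kernel N (pi * of_int l / real N) = 0"
proof -
  have "sin (pi * of_int l / real N / 2) \<noteq> 0"
  proof
    assume "sin (pi * of_int l / real N / 2) = 0"
    then obtain i :: int where "pi * of_int l / real N / 2 = of_int i * pi"
      unfolding sin_zero_iff_int2 by blast
    then have "real_of_int l = real_of_int (2 * i * int N)" using assms by (simp add: field_simps)
    then have l: "l = 2 * int N * i" by (simp only: of_int_eq_iff mult.commute mult.left_commute)
    then have "\<bar>l\<bar> = 2 * int N * \<bar>i\<bar>" by (simp add: abs_mult)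
    moreover have "1 \<le> \<bar>i\<bar>" using l assms by auto
    ultimately show False using assms mult_left_mono[of 1 "\<bar>i\<bar>" "2 * int N"] by simp
  qed
  moreover have "sin (real N * (pi * of_int l / real N)) = 0"
    using assms by (simp add: sin_zero_iff_int2 mult.commute)
  ultimately show ?thesis
    using lobatto_kernel_eq[OF assms(1), of "pi * of_int l / real N"] assms by auto
qed

lemma lobatto_kernel_2pi: "0 < N \<Longrightarrow> lobatto_kernel N (2 * pi) = 1"
  using lobatto_kernel_periodic[of N 0] lobatto_kernel_0[of N] by simp

text \<open>Discrete orthogonality of cosines on the grid. At the two extreme indices both kernel
  arguments are multiples of 2\<pi>, which gives 2, the reciprocal of the weight 1/2.\<close>

lemma lobatto_kernel_pair:
  assumes "0 < N" "j \<le> N" "m \<le> N"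
  shows "lobatto_kernel N (pi * real j / real N - pi * real m / real N)
       + lobatto_kernel N (pi * real j / real N + pi * real m / real N)
       = (if j = m then 1 / lobatto_weight N j else 0)"
proof -
  have d: "pi * real j / real N - pi * real m / real N = pi * of_int (int j - int m) / real N"
    "pi * real j / real N + pi * real m / real N = pi * of_int (int j + int m) / real N"
    by (simp_all add: algebra_simps diff_divide_distrib add_divide_distrib)
  consider "j \<noteq> m" | "j = m" "j = 0" | "j = m" "j = N" | "j = m" "0 < j" "j < N"
    using assms by linarith
  then show ?thesis
  proof cases
    case 1
    then show ?thesis unfolding d using assms
      by (subst (1 2) lobatto_kernel_grid) auto
  next
    case 2
    then show ?thesis using assms by (simp add: lobatto_kernel_0 lobatto_weight_def)
  next
    case 3
    then have "pi * real j / real N + pi * real m / real N = 2 * pi" using assms by simp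
    with 3 show ?thesis using assms by (simp add: lobatto_kernel_0 lobatto_kernel_2pi lobatto_weight_def)
  next
    case 4
    then have "lobatto_kernel N (pi * of_int (int j + int m) / real N) = 0"
      using assms by (intro lobatto_kernel_grid) auto
    then show ?thesis unfolding d using 4 assms by (simp add: lobatto_kernel_0 lobatto_weight_def)
  qed
qed

lemma cos_times_cos_kernel:
  "(\<Sum>k\<le>N. lobatto_weight N k * cos (real k * x) * cos (real k * y)) * (2 / real N)
     = lobatto_kernel N (x - y) + lobatto_kernel N (x + y)"
proof -
  have "lobatto_weight N k * cos (real k * x) * cos (real k * y) =
    (lobatto_weight N k * cos (real k * (x - y)) + lobatto_weight N k * cos (real k * (x + y))) / 2" for k
    by (simp add: right_diff_distrib distrib_left mult.assoc cos_times_cos)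
  then show ?thesis unfolding lobatto_kernel_def
    by (simp add: sum.distrib sum_divide_distrib[symmetric] add_divide_distrib)
qed

lemma lobatto_cardinal_eq_kernel:
  "lobatto_cardinal N k \<theta> = lobatto_weight N k *
     (lobatto_kernel N (\<theta> - lobatto_angle N k) + lobatto_kernel N (\<theta> + lobatto_angle N k))"
  unfolding lobatto_cardinal_def cos_times_cos_kernel[symmetric] by (simp add: mult_ac)

lemma lobatto_cardinal_node:
  assumes "0 < N" "k \<le> N" "m \<le> N"
  shows "lobatto_cardinal N k (lobatto_angle N m) = (if m = k then 1 else 0)"
  using lobatto_kernel_pair[OF assms(1,3,2)]
  unfolding lobatto_cardinal_eq_kernel lobatto_angle_def by (auto simp: lobatto_weight_def)

lemma cos_angle_swap: "cos (real j * lobatto_angle N k) = cos (real k * lobatto_angle N j)"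
  unfolding lobatto_angle_def by (simp add: mult_ac)

text \<open>Degree and node enter \<open>cos (j * pi * k / N)\<close> symmetrically, so after
  exchanging the sums the inner sum over the nodes is an orthogonality relation. No uniqueness
  theorem for polynomials is involved.\<close>

lemma lobatto_interp_cos:
  assumes "0 < N" "m \<le> N"
  shows "(\<Sum>k\<le>N. lobatto_cardinal N k \<theta> * cos (real m * lobatto_angle N k)) = cos (real m * \<theta>)"
proof -
  have "(\<Sum>k\<le>N. lobatto_cardinal N k \<theta> * cos (real m * lobatto_angle N k))
     = (\<Sum>k\<le>N. \<Sum>j\<le>N. lobatto_weight N j * cos (real j * \<theta>) * (2 / real N) *
          (lobatto_weight N k * cos (real k * lobatto_angle N j) * cos (real k * lobatto_angle N m)))"
    unfolding lobatto_cardinal_def sum_distrib_left sum_distrib_right cos_angle_swap[of _ N]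
    by (intro sum.cong refl) (simp add: cos_angle_swap mult_ac)
  also have "\<dots> = (\<Sum>j\<le>N. lobatto_weight N j * cos (real j * \<theta>) *
          ((\<Sum>k\<le>N. lobatto_weight N k * cos (real k * lobatto_angle N j) * cos (real k * lobatto_angle N m)) * (2 / real N)))"
    by (subst sum.swap) (simp add: sum_distrib_left sum_distrib_right mult_ac)
  also have "\<dots> = (\<Sum>j\<le>N. if j = m then cos (real m * \<theta>) else 0)"
    unfolding cos_times_cos_kernel lobatto_angle_def
    using assms by (intro sum.cong refl) (auto simp: lobatto_kernel_pair lobatto_weight_def)
  also have "\<dots> = cos (real m * \<theta>)" using assms by simp
  finally show ?thesis .
qed

section \<open>Aliasing of high frequencies\<close>

definition alias_err :: "nat \<Rightarrow> real \<Rightarrow> nat \<Rightarrow> real" where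
  "alias_err N \<theta> m = cos (real m * \<theta>) - (\<Sum>k\<le>N. lobatto_cardinal N k \<theta> * cos (real m * lobatto_angle N k))"

lemma alias_err_low: "0 < N \<Longrightarrow> m \<le> N \<Longrightarrow> alias_err N \<theta> m = 0"
  unfolding alias_err_def by (simp add: lobatto_interp_cos)

text \<open>The frequencies N+i and |i-N| coincide at every node, hence have the same interpolant,
  and the errors differ by cos((N+i)\<theta>) - cos((N-i)\<theta>). For i < 2N the lower frequency
  is at most N and is reproduced without error; otherwise it is N + (i - 2N).\<close>

lemma alias_err_rec:
  assumes "0 < N"
  shows "alias_err N \<theta> (N + i) = (if 2 * N \<le> i then alias_err N \<theta> (N + (i - 2 * N)) else 0)
           - 2 * sin (real N * \<theta>) * sin (real i * \<theta>)"
proof -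
  define m where "m = (if N \<le> i then i - N else N - i)"
  have m: "cos (real m * x) = cos (real i * x - real N * x)" for x
  proof (cases "N \<le> i")
    case False
    then have "real m * x = - (real i * x - real N * x)" unfolding m_def by (simp add: algebra_simps of_nat_diff)
    then show ?thesis by (metis cos_minus)
  qed (simp add: m_def algebra_simps of_nat_diff)
  have "cos (real (N + i) * lobatto_angle N k) = cos (real m * lobatto_angle N k)" for k
    unfolding m
    by (rule cos_eq_periodic_intro[of _ _ "int k"])
       (use assms in \<open>simp add: lobatto_angle_def field_simps\<close>)
  moreover have "cos (real (N + i) * \<theta>) = cos (real m * \<theta>) - 2 * sin (real N * \<theta>) * sin (real i * \<theta>)"
    unfolding m by (simp add: distrib_right cos_add cos_diff)
  ultimately have "alias_err N \<theta> (N + i) = alias_err N \<theta> m - 2 * sin (real N * \<theta>) * sin (real i * \<theta>)"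
    unfolding alias_err_def by simp
  moreover have "alias_err N \<theta> m = (if 2 * N \<le> i then alias_err N \<theta> (N + (i - 2 * N)) else 0)"
  proof (cases "2 * N \<le> i")
    case True
    then have "m = N + (i - 2 * N)" unfolding m_def by simp
    with True show ?thesis by simp
  next
    case False
    then have "m \<le> N" unfolding m_def by auto
    with False show ?thesis using alias_err_low[OF assms] by simp
  qed
  ultimately show ?thesis by simp
qed

text \<open>A crude bound uniform in m, which supplies the convergence hypothesis of the energy
  estimate.\<close>

lemma alias_err_bound: "\<bar>alias_err N \<theta> m\<bar> \<le> 1 + (\<Sum>k\<le>N. \<bar>lobatto_cardinal N k \<theta>\<bar>)"
proof -
  have "\<bar>\<Sum>k\<le>N. lobatto_cardinal N k \<theta> * cos (real m * lobatto_angle N k)\<bar>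
     \<le> (\<Sum>k\<le>N. \<bar>lobatto_cardinal N k \<theta>\<bar> * 1)"
    by (intro order_trans[OF sum_abs] sum_mono) (simp only: abs_mult mult_left_mono abs_ge_zero abs_cos_le_one)
  then have "\<bar>\<Sum>k\<le>N. lobatto_cardinal N k \<theta> * cos (real m * lobatto_angle N k)\<bar>
     \<le> (\<Sum>k\<le>N. \<bar>lobatto_cardinal N k \<theta>\<bar>)" by simp
  then show ?thesis unfolding alias_err_def using abs_cos_le_one[of "real m * \<theta>"] by linarith
qed

text \<open>Frequencies up to N contribute nothing, and shifting the others by N brings out the
  factor \<open>q ^ N\<close>. Finite sums suffice because the kernel will only be expanded up to a
  finite order.\<close>

lemma alias_energy:
  fixes q :: real
  assumes "0 < N" "0 < q" "q < 1"
  shows "(\<Sum>m\<le>M. (alias_err N \<theta> m)\<^sup>2 * q ^ m) \<le> q ^ N * ((1 + q) / (1 - q))"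
proof -
  define b where "b i = alias_err N \<theta> (N + i)" for i
  note E = aliasing_energy_bound[of N q b "1 + (\<Sum>k\<le>N. \<bar>lobatto_cardinal N k \<theta>\<bar>)" \<theta>,
      unfolded b_def, OF assms alias_err_bound alias_err_rec[OF assms(1)]]
  have "(\<Sum>m\<le>M. (alias_err N \<theta> m)\<^sup>2 * q ^ m) \<le> (\<Sum>m\<le>N + M. (alias_err N \<theta> m)\<^sup>2 * q ^ m)"
    using assms by (intro sum_mono2) auto
  also have "\<dots> = (\<Sum>m\<in>{N..N+M}. (alias_err N \<theta> m)\<^sup>2 * q ^ m)"
    by (rule sum.mono_neutral_right) (auto simp: alias_err_low assms)
  also have "\<dots> = (\<Sum>i\<le>M. q ^ N * ((alias_err N \<theta> (N + i))\<^sup>2 * q ^ i))"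
    by (rule sum.reindex_bij_witness[of _ "\<lambda>i. N + i" "\<lambda>m. m - N"]) (auto simp: power_add[symmetric])
  also have "\<dots> = q ^ N * (\<Sum>i\<le>M. (alias_err N \<theta> (N + i))\<^sup>2 * q ^ i)"
    by (simp add: sum_distrib_left)
  also have "\<dots> \<le> q ^ N * (\<Sum>i. (alias_err N \<theta> (N + i))\<^sup>2 * q ^ i)"
    using assms by (intro mult_left_mono sum_le_suminf E(1)) auto
  also have "\<dots> \<le> q ^ N * ((1 + q) / (1 - q))"
    using assms by (intro mult_left_mono E(2)) auto
  finally show ?thesis .
qed

section \<open>The Lebesgue function against a mean of cotangents\<close>

lemma sin_mult_ratio:
  assumes "0 \<le> t" "t \<le> a" "real N * a \<le> pi" "a \<le> pi / 2"
  shows "sin t * sin (real N * a) \<le> sin (real N * t) * sin a"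
  using assms(3)
proof (induction N)
  case (Suc N)
  have Na: "0 \<le> real N * a" "real N * a \<le> pi" "real N * t \<le> real N * a"
    using Suc.prems assms by (auto simp: distrib_right intro!: mult_left_mono)
  have st: "0 \<le> sin t" "0 \<le> sin a" using assms by (auto intro!: sin_ge_zero)
  have c: "cos a \<le> cos t" "cos (real N * a) \<le> cos (real N * t)"
    using assms Na by (auto intro!: cos_monotone_0_pi_le)
  have "0 \<le> sin (real N * t)" "0 \<le> sin (real N * a)"
    using assms Na by (auto intro!: sin_ge_zero)
  have "sin t * sin (real (Suc N) * a) = (sin t * sin (real N * a)) * cos a + sin t * sin a * cos (real N * a)"
    by (simp add: distrib_right sin_add algebra_simps)
  also have "\<dots> \<le> (sin t * sin (real N * a)) * cos t + sin t * sin a * cos (real N * t)"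
    using c st \<open>0 \<le> sin (real N * a)\<close> by (intro add_mono mult_left_mono) auto
  also have "\<dots> \<le> (sin (real N * t) * sin a) * cos t + sin t * sin a * cos (real N * t)"
    using assms Na(2) by (intro add_right_mono mult_right_mono Suc.IH cos_ge_zero) auto
  also have "\<dots> = sin (real (Suc N) * t) * sin a"
    by (simp add: distrib_right sin_add algebra_simps)
  finally show ?case .
qed (use assms in simp)

lemma midpoint_dominates:
  assumes N: "0 < N" and d: "\<bar>\<delta>\<bar> \<le> pi / (2 * real N)" and c: "c \<le> cos (pi / (2 * real N))"
  shows "cos (real N * \<delta>) * (1 - c) \<le> cos \<delta> - c"
proof -
  define a where "a = pi / (4 * real N)"
  define t where "t = \<bar>\<delta>\<bar> / 2"
  have a: "0 < a" "real N * a = pi / 4" "a \<le> pi / 4" "pi / (2 * real N) = 2 * a"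
    unfolding a_def using N by (auto simp: field_simps)
  have t: "0 \<le> t" "t \<le> a" unfolding t_def using d a by auto
  have Nt: "0 \<le> real N * t" "real N * t \<le> pi / 4"
    using t a mult_left_mono[OF t(2), of "real N"] by auto
  have "sin t * sin (pi / 4) \<le> sin (real N * t) * sin a"
    using sin_mult_ratio[OF t, of N] a by simp
  then have "(sin t * sin (pi / 4))\<^sup>2 \<le> (sin (real N * t) * sin a)\<^sup>2"
    using t a by (intro power_mono mult_nonneg_nonneg sin_ge_zero) auto
  then have le: "(sin t)\<^sup>2 * (1 / 2) \<le> (sin (real N * t))\<^sup>2 * (sin a)\<^sup>2"
    by (simp add: power_mult_distrib sin_45 power_divide)
  have c1: "cos \<delta> = 1 - 2 * (sin t)\<^sup>2"
    using cos_double_sin[of t] unfolding t_def by (simp add: abs_if split: if_splits)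
  have c2: "cos (real N * \<delta>) = 1 - 2 * (sin (real N * t))\<^sup>2"
    using cos_double_sin[of "real N * t"] unfolding t_def by (simp add: abs_if split: if_splits)
  have c3: "cos (pi / (2 * real N)) = 1 - 2 * (sin a)\<^sup>2"
    unfolding a(4) by (rule cos_double_sin)
  have "(1 - cos (real N * \<delta>)) * cos (pi / (2 * real N)) \<le> cos \<delta> - cos (real N * \<delta>)"
    unfolding c1 c2 c3 using le by (simp add: algebra_simps)
  moreover have "(1 - cos (real N * \<delta>)) * c \<le> (1 - cos (real N * \<delta>)) * cos (pi / (2 * real N))"
    using c by (intro mult_left_mono) auto
  ultimately show ?thesis by (simp add: algebra_simps)
qed

text \<open>This number is also the Lebesgue constant of the N zeros of the Chebyshev polynomial of
  degree N. Here it arises from the kernel pairs evaluated at the centre of a grid cell.\<close>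

definition cot_mean :: "nat \<Rightarrow> real" where
  "cot_mean N = (\<Sum>k<N. cot (real (2 * k + 1) * pi / (4 * real N))) / real N"

text \<open>The two arguments have a sum independent of \<phi>, and |sin(N x)| has the same value
  sin(N\<phi>) at both. Adding the two half-angle cotangents therefore gives a single quotient that
  depends on \<phi> only through the displacement \<delta> from the cell centre, and it is maximal
  at \<delta> = 0.\<close>

lemma kernel_pair_bound:
  assumes N: "0 < N" and j: "j < N" and f: "0 < \<phi>" "\<phi> < pi / real N"
  shows "\<bar>lobatto_kernel N (\<phi> + real j * (pi / real N))\<bar> + \<bar>lobatto_kernel N (real (Suc j) * (pi / real N) - \<phi>)\<bar>
     \<le> cot (real (2 * j + 1) * pi / (4 * real N)) / real N"
proof -
  define h where "h = pi / real N"
  define M where "M = real (2 * j + 1) * h / 4"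
  define \<psi>1 where "\<psi>1 = \<phi> + real j * h"
  define \<psi>2 where "\<psi>2 = real (Suc j) * h - \<phi>"
  define \<delta> where "\<delta> = \<phi> - h / 2"
  have h: "0 < h" "real N * h = pi" unfolding h_def using N by auto
  have jh: "0 \<le> real j * h" "real (Suc j) * h \<le> pi"
    using h j mult_right_mono[of "real (Suc j)" "real N" h] by auto
  have fh: "0 < \<phi>" "\<phi> < h" using f unfolding h_def by auto
  have Sj: "real (Suc j) * h = h + real j * h" by (simp add: distrib_right)
  have p1: "0 < \<psi>1" "\<psi>1 < pi" unfolding \<psi>1_def using fh jh Sj by linarith+
  have p2: "0 < \<psi>2" "\<psi>2 < pi" unfolding \<psi>2_def using fh jh Sj by linarith+
  have M: "\<psi>1 / 2 + \<psi>2 / 2 = 2 * M" "\<psi>1 / 2 - \<psi>2 / 2 = \<delta>"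
    unfolding M_def \<psi>1_def \<psi>2_def \<delta>_def by (simp_all add: field_simps)
  have M4: "0 < M" "2 * M < pi" "h / 2 \<le> 2 * M"
    using p1 p2 M jh h unfolding M_def by (auto simp: field_simps)
  have sN: "0 < sin (real N * \<phi>)"
    using f N by (intro sin_gt_zero) (auto simp: field_simps)
  have kabs: "\<bar>lobatto_kernel N \<psi>\<bar> = sin (real N * \<phi>) / (2 * real N) * (cos (\<psi> / 2) / sin (\<psi> / 2))"
    if "0 < \<psi>" "\<psi> < pi" "\<bar>sin (real N * \<psi>)\<bar> = sin (real N * \<phi>)" for \<psi>
  proof -
    have s: "0 < sin (\<psi> / 2)" "0 < cos (\<psi> / 2)" using that by (auto intro: sin_gt_zero cos_gt_zero)
    have "\<bar>2 * real N * sin (\<psi> / 2) * lobatto_kernel N \<psi>\<bar> = sin (real N * \<phi>) * cos (\<psi> / 2)"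
      unfolding lobatto_kernel_eq[OF N] abs_mult that(3) using s by simp
    then have "2 * real N * sin (\<psi> / 2) * \<bar>lobatto_kernel N \<psi>\<bar> = sin (real N * \<phi>) * cos (\<psi> / 2)"
      using s by (simp add: abs_mult)
    then show ?thesis using s N by (simp add: field_simps)
  qed
  have per: "\<bar>sin (x + real j * pi)\<bar> = \<bar>sin x\<bar>" for x j
    by (induction j) (auto simp: distrib_right add.assoc[symmetric] add.commute[of pi] simp flip: add.assoc)
  have "real N * \<psi>1 = real N * \<phi> + real j * pi"
    unfolding \<psi>1_def using h by (simp add: algebra_simps)
  then have a1: "\<bar>sin (real N * \<psi>1)\<bar> = sin (real N * \<phi>)" using per sN by simp
  have "real N * \<psi>2 = - (real N * \<phi>) + real (Suc j) * pi"
    unfolding \<psi>2_def using h by (simp add: algebra_simps)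
  then have a2: "\<bar>sin (real N * \<psi>2)\<bar> = sin (real N * \<phi>)" using per[of "- (real N * \<phi>)" "Suc j"] sN by simp
  have s12: "0 < sin (\<psi>1 / 2)" "0 < sin (\<psi>2 / 2)" using p1 p2 by (auto intro: sin_gt_zero)
  have ss: "2 * sin (\<psi>1 / 2) * sin (\<psi>2 / 2) = cos \<delta> - cos (2 * M)"
    unfolding M[symmetric] cos_diff cos_add by simp
  then have cpos: "0 < cos \<delta> - cos (2 * M)" using s12 by (metis mult_pos_pos zero_less_numeral)
  have sM: "0 < sin (2 * M)" using M4 by (intro sin_gt_zero) auto
  have "0 < sin M" using M4 by (intro sin_gt_zero) auto
  then have cM: "0 < 1 - cos (2 * M)" by (simp add: cos_double_sin)
  have "\<bar>lobatto_kernel N \<psi>1\<bar> + \<bar>lobatto_kernel N \<psi>2\<bar>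
      = sin (real N * \<phi>) / (2 * real N) * (cos (\<psi>1 / 2) / sin (\<psi>1 / 2) + cos (\<psi>2 / 2) / sin (\<psi>2 / 2))"
    using kabs[OF p1 a1] kabs[OF p2 a2] by (simp add: distrib_left)
  also have "cos (\<psi>1 / 2) / sin (\<psi>1 / 2) + cos (\<psi>2 / 2) / sin (\<psi>2 / 2)
      = sin (2 * M) / (sin (\<psi>1 / 2) * sin (\<psi>2 / 2))"
    unfolding M[symmetric] sin_add using s12 by (simp add: field_simps)
  also have "sin (real N * \<phi>) / (2 * real N) * \<dots> = sin (real N * \<phi>) * sin (2 * M) / (cos \<delta> - cos (2 * M)) / real N"
    unfolding ss[symmetric] using s12 N by (simp add: field_simps)
  also have "\<dots> \<le> sin (2 * M) / (1 - cos (2 * M)) / real N"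
  proof (rule divide_right_mono)
    have "sin (real N * \<phi>) = cos (real N * \<delta>)"
    proof -
      have "real N * \<delta> = real N * \<phi> - pi / 2" unfolding \<delta>_def using h by (simp add: algebra_simps)
      then show ?thesis by (simp add: cos_diff)
    qed
    moreover have "cos (real N * \<delta>) * (1 - cos (2 * M)) \<le> cos \<delta> - cos (2 * M)"
    proof (rule midpoint_dominates[OF N])
      show "\<bar>\<delta>\<bar> \<le> pi / (2 * real N)" unfolding \<delta>_def using fh unfolding h_def by (auto simp: field_simps abs_if)
      show "cos (2 * M) \<le> cos (pi / (2 * real N))"
        using M4 h unfolding h_def by (intro cos_monotone_0_pi_le) (auto simp: field_simps)
    qed
    ultimately have "sin (2 * M) * (sin (real N * \<phi>) * (1 - cos (2 * M))) \<le> sin (2 * M) * (cos \<delta> - cos (2 * M))"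
      using sM by simp
    then show "sin (real N * \<phi>) * sin (2 * M) / (cos \<delta> - cos (2 * M)) \<le> sin (2 * M) / (1 - cos (2 * M))"
      using cpos cM by (simp add: field_simps)
  qed simp
  also have "sin (2 * M) / (1 - cos (2 * M)) = cot M"
  proof -
    have "0 < sin M" using M4 by (intro sin_gt_zero) auto
    then show ?thesis unfolding cot_def sin_double cos_double_sin by (simp add: power2_eq_square)
  qed
  also have "M = real (2 * j + 1) * pi / (4 * real N)" unfolding M_def h_def by (simp add: field_simps)
  finally show ?thesis unfolding \<psi>1_def \<psi>2_def h_def .
qed

text \<open>The sum P of |kernel| over all 2N grid translates in one period is invariant under a
  grid step. Hence \<theta> may be reduced to its residue \<phi> in one cell, and evenness of the
  kernel groups the 2N terms into the N pairs that \<open>kernel_pair_bound\<close>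
  controls.\<close>

lemma sum_abs_cardinal_le_kernel:
  assumes N: "0 < N" and th: "0 \<le> \<theta>"
  obtains \<phi> m where "\<phi> = \<theta> - real m * (pi / real N)" "0 \<le> \<phi>" "\<phi> < pi / real N"
    "(\<Sum>k\<le>N. \<bar>lobatto_cardinal N k \<theta>\<bar>)
       \<le> (\<Sum>j<N. \<bar>lobatto_kernel N (\<phi> + real j * (pi / real N))\<bar>
                + \<bar>lobatto_kernel N (real (Suc j) * (pi / real N) - \<phi>)\<bar>)"
proof -
  define h where "h = pi / real N"
  define g where "g x = \<bar>lobatto_kernel N x\<bar>" for x
  define P where "P x = (\<Sum>k<2 * N. g (x + real k * h))" for x
  have h: "0 < h" "real N * h = pi" unfolding h_def using N by auto
  have g_per: "g (x + 2 * pi) = g x" for x unfolding g_def by (simp add: lobatto_kernel_periodic)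
  have g_even: "g (- x) = g x" for x unfolding g_def by (simp add: lobatto_kernel_minus)
  have P_shift: "P (x + h) = P x" for x
  proof -
    define G where "G k = g (x + real k * h)" for k
    have "G (2 * N) = G 0" unfolding G_def using g_per[of x] h by (simp add: mult.assoc)
    moreover have "(\<Sum>k<2 * N. G (Suc k)) + G 0 = (\<Sum>k<2 * N. G k) + G (2 * N)"
      using sum.lessThan_Suc_shift[of G "2 * N"] sum.lessThan_Suc[of G "2 * N"] by simp
    moreover have "P (x + h) = (\<Sum>k<2 * N. G (Suc k))" unfolding P_def G_def by (simp add: distrib_right add_ac)
    ultimately show ?thesis unfolding P_def G_def by simp
  qed
  have P_shifts: "P (x + real m * h) = P x" for x m
  proof (induction m)
    case (Suc m)
    have "x + real (Suc m) * h = (x + real m * h) + h" by (simp add: distrib_right)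
    then show ?case using P_shift[of "x + real m * h"] Suc by (simp only:)
  qed simp
  have P_split: "P (z - pi) = (\<Sum>k<N. g (z + real k * h)) + (\<Sum>k<N. g (z - real (Suc k) * h))" for z
  proof -
    have "P (z - pi) = (\<Sum>k=0..<N. g (z - pi + real k * h)) + (\<Sum>k=N..<N + N. g (z - pi + real k * h))"
      unfolding P_def by (subst sum.atLeastLessThan_concat) (auto simp: lessThan_atLeast0 mult_2)
    also have "(\<Sum>k=N..<N + N. g (z - pi + real k * h)) = (\<Sum>k<N. g (z - pi + real (k + N) * h))"
      using sum.shift_bounds_nat_ivl[of "\<lambda>k. g (z - pi + real k * h)" 0 N N] by (simp add: lessThan_atLeast0)
    also have "\<dots> = (\<Sum>k<N. g (z + real k * h))"
      using h by (simp add: distrib_right)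
    also have "(\<Sum>k=0..<N. g (z - pi + real k * h)) = (\<Sum>k<N. g (z - pi + real (N - Suc k) * h))"
      unfolding atLeast0LessThan by (rule sum.nat_diff_reindex[symmetric])
    also have "\<dots> = (\<Sum>k<N. g (z - real (Suc k) * h))"
    proof (rule sum.cong[OF refl])
      fix k assume "k \<in> {..<N}"
      then have "real (N - Suc k) = real N - real (Suc k)" by (simp add: of_nat_diff)
      then show "g (z - pi + real (N - Suc k) * h) = g (z - real (Suc k) * h)"
        unfolding h(2)[symmetric] by (simp only: left_diff_distrib) (simp add: algebra_simps)
    qed
    finally show ?thesis by simp
  qed
  define m where "m = nat \<lfloor>\<theta> / h\<rfloor>"
  define \<phi> where "\<phi> = \<theta> - real m * h"
  have m: "real m = of_int \<lfloor>\<theta> / h\<rfloor>" unfolding m_def using th h by simp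
  have \<phi>: "0 \<le> \<phi>" "\<phi> < h"
    unfolding \<phi>_def m
    using of_int_floor_le[of "\<theta> / h"] real_of_int_floor_add_one_gt[of "\<theta> / h"]
    unfolding pos_le_divide_eq[OF h(1)] pos_divide_less_eq[OF h(1)] by (simp_all add: distrib_right)
  have "(\<Sum>k\<le>N. \<bar>lobatto_cardinal N k \<theta>\<bar>)
      \<le> (\<Sum>k\<le>N. lobatto_weight N k * (g (\<theta> - real k * h) + g (\<theta> + real k * h)))"
  proof (rule sum_mono)
    fix k
    have "lobatto_angle N k = real k * h" unfolding lobatto_angle_def h_def by simp
    then show "\<bar>lobatto_cardinal N k \<theta>\<bar> \<le> lobatto_weight N k * (g (\<theta> - real k * h) + g (\<theta> + real k * h))"
      unfolding lobatto_cardinal_eq_kernel abs_mult g_def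
      by (intro mult_mono) (auto simp: lobatto_weight_def)
  qed
  \<comment> \<open>Averaging neighbours converts the halved end terms into two complete sums, taken
    at arguments one grid step apart; by invariance they agree.\<close>
  also have "\<dots> = (P (\<theta> - pi) + P (\<theta> + h - pi)) / 2"
    unfolding sum_lobatto_weight[OF N] P_split
    by (simp add: sum.distrib sum_divide_distrib[symmetric] distrib_right algebra_simps add_divide_distrib)
  also have "\<dots> = P (\<phi> - pi)"
    using P_shift[of "\<theta> - pi"] P_shifts[of "\<phi> - pi" m] unfolding \<phi>_def by (simp add: algebra_simps)
  also have "\<dots> = (\<Sum>j<N. g (\<phi> + real j * h) + g (real (Suc j) * h - \<phi>))"
    unfolding P_split sum.distrib[symmetric] using g_even by (metis minus_diff_eq)
  finally show ?thesis using that \<phi>_def \<phi> unfolding g_def h_def by blast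
qed

lemma sum_kernel_pairs_le:
  assumes N: "0 < N" and f: "0 < \<phi>" "\<phi> < pi / real N"
  shows "(\<Sum>j<N. \<bar>lobatto_kernel N (\<phi> + real j * (pi / real N))\<bar>
                + \<bar>lobatto_kernel N (real (Suc j) * (pi / real N) - \<phi>)\<bar>) \<le> cot_mean N"
  unfolding cot_mean_def sum_divide_distrib
  using assms by (intro sum_mono kernel_pair_bound) auto

text \<open>The cardinal functions sum to one, so their absolute values sum to at least one; the
  paired estimate applies at half a grid step, where \<phi> cannot vanish for reasons of parity. The
  bound settles the case of a node, which the paired estimate excludes.\<close>

lemma cot_mean_ge_1:
  assumes N: "0 < N" shows "1 \<le> cot_mean N"
proof -
  define \<theta> where "\<theta> = pi / (2 * real N)"
  have "0 \<le> \<theta>" unfolding \<theta>_def by simp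
  from sum_abs_cardinal_le_kernel[OF N this] obtain \<phi> m where \<phi>: "\<phi> = \<theta> - real m * (pi / real N)"
    "0 \<le> \<phi>" "\<phi> < pi / real N" and le: "(\<Sum>k\<le>N. \<bar>lobatto_cardinal N k \<theta>\<bar>)
       \<le> (\<Sum>j<N. \<bar>lobatto_kernel N (\<phi> + real j * (pi / real N))\<bar>
                + \<bar>lobatto_kernel N (real (Suc j) * (pi / real N) - \<phi>)\<bar>)" .
  have "\<phi> \<noteq> 0"
  proof
    assume "\<phi> = 0"
    then have "real 1 = real (2 * m)" using \<phi>(1) N unfolding \<theta>_def by (simp add: field_simps)
    then show False by (simp only: of_nat_eq_iff) presburger
  qed
  then have "(\<Sum>k\<le>N. \<bar>lobatto_cardinal N k \<theta>\<bar>) \<le> cot_mean N"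
    using le sum_kernel_pairs_le[OF N _ \<phi>(3)] \<phi>(2) by linarith
  moreover have "1 \<le> (\<Sum>k\<le>N. \<bar>lobatto_cardinal N k \<theta>\<bar>)"
    using lobatto_interp_cos[OF N, of 0 \<theta>] sum_abs[of "\<lambda>k. lobatto_cardinal N k \<theta>" "{..N}"] by simp
  ultimately show ?thesis by linarith
qed

lemma sum_abs_cardinal_le:
  assumes N: "0 < N" and th: "0 \<le> \<theta>"
  shows "(\<Sum>k\<le>N. \<bar>lobatto_cardinal N k \<theta>\<bar>) \<le> cot_mean N"
proof -
  from sum_abs_cardinal_le_kernel[OF assms] obtain \<phi> m where \<phi>: "\<phi> = \<theta> - real m * (pi / real N)"
    "0 \<le> \<phi>" "\<phi> < pi / real N" and le: "(\<Sum>k\<le>N. \<bar>lobatto_cardinal N k \<theta>\<bar>)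
       \<le> (\<Sum>j<N. \<bar>lobatto_kernel N (\<phi> + real j * (pi / real N))\<bar>
                + \<bar>lobatto_kernel N (real (Suc j) * (pi / real N) - \<phi>)\<bar>)" .
  show ?thesis
  proof (cases "\<phi> = 0")
    case True
    \<comment> \<open>At a node all kernel values vanish except the one at argument 0, so the whole
      sum is 1.\<close>
    have zero: "lobatto_kernel N (real i * (pi / real N)) = 0" if "0 < i" "i < 2 * N" for i
      using lobatto_kernel_grid[OF N, of "int i"] that by (simp add: mult.commute)
    have "\<bar>lobatto_kernel N (\<phi> + real j * (pi / real N))\<bar>
                + \<bar>lobatto_kernel N (real (Suc j) * (pi / real N) - \<phi>)\<bar> = (if j = 0 then 1 else 0)" if "j < N" for j
      using zero[of j] zero[of "Suc j"] that True N lobatto_kernel_0[OF N] by (cases "j = 0") auto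
    then have "(\<Sum>j<N. \<bar>lobatto_kernel N (\<phi> + real j * (pi / real N))\<bar>
                + \<bar>lobatto_kernel N (real (Suc j) * (pi / real N) - \<phi>)\<bar>) = (\<Sum>j<N. if j = 0 then 1 else 0)"
      by (intro sum.cong) auto
    also have "\<dots> = 1" using N by simp
    finally show ?thesis using le cot_mean_ge_1[OF N] by linarith
  next
    case False
    then show ?thesis using le sum_kernel_pairs_le[OF N _ \<phi>(3)] \<phi>(2) by linarith
  qed
qed

section \<open>Growth of the cotangent mean\<close>

lemma cot_le:
  fixes x :: real
  assumes "0 < x" "x < pi / 2"
  shows "cot x \<le> 1 / x - x / 3"
proof -
  have 1: "0 \<le> sin x - x * cos x" if "0 \<le> x" "x \<le> pi / 2" for x :: real
  proof -
    have "sin 0 - 0 * cos 0 \<le> sin x - x * cos x"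
    proof (rule DERIV_nonneg_imp_nondecreasing[OF that(1), where f = "\<lambda>x. sin x - x * cos x"])
      fix t :: real assume "0 \<le> t" "t \<le> x"
      then show "\<exists>y. ((\<lambda>x. sin x - x * cos x) has_real_derivative y) (at t) \<and> 0 \<le> y"
        using that by (intro exI[of _ "t * sin t"] conjI) (auto intro!: derivative_eq_intros mult_nonneg_nonneg sin_ge_zero)
    qed
    then show ?thesis by simp
  qed
  have "(1 - 0^2/3) * sin 0 - 0 * cos 0 \<le> (1 - x^2/3) * sin x - x * cos x"
  proof (rule DERIV_nonneg_imp_nondecreasing[where f = "\<lambda>x. (1 - x^2/3) * sin x - x * cos x"])
    show "0 \<le> x" using assms by simp
    fix t :: real assume t: "0 \<le> t" "t \<le> x"
    have "((\<lambda>x. (1 - x^2/3) * sin x - x * cos x) has_real_derivative t / 3 * (sin t - t * cos t)) (at t)"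
      by (auto intro!: derivative_eq_intros simp: field_simps power2_eq_square)
    moreover have "0 \<le> t / 3 * (sin t - t * cos t)" using t assms 1[of t] by simp
    ultimately show "\<exists>y. ((\<lambda>x. (1 - x^2/3) * sin x - x * cos x) has_real_derivative y) (at t) \<and> 0 \<le> y"
      by blast
  qed
  then have "x * cos x \<le> (1 - x^2/3) * sin x" by simp
  moreover have "0 < sin x" using assms by (intro sin_gt_zero) auto
  ultimately show ?thesis unfolding cot_def using assms by (simp add: field_simps power2_eq_square)
qed

text \<open>The reciprocal terms give the odd harmonic sum; the linear terms of
  \<open>cot_le\<close> sum to a multiple of N squared and leave the constant \<pi>/12. This
  constant is essential for comparison with sqrt N: at N = 3 the harmonic term alone is about 1.95,
  larger than sqrt 3.\<close>

lemma cot_mean_le: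
  assumes "0 < N"
  shows "cot_mean N \<le> 4 / pi * (\<Sum>k<N. 1 / real (2 * k + 1)) - pi / 12"
proof -
  have odd: "(\<Sum>k<n. real (2 * k + 1)) = real n ^ 2" for n
    by (induction n) (auto simp: power2_eq_square algebra_simps)
  have "(\<Sum>k<N. cot (real (2 * k + 1) * pi / (4 * real N)))
      \<le> (\<Sum>k<N. 4 * real N / pi * (1 / real (2 * k + 1)) - pi / (12 * real N) * real (2 * k + 1))"
  proof (rule sum_mono)
    fix k assume "k \<in> {..<N}"
    then have "real (2 * k + 1) * pi < real (2 * N) * pi" by (intro mult_strict_right_mono) auto
    then have "cot (real (2 * k + 1) * pi / (4 * real N))
        \<le> 1 / (real (2 * k + 1) * pi / (4 * real N)) - real (2 * k + 1) * pi / (4 * real N) / 3"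
      using assms by (intro cot_le divide_pos_pos mult_pos_pos) (auto simp: field_simps)
    then show "cot (real (2 * k + 1) * pi / (4 * real N))
        \<le> 4 * real N / pi * (1 / real (2 * k + 1)) - pi / (12 * real N) * real (2 * k + 1)"
      by (simp add: field_simps)
  qed
  also have "\<dots> = 4 * real N / pi * (\<Sum>k<N. 1 / real (2 * k + 1)) - pi / (12 * real N) * real N ^ 2"
    unfolding sum_subtractf sum_distrib_left[symmetric] odd ..
  also have "\<dots> = (4 / pi * (\<Sum>k<N. 1 / real (2 * k + 1)) - pi / 12) * real N"
    using assms by (simp add: algebra_simps power2_eq_square)
  finally show ?thesis unfolding cot_mean_def using assms by (simp add: pos_divide_le_eq)
qed

lemma odd_harmonic_le_ln:
  assumes "0 < N"
  shows "(\<Sum>k<N. 1 / real (2 * k + 1)) \<le> 1 + ln (real N)"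
  using assms
proof (induction N)
  case (Suc n)
  show ?case
  proof (cases "n = 0")
    case False
    have "1 / real (Suc n) \<le> ln (real (Suc n) / real n)"
    proof -
      have "ln (real n / real (Suc n)) \<le> real n / real (Suc n) - 1"
        using False by (intro ln_le_minus_one) simp
      also have "\<dots> = - (1 / real (Suc n))" by (simp add: field_simps)
      finally show ?thesis using False by (simp add: ln_div del: of_nat_Suc)
    qed
    moreover have "1 / real (2 * n + 1) \<le> 1 / real (Suc n)" by (simp add: frac_le)
    ultimately show ?thesis using Suc.IH False by (simp add: ln_div)
  qed simp
qed simp

lemma cot_mean_le_ln:
  assumes "0 < N" shows "cot_mean N \<le> 2 * (1 + ln (real N))"
proof -
  have "0 \<le> ln (real N)" using assms by simp
  then have "4 / pi * (\<Sum>k<N. 1 / real (2 * k + 1)) \<le> 2 * (1 + ln (real N))"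
    using odd_harmonic_le_ln[OF assms] pi_gt3 by (intro mult_mono sum_nonneg) (auto simp: field_simps)
  then show ?thesis using cot_mean_le[OF assms] pi_gt_zero by linarith
qed

text \<open>At N = 2 equality holds, so no estimate with slack is possible there and the value is
  computed. From N = 3 on, the majorant a stays below the square root, because its increment is at
  most that of the square root.\<close>

lemma cot_mean_sq_le:
  assumes "2 \<le> N" shows "(cot_mean N)\<^sup>2 \<le> real N"
proof (cases "N = 2")
  case True
  have "cot (pi / 8) + cot (3 * pi / 8) = 2 * sqrt 2"
  proof -
    have s: "0 < sin (pi / 8)" "0 < cos (pi / 8)" by (auto intro: sin_gt_zero cos_gt_zero)
    have "cos (3 * pi / 8) = sin (pi / 8)" "sin (3 * pi / 8) = cos (pi / 8)"
      unfolding cos_sin_eq[of "3 * pi / 8"] sin_cos_eq[of "3 * pi / 8"] by simp_all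
    then have "cot (pi / 8) + cot (3 * pi / 8) = cos (pi / 8) / sin (pi / 8) + sin (pi / 8) / cos (pi / 8)"
      unfolding cot_def by simp
    also have "\<dots> = ((sin (pi / 8))\<^sup>2 + (cos (pi / 8))\<^sup>2) / (sin (pi / 8) * cos (pi / 8))"
      using s by (simp add: field_simps power2_eq_square)
    also have "sin (pi / 8) * cos (pi / 8) = sqrt 2 / 4"
      using sin_double[of "pi / 8"] sin_45 by simp
    also have "((sin (pi / 8))\<^sup>2 + (cos (pi / 8))\<^sup>2) / (sqrt 2 / 4) = 2 * sqrt 2"
      by (simp add: field_simps)
    finally show ?thesis .
  qed
  then have "cot_mean N = sqrt 2" unfolding True cot_mean_def by (simp add: numeral_2_eq_2 mult.commute)
  then show ?thesis using True by simp
next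
  case False
  define a where "a n = 4 / pi * (\<Sum>k<n. 1 / real (2 * k + 1)) - pi / 12" for n
  have pi: "3.14 < pi" "pi < 3.15" using pi_approx by simp_all
  have a3: "a 3 = 92 / (15 * pi) - pi / 12" unfolding a_def by (simp add: numeral_3_eq_3)
  have "a n \<le> sqrt (real n)" if "3 \<le> n" for n
    using that
  proof (induction n rule: dec_induct)
    case base
    have "92 / (15 * pi) \<le> 92 / (15 * 3.14)" using pi by (intro divide_left_mono) auto
    then have "a 3 \<le> 1.73" unfolding a3 using pi by simp
    also have "1.73 \<le> sqrt 3" by (rule real_le_rsqrt) (simp add: power2_eq_square)
    finally show ?case by simp
  next
    case (step n)
    have "a (Suc n) = a n + 4 / (pi * real (2 * n + 1))" 
      unfolding a_def sum.lessThan_Suc distrib_left by simp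
    moreover have "4 / (pi * real (2 * n + 1)) \<le> sqrt (real (Suc n)) - sqrt (real n)"
    proof -
      have s: "0 < sqrt (real n)" "sqrt (real n) \<le> sqrt (real (Suc n))" using step by auto
      \<comment> \<open>Replacing \<pi> by 3 and squaring leaves
        \<open>64*n + 64 \<le> 36*n^2 + 36*n + 9\<close>, which follows from n \<ge> 3.\<close>
      have "sqrt (real (Suc n)) * 8 \<le> pi * real (2 * n + 1)"
      proof -
        have "3 * real n \<le> real n * real n" using step by (intro mult_right_mono) auto
        moreover have "(sqrt (real (Suc n)) * 8)\<^sup>2 = 64 * real n + 64" by (simp add: power_mult_distrib)
        moreover have "(3 * real (2 * n + 1))\<^sup>2 = 36 * (real n * real n) + 36 * real n + 9"
          by (simp add: power2_eq_square algebra_simps)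
        moreover have "3 \<le> real n" using step by simp
        ultimately have "(sqrt (real (Suc n)) * 8)\<^sup>2 \<le> (3 * real (2 * n + 1))\<^sup>2" by linarith
        then have "sqrt (real (Suc n)) * 8 \<le> 3 * real (2 * n + 1)" by (rule power2_le_imp_le) simp
        also have "\<dots> \<le> pi * real (2 * n + 1)" using pi by (intro mult_right_mono) auto
        finally show ?thesis .
      qed
      then have "4 / (pi * real (2 * n + 1)) \<le> 4 / (sqrt (real (Suc n)) * 8)"
        using s by (intro divide_left_mono) auto
      also have "\<dots> = 1 / (2 * sqrt (real (Suc n)))" by simp
      also have "\<dots> \<le> 1 / (sqrt (real (Suc n)) + sqrt (real n))"
        using s by (intro divide_left_mono mult_pos_pos add_pos_pos) auto
      also have "\<dots> = sqrt (real (Suc n)) - sqrt (real n)"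
      proof -
        have "(sqrt (real (Suc n)) - sqrt (real n)) * (sqrt (real (Suc n)) + sqrt (real n)) = 1"
          by (simp add: algebra_simps)
        moreover have "sqrt (real (Suc n)) + sqrt (real n) \<noteq> 0" using s by linarith
        ultimately show ?thesis by (rule eq_divide_imp[symmetric, rotated])
      qed
      finally show ?thesis .
    qed
    ultimately show ?case using step by simp
  qed
  from this[of N] have "a N \<le> sqrt (real N)" using assms False by simp
  then have "cot_mean N \<le> sqrt (real N)"
    using cot_mean_le[of N] assms unfolding a_def by linarith
  moreover have "0 \<le> cot_mean N" using cot_mean_ge_1[of N] assms by simp
  ultimately have "(cot_mean N)\<^sup>2 \<le> (sqrt (real N))\<^sup>2" by (rule power_mono)
  then show ?thesis by simp
qed

section \<open>Interpolation on a Bernstein ellipse\<close>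

definition joukowski :: "complex \<Rightarrow> complex" where
  "joukowski v = (v + 1 / v) / 2"

text \<open>Since J(v) - 1 and J(v) + 1 are \<open>(v-1)^2 / (2*v)\<close> and
  \<open>(v+1)^2 / (2*v)\<close>, the parallelogram law gives the sum of the focal distances. The
  circle of radius r > 1 is thus sent to the boundary of the ellipse with parameter r.\<close>

lemma joukowski_foci:
  assumes "v \<noteq> 0"
  shows "cmod (joukowski v - 1) + cmod (joukowski v + 1) = cmod v + 1 / cmod v"
proof -
  have 1: "joukowski v - 1 = (v - 1)^2 / (2 * v)" "joukowski v + 1 = (v + 1)^2 / (2 * v)"
    unfolding joukowski_def using assms by (simp_all add: field_simps power2_eq_square)
  have "(cmod (v - 1))\<^sup>2 + (cmod (v + 1))\<^sup>2 = 2 * (cmod v)\<^sup>2 + 2"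
    unfolding cmod_power2 by (simp add: power2_eq_square algebra_simps)
  then have "cmod (joukowski v - 1) + cmod (joukowski v + 1) = (2 * (cmod v)\<^sup>2 + 2) / (2 * cmod v)"
    unfolding 1 norm_divide norm_power norm_mult by (simp add: add_divide_distrib[symmetric])
  also have "\<dots> = cmod v + 1 / cmod v" using assms by (simp add: field_simps power2_eq_square)
  finally show ?thesis .
qed

lemma ellipse_axis_mono:
  fixes r s :: real
  assumes "1 \<le> r" "r < s"
  shows "r + 1 / r < s + 1 / s"
proof -
  have "0 < (s - r) * (r * s - 1)"
    using assms mult_strict_mono'[of 1 r 1 s] by (intro mult_pos_pos) (auto intro: less_le_trans[of 1 s] simp: less_1_mult mult_le_cancel_right1 order_less_le_trans)
  then have "0 < (s - r) * (r * s - 1) / (r * s)" using assms by simp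
  also have "\<dots> = (s + 1 / s) - (r + 1 / r)" using assms by (simp add: field_simps)
  finally show ?thesis by simp
qed

lemma open_bernstein_ellipse: "open (bernstein_ellipse r)"
  unfolding bernstein_ellipse_def by (intro open_Collect_less continuous_intros)

lemma convex_bernstein_ellipse: "convex (bernstein_ellipse r)"
proof (rule convexI)
  fix a b :: complex and u v :: real
  assume ab: "a \<in> bernstein_ellipse r" "b \<in> bernstein_ellipse r" and uv: "0 \<le> u" "0 \<le> v" "u + v = 1"
  have v: "v = 1 - u" using uv by simp
  have "cmod (u *\<^sub>R a + v *\<^sub>R b - c) \<le> u * cmod (a - c) + v * cmod (b - c)" for c
  proof -
    have "u *\<^sub>R a + v *\<^sub>R b - c = u *\<^sub>R (a - c) + v *\<^sub>R (b - c)" unfolding v by (simp add: algebra_simps)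
    then show ?thesis using uv norm_triangle_ineq[of "u *\<^sub>R (a - c)" "v *\<^sub>R (b - c)"] by simp
  qed
  from add_mono[OF this[of 1] this[of "-1"]]
  have "cmod (u *\<^sub>R a + v *\<^sub>R b - 1) + cmod (u *\<^sub>R a + v *\<^sub>R b + 1)
      \<le> u * (cmod (a - 1) + cmod (a + 1)) + v * (cmod (b - 1) + cmod (b + 1))"
    by (simp add: algebra_simps)
  also have "\<dots> < r + 1 / r"
    using ab uv unfolding bernstein_ellipse_def by (intro convex_bound_lt) auto
  finally show "u *\<^sub>R a + v *\<^sub>R b \<in> bernstein_ellipse r" unfolding bernstein_ellipse_def by simp
qed

lemma joukowski_in_ellipse:
  assumes "1 < cmod v" "cmod v < \<rho>"
  shows "joukowski v \<in> bernstein_ellipse \<rho>"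
proof -
  have "v \<noteq> 0" using assms by auto
  then show ?thesis
    unfolding bernstein_ellipse_def using joukowski_foci[of v] ellipse_axis_mono[of "cmod v" \<rho>] assms by auto
qed

lemma real_in_ellipse:
  assumes "1 < \<rho>" "\<bar>x\<bar> \<le> 1"
  shows "of_real x \<in> bernstein_ellipse \<rho>"
proof -
  have "cmod (of_real x - 1) = 1 - x" "cmod (of_real x + 1) = 1 + x"
    using assms norm_of_real[of "x - 1", where 'a = complex] norm_of_real[of "x + 1", where 'a = complex] by auto
  then show ?thesis
    unfolding bernstein_ellipse_def using ellipse_axis_mono[of 1 \<rho>] assms by simp
qed

text \<open>With J the Joukowski map this is v J'(v) / (J(v) - cos \<theta>), in partial fractions;
  the poles \<open>cis \<theta>\<close> and \<open>cis (-\<theta>)\<close> are the two preimages of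
  cos \<theta>.\<close>

definition cauchy_kernel :: "real \<Rightarrow> complex \<Rightarrow> complex" where
  "cauchy_kernel \<theta> v = 1 + cis \<theta> / (v - cis \<theta>) + cis (- \<theta>) / (v - cis (- \<theta>))"

text \<open>No winding number of an ellipse is computed. The difference quotient H of f at cos
  \<theta> has a primitive on the convex ellipse, and composing it with the Joukowski map shows that
  the pulled-back H integrates to zero over the circle. What remains is f(cos \<theta>) times
  explicit simple poles inside the circle.\<close>

lemma ellipse_cauchy_formula:
  assumes f: "f holomorphic_on bernstein_ellipse \<rho>" and r: "1 < r" "r < \<rho>"
  shows "((\<lambda>t. f (joukowski (of_real r * cis (2 * pi * t))) * cauchy_kernel \<theta> (of_real r * cis (2 * pi * t)))
           has_integral f (of_real (cos \<theta>))) {0..1}"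
proof -
  define E where "E = bernstein_ellipse \<rho>"
  define x where "x = complex_of_real (cos \<theta>)"
  define w1 where "w1 = cis \<theta>"
  define w2 where "w2 = cis (- \<theta>)"
  define \<gamma> where "\<gamma> = circlepath 0 r"
  have oE: "open E" and cE: "convex E" unfolding E_def by (rule open_bernstein_ellipse convex_bernstein_ellipse)+
  define H where "H z = (if z = x then deriv f x else (f z - f x) / (z - x))" for z
  have "H holomorphic_on E"
    unfolding H_def using pole_lemma_open[OF f open_bernstein_ellipse] unfolding E_def .
  then obtain \<Phi> where \<Phi>: "\<And>z. z \<in> E \<Longrightarrow> (\<Phi> has_field_derivative H z) (at z within E)"
    using holomorphic_convex_primitive'[OF cE oE] by blast
  define S where "S = {v. v \<noteq> 0 \<and> joukowski v \<in> E}"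
  have path: "path_image \<gamma> = sphere 0 r" unfolding \<gamma>_def using r by simp
  have sub: "path_image \<gamma> \<subseteq> S"
    unfolding path S_def E_def using r by (auto simp: joukowski_in_ellipse)
  have val: "valid_path \<gamma>" unfolding \<gamma>_def by simp
  have "((\<lambda>v. H (joukowski v) * ((1 - 1 / v^2) / 2)) has_contour_integral
      (\<Phi> \<circ> joukowski) (pathfinish \<gamma>) - (\<Phi> \<circ> joukowski) (pathstart \<gamma>)) \<gamma>"
  proof (rule contour_integral_primitive[OF _ val sub])
    fix v assume v: "v \<in> S"
    have "(joukowski has_field_derivative (1 - 1 / v^2) / 2) (at v)"
      unfolding joukowski_def using v unfolding S_def
      by (auto intro!: derivative_eq_intros simp: power2_eq_square)
    moreover have "(\<Phi> has_field_derivative H (joukowski v)) (at (joukowski v))"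
    proof -
      have jv: "joukowski v \<in> E" using v unfolding S_def by blast
      show ?thesis using \<Phi>[OF jv] unfolding at_within_open[OF jv oE] .
    qed
    ultimately have "(\<Phi> \<circ> joukowski has_field_derivative H (joukowski v) * ((1 - 1 / v^2) / 2)) (at v)"
      by (intro DERIV_chain)
    then show "(\<Phi> \<circ> joukowski has_field_derivative H (joukowski v) * ((1 - 1 / v^2) / 2)) (at v within S)"
      by (rule has_field_derivative_at_within)
  qed
  then have g1: "((\<lambda>v. H (joukowski v) * ((1 - 1 / v^2) / 2)) has_contour_integral 0) \<gamma>"
    unfolding \<gamma>_def by simp
  have wn: "((\<lambda>v. 1 / (v - w)) has_contour_integral (2 * of_real pi * \<i>)) \<gamma>" if "cmod w \<le> 1" for w
  proof -
    have "w \<notin> path_image \<gamma>" unfolding path using that r by auto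
    from has_contour_integral_winding_number[OF val this] winding_number_circlepath[of w 0 r] that r
    show ?thesis unfolding \<gamma>_def by simp
  qed
  \<comment> \<open>All three poles lie inside the circle, so their contributions add up as 1 + 1 -
    1 = 1.\<close>
  have g2: "((\<lambda>v. f x * (1 / (v - w1) + 1 / (v - w2) - 1 / (v - 0))) has_contour_integral
      f x * (2 * of_real pi * \<i> + 2 * of_real pi * \<i> - 2 * of_real pi * \<i>)) \<gamma>"
    unfolding w1_def w2_def
    by (intro has_contour_integral_lmul has_contour_integral_add has_contour_integral_diff wn) auto
  have "((\<lambda>v. f (joukowski v) * cauchy_kernel \<theta> v / v) has_contour_integral (2 * of_real pi * \<i> * f x)) \<gamma>"
  proof (rule has_contour_integral_eq[rotated])
    show "((\<lambda>v. H (joukowski v) * ((1 - 1 / v^2) / 2) + f x * (1 / (v - w1) + 1 / (v - w2) - 1 / (v - 0)))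
        has_contour_integral (2 * of_real pi * \<i> * f x)) \<gamma>"
      using has_contour_integral_add[OF g1 g2] by (simp add: mult_ac)
    fix v assume "v \<in> path_image \<gamma>"
    then have nv: "cmod v = r" unfolding path by simp
    have ne: "v \<noteq> 0" "v \<noteq> w1" "v \<noteq> w2" using nv r unfolding w1_def w2_def by auto
    have w: "w1 * w2 = 1" "w1 + w2 = 2 * x"
      unfolding w1_def w2_def x_def by (auto simp: cis_mult complex_eq_iff)
    define A where "A = 1 / (v - w1) + 1 / (v - w2) - 1 / v"
    have J: "joukowski v - x = (v - w1) * (v - w2) / (2 * v)"
    proof -
      have "(v - w1) * (v - w2) = v^2 - (w1 + w2) * v + w1 * w2" by (simp add: algebra_simps power2_eq_square)
      then show ?thesis unfolding w joukowski_def using ne by (simp add: field_simps power2_eq_square)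
    qed
    then have Jx: "joukowski v \<noteq> x" using ne by auto
    have "(joukowski v - x) * A = ((v - w2) + (v - w1) - (v - w1) * (v - w2) / v) / (2 * v)"
      unfolding J A_def using ne by (simp add: divide_simps)
    also have "(v - w2) + (v - w1) - (v - w1) * (v - w2) / v = v - 1 / v"
    proof -
      have "(v - w1) * (v - w2) = v^2 - (w1 + w2) * v + w1 * w2" by (simp add: algebra_simps power2_eq_square)
      then show ?thesis using ne w by (simp add: field_simps power2_eq_square)
    qed
    also have "(v - 1 / v) / (2 * v) = (1 - 1 / v^2) / 2" using ne by (simp add: field_simps power2_eq_square)
    finally have JA: "(1 - 1 / v^2) / 2 = (joukowski v - x) * A" ..
    have HA: "H (joukowski v) * ((1 - 1 / v^2) / 2) = (f (joukowski v) - f x) * A"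
      unfolding JA H_def using Jx by simp
    have kA: "cauchy_kernel \<theta> v / v = A"
      unfolding cauchy_kernel_def A_def w1_def[symmetric] w2_def[symmetric]
      using ne by (simp add: divide_simps) (simp add: algebra_simps)
    have "H (joukowski v) * ((1 - 1 / v^2) / 2) + f x * (1 / (v - w1) + 1 / (v - w2) - 1 / (v - 0))
        = (f (joukowski v) - f x) * A + f x * A"
      unfolding HA by (simp add: A_def)
    also have "\<dots> = f (joukowski v) * A" by (simp add: algebra_simps)
    also have "\<dots> = f (joukowski v) * cauchy_kernel \<theta> v / v" unfolding kA[symmetric] by simp
    finally show "H (joukowski v) * ((1 - 1 / v^2) / 2) + f x * (1 / (v - w1) + 1 / (v - w2) - 1 / (v - 0))
        = f (joukowski v) * cauchy_kernel \<theta> v / v" .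
  qed
  then have "((\<lambda>t. 2 * of_real pi * \<i> * (f (joukowski (of_real r * cis (2 * pi * t))) *
       cauchy_kernel \<theta> (of_real r * cis (2 * pi * t)))) has_integral (2 * of_real pi * \<i> * f x)) {0..1}"
    unfolding has_contour_integral_def
  proof (rule has_integral_eq[rotated])
    fix t :: real assume t: "t \<in> {0..1}"
    have e: "circlepath 0 r t = of_real r * cis (2 * pi * t)" 
      unfolding circlepath by (simp add: cis_conv_exp mult_ac)
    then show "f (joukowski (\<gamma> t)) * cauchy_kernel \<theta> (\<gamma> t) / \<gamma> t * vector_derivative \<gamma> (at t within {0..1})
       = 2 * of_real pi * \<i> * (f (joukowski (of_real r * cis (2 * pi * t))) * cauchy_kernel \<theta> (of_real r * cis (2 * pi * t)))"
      using t r unfolding \<gamma>_def by (simp add: vector_derivative_circlepath01 cis_conv_exp mult_ac)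
  qed
  from has_integral_mult_right[OF this, of "1 / (2 * of_real pi * \<i>)"]
  show ?thesis unfolding x_def by (simp add: field_simps)
qed

section \<open>Fourier expansion of the error kernel\<close>

lemma has_integral_cos_2pi:
  fixes l :: int
  shows "((\<lambda>t. cos (2 * pi * of_int l * t)) has_integral (if l = 0 then 1 else 0)) {0..1}"
proof (cases "l = 0")
  case False
  have "((\<lambda>t. cos (2 * pi * of_int l * t)) has_integral
     (sin (2 * pi * of_int l * 1) / (2 * pi * of_int l) - sin (2 * pi * of_int l * 0) / (2 * pi * of_int l))) {0..1}"
  proof (rule fundamental_theorem_of_calculus)
    fix t :: real assume "t \<in> {0..1}"
    have "((\<lambda>t. sin (2 * pi * of_int l * t) / (2 * pi * of_int l)) has_real_derivative cos (2 * pi * of_int l * t)) (at t within {0..1})"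
      using False by (auto intro!: derivative_eq_intros)
    then show "((\<lambda>t. sin (2 * pi * of_int l * t) / (2 * pi * of_int l)) has_vector_derivative cos (2 * pi * of_int l * t)) (at t within {0..1})"
      by (simp add: has_real_derivative_iff_has_vector_derivative)
  qed simp
  moreover have "sin (2 * pi * of_int l * 1) = 0"
    using sin_integer_2pi[of "of_int l"] by simp
  ultimately show ?thesis using False by simp
next
  case True
  have "((\<lambda>t::real. 1::real) has_integral 1) {0..1}"
    using has_integral_const_real[of "1::real" 0 1] by simp
  with True show ?thesis by simp
qed

lemma has_integral_trig_poly_square:
  fixes c :: "nat \<Rightarrow> real"
  assumes "finite A"
  shows "((\<lambda>t. (cmod (\<Sum>m\<in>A. of_real (c m) * cis (2 * pi * real m * t)))\<^sup>2) has_integral (\<Sum>m\<in>A. (c m)\<^sup>2)) {0..1}"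
proof -
  have "(cmod (\<Sum>m\<in>A. of_real (c m) * cis (2 * pi * real m * t)))\<^sup>2
      = (\<Sum>m\<in>A. \<Sum>n\<in>A. c m * c n * cos (2 * pi * of_int (int m - int n) * t))" for t
  proof -
    have "complex_of_real ((cmod (\<Sum>m\<in>A. of_real (c m) * cis (2 * pi * real m * t)))\<^sup>2)
       = (\<Sum>m\<in>A. \<Sum>n\<in>A. (of_real (c m) * cis (2 * pi * real m * t)) * cnj (of_real (c n) * cis (2 * pi * real n * t)))"
      unfolding complex_norm_square cnj_sum sum_product ..
    then have "(cmod (\<Sum>m\<in>A. of_real (c m) * cis (2 * pi * real m * t)))\<^sup>2
       = Re (\<Sum>m\<in>A. \<Sum>n\<in>A. (of_real (c m) * cis (2 * pi * real m * t)) * cnj (of_real (c n) * cis (2 * pi * real n * t)))"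
      by (metis Re_complex_of_real)
    also have "\<dots> = (\<Sum>m\<in>A. \<Sum>n\<in>A. c m * c n * cos (2 * pi * real m * t - 2 * pi * real n * t))"
      unfolding Re_sum by (intro sum.cong refl) (simp add: cos_diff algebra_simps)
    finally show ?thesis by (simp add: algebra_simps)
  qed
  moreover have "((\<lambda>t. \<Sum>m\<in>A. \<Sum>n\<in>A. c m * c n * cos (2 * pi * of_int (int m - int n) * t)) has_integral
      (\<Sum>m\<in>A. \<Sum>n\<in>A. c m * c n * (if int m - int n = 0 then 1 else 0))) {0..1}"
    using assms by (intro has_integral_sum has_integral_mult_right has_integral_cos_2pi)
  moreover have "(\<Sum>m\<in>A. \<Sum>n\<in>A. c m * c n * (if int m - int n = 0 then 1 else 0)) = (\<Sum>m\<in>A. (c m)\<^sup>2)"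
    using assms by (intro sum.cong refl) (simp add: if_distrib[of "(*) _"] power2_eq_square cong: if_cong)
  ultimately show ?thesis by simp
qed

lemma geometric_remainder:
  fixes w v :: complex
  assumes "v \<noteq> 0" "v \<noteq> w"
  shows "w / (v - w) = (\<Sum>m=1..M. (w / v) ^ m) + (w / v) ^ M * (w / (v - w))"
proof (induction M)
  case (Suc M)
  have "w / (v - w) = w / v + w / v * (w / (v - w))" using assms by (simp add: field_simps)
  then have "(w / v) ^ M * (w / (v - w)) = (w / v) ^ Suc M + (w / v) ^ Suc M * (w / (v - w))"
    by (metis distrib_left mult.assoc power_Suc2)
  moreover have "(\<Sum>m=1..Suc M. (w / v) ^ m) = (\<Sum>m=1..M. (w / v) ^ m) + (w / v) ^ Suc M" by simp
  ultimately show ?case using Suc by (metis add.assoc)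
qed simp

text \<open>The exact remainder of the two geometric expansions after M terms. With an explicit
  remainder, Parseval is needed for finite sums only and no infinite series is integrated.\<close>

definition kernel_tail :: "nat \<Rightarrow> real \<Rightarrow> complex \<Rightarrow> complex" where
  "kernel_tail M \<theta> v = (cis \<theta> / v) ^ M * (cis \<theta> / (v - cis \<theta>))
     + (cis (- \<theta>) / v) ^ M * (cis (- \<theta>) / (v - cis (- \<theta>)))"

lemma cauchy_kernel_expansion:
  assumes "1 < cmod v"
  shows "cauchy_kernel \<theta> v = 1 + (\<Sum>m=1..M. of_real (2 * cos (real m * \<theta>)) / v ^ m) + kernel_tail M \<theta> v"
proof -
  have ne: "v \<noteq> 0" "v \<noteq> cis \<theta>" "v \<noteq> cis (- \<theta>)" using assms by auto
  have "(cis \<theta> / v) ^ m + (cis (- \<theta>) / v) ^ m = of_real (2 * cos (real m * \<theta>)) / v ^ m" for m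
    unfolding power_divide Complex.DeMoivre add_divide_distrib[symmetric]
    by (rule arg_cong2[where f = "(/)"]) (auto simp: complex_eq_iff)
  then have S: "(\<Sum>m=1..M. (cis \<theta> / v) ^ m) + (\<Sum>m=1..M. (cis (- \<theta>) / v) ^ m)
      = (\<Sum>m=1..M. of_real (2 * cos (real m * \<theta>)) / v ^ m)"
    by (simp only: sum.distrib[symmetric])
  have K: "cauchy_kernel \<theta> v = 1
      + ((\<Sum>m=1..M. (cis \<theta> / v) ^ m) + (cis \<theta> / v) ^ M * (cis \<theta> / (v - cis \<theta>)))
      + ((\<Sum>m=1..M. (cis (- \<theta>) / v) ^ m) + (cis (- \<theta>) / v) ^ M * (cis (- \<theta>) / (v - cis (- \<theta>))))"
    unfolding cauchy_kernel_def by (intro arg_cong2[where f = "(+)"] refl geometric_remainder ne)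
  show ?thesis unfolding kernel_tail_def K S[symmetric] by (simp only: add_ac)
qed

lemma kernel_tail_bound:
  assumes "1 < cmod v"
  shows "cmod (kernel_tail M \<theta> v) \<le> 2 / (cmod v - 1) / cmod v ^ M"
proof -
  have 1: "cmod ((cis a / v) ^ M * (cis a / (v - cis a))) \<le> 1 / (cmod v - 1) / cmod v ^ M" for a
  proof -
    have "cmod v - 1 \<le> cmod (v - cis a)" using norm_triangle_ineq2[of v "cis a"] by simp
    then have "1 / cmod (v - cis a) \<le> 1 / (cmod v - 1)"
      using assms by (intro divide_left_mono mult_pos_pos) linarith+
    then have "1 / cmod (v - cis a) / cmod v ^ M \<le> 1 / (cmod v - 1) / cmod v ^ M"
      by (intro divide_right_mono) auto
    then show ?thesis by (simp add: norm_mult norm_divide norm_power power_divide mult.commute)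
  qed
  show ?thesis unfolding kernel_tail_def
    using norm_triangle_mono[OF 1[of \<theta>] 1[of "- \<theta>"]] by (simp add: add_divide_distrib[symmetric])
qed

text \<open>Subtracting Cauchy's formula at the nodes represents the error as the integral of f
  against a kernel k. Up to a tail of size \<open>C * (1/r) ^ M\<close>, k is a trigonometric
  polynomial with coefficients \<open>2 * alias_err N \<theta> m / r ^ m\<close>, so its mean square
  is at most \<open>A^2\<close> by \<open>alias_energy\<close>; finally M tends to infinity.\<close>

lemma interp_error_circle:
  assumes f: "f holomorphic_on bernstein_ellipse \<rho>" and r: "1 < r" "r < \<rho>" and N: "0 < N"
    and B: "\<And>z. z \<in> bernstein_ellipse \<rho> \<Longrightarrow> cmod (f z) \<le> B"
  defines "q \<equiv> 1 / r\<^sup>2"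
  shows "cmod (f (of_real (cos \<theta>)) - (\<Sum>k\<le>N. of_real (lobatto_cardinal N k \<theta>) * f (of_real (cos (lobatto_angle N k)))))
     \<le> B * (2 * sqrt (q ^ N * ((1 + q) / (1 - q))))"
proof -
  define v where "v t = of_real r * cis (2 * pi * t)" for t :: real
  define E where "E = f (of_real (cos \<theta>)) - (\<Sum>k\<le>N. of_real (lobatto_cardinal N k \<theta>) * f (of_real (cos (lobatto_angle N k))))"
  define A where "A = 2 * sqrt (q ^ N * ((1 + q) / (1 - q)))"
  define L where "L = (\<Sum>k\<le>N. \<bar>lobatto_cardinal N k \<theta>\<bar>)"
  have q: "0 < q" "q < 1" unfolding q_def using r by (auto simp: divide_less_eq_1_pos one_less_power)
  have A: "0 < A" unfolding A_def using q by simp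
  have nv: "cmod (v t) = r" for t unfolding v_def using r by (simp add: norm_mult)
  have B0: "0 \<le> B" 
    using B[OF real_in_ellipse[of \<rho> 0]] r norm_ge_zero[of "f (of_real 0)"] by linarith
  have fB: "cmod (f (joukowski (v t))) \<le> B" for t
    by (rule B, rule joukowski_in_ellipse) (use r nv in auto)
  define k where "k t = cauchy_kernel \<theta> (v t) - (\<Sum>k\<le>N. of_real (lobatto_cardinal N k \<theta>) * cauchy_kernel (lobatto_angle N k) (v t))" for t
  have "((\<lambda>t. f (joukowski (v t)) * cauchy_kernel \<theta> (v t)
      - (\<Sum>k\<le>N. of_real (lobatto_cardinal N k \<theta>) * (f (joukowski (v t)) * cauchy_kernel (lobatto_angle N k) (v t))))
      has_integral E) {0..1}"
    unfolding v_def E_def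
    by (intro has_integral_diff has_integral_sum has_integral_mult_right ellipse_cauchy_formula[OF f r]) auto
  moreover have "f (joukowski (v t)) * cauchy_kernel \<theta> (v t)
      - (\<Sum>k\<le>N. of_real (lobatto_cardinal N k \<theta>) * (f (joukowski (v t)) * cauchy_kernel (lobatto_angle N k) (v t)))
      = f (joukowski (v t)) * k t" for t
    unfolding k_def right_diff_distrib sum_distrib_left by (simp add: mult_ac)
  ultimately have int: "((\<lambda>t. f (joukowski (v t)) * k t) has_integral E) {0..1}" by simp
  define C where "C = (1 + L) * (2 / (r - 1))"
  have bound: "cmod E \<le> B * (A + C * (1 / r) ^ M)" for M
  proof -
    define c where "c m = 2 * alias_err N \<theta> m / r ^ m" for m
    define S where "S t = (\<Sum>m\<in>{1..M}. of_real (c m) * cis (2 * pi * real m * t))" for t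
    have k: "k t = cnj (S t) + (kernel_tail M \<theta> (v t) - (\<Sum>k\<le>N. of_real (lobatto_cardinal N k \<theta>) * kernel_tail M (lobatto_angle N k) (v t)))" for t
    proof -
      have "1 < cmod (v t)" using nv r by simp
      note ex = cauchy_kernel_expansion[OF this, of _ M]
      \<comment> \<open>The constant term of the kernel cancels, because interpolation reproduces
        constants; hence S starts at m = 1.\<close>
      have one: "(\<Sum>k\<le>N. complex_of_real (lobatto_cardinal N k \<theta>)) = 1"
        using lobatto_interp_cos[OF N, of 0 \<theta>] by (simp flip: of_real_sum)
      have "(\<Sum>m=1..M. of_real (2 * cos (real m * \<theta>)) / v t ^ m)
         - (\<Sum>k\<le>N. of_real (lobatto_cardinal N k \<theta>) * (\<Sum>m=1..M. of_real (2 * cos (real m * lobatto_angle N k)) / v t ^ m))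
         = (\<Sum>m=1..M. of_real (2 * alias_err N \<theta> m) / v t ^ m)"
      proof -
        have "(\<Sum>k\<le>N. of_real (lobatto_cardinal N k \<theta>) * (\<Sum>m=1..M. of_real (2 * cos (real m * lobatto_angle N k)) / v t ^ m))
          = (\<Sum>m=1..M. (\<Sum>k\<le>N. of_real (lobatto_cardinal N k \<theta> * (2 * cos (real m * lobatto_angle N k)))) / v t ^ m)"
          unfolding sum_distrib_left sum_divide_distrib by (subst sum.swap) (simp add: mult_ac)
        moreover have "of_real (2 * cos (real m * \<theta>))
            - (\<Sum>k\<le>N. of_real (lobatto_cardinal N k \<theta> * (2 * cos (real m * lobatto_angle N k))))
            = complex_of_real (2 * alias_err N \<theta> m)" for m
          unfolding alias_err_def by (simp add: right_diff_distrib sum_distrib_left mult_ac)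
        ultimately show ?thesis by (simp only: sum_subtractf[symmetric] diff_divide_distrib[symmetric])
      qed
      \<comment> \<open>Negative powers of v are negative frequencies; conjugating gives a
        polynomial in positive ones with the same modulus.\<close>
      moreover have "of_real (2 * alias_err N \<theta> m) / v t ^ m = cnj (of_real (c m) * cis (2 * pi * real m * t))" for m
      proof -
        have "v t ^ m = of_real (r ^ m) * cis (2 * pi * real m * t)"
          unfolding v_def power_mult_distrib Complex.DeMoivre by (simp add: mult_ac)
        moreover have "inverse (cis (2 * pi * real m * t)) = cnj (cis (2 * pi * real m * t))"
          by (simp add: cis_cnj)
        ultimately show ?thesis unfolding c_def by (simp add: divide_inverse cis_cnj)
      qed
      ultimately show ?thesis
        unfolding k_def ex S_def cnj_sum distrib_left sum.distrib
        by (simp add: one algebra_simps)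
    qed
    have tail: "cmod (kernel_tail M \<theta> (v t) - (\<Sum>k\<le>N. of_real (lobatto_cardinal N k \<theta>) * kernel_tail M (lobatto_angle N k) (v t)))
       \<le> C * (1 / r) ^ M" for t
    proof -
      have T: "cmod (kernel_tail M a (v t)) \<le> 2 / (r - 1) / r ^ M" for a
        using kernel_tail_bound[of "v t" M a] r unfolding nv by simp
      have "cmod (\<Sum>k\<le>N. of_real (lobatto_cardinal N k \<theta>) * kernel_tail M (lobatto_angle N k) (v t))
          \<le> (\<Sum>k\<le>N. \<bar>lobatto_cardinal N k \<theta>\<bar> * (2 / (r - 1) / r ^ M))"
        by (intro sum_norm_le) (unfold norm_mult norm_of_real, rule mult_left_mono[OF T], simp)
      also have "\<dots> = L * (2 / (r - 1) / r ^ M)" unfolding L_def sum_distrib_right ..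
      finally have "cmod (kernel_tail M \<theta> (v t) - (\<Sum>k\<le>N. of_real (lobatto_cardinal N k \<theta>) * kernel_tail M (lobatto_angle N k) (v t)))
          \<le> 2 / (r - 1) / r ^ M + L * (2 / (r - 1) / r ^ M)"
        using T[of \<theta>] by (intro order_trans[OF norm_triangle_ineq4] add_mono)
      also have "\<dots> = C * (1 / r) ^ M" unfolding C_def by (simp add: power_divide distrib_right add_divide_distrib)
      finally show ?thesis .
    qed
    have energy: "(\<Sum>m\<in>{1..M}. (c m)\<^sup>2) \<le> A\<^sup>2"
    proof -
      have "(c m)\<^sup>2 = 4 * ((alias_err N \<theta> m)\<^sup>2 * q ^ m)" for m
        unfolding c_def q_def by (simp add: power_divide power_mult_distrib flip: power_mult) (simp add: mult.commute)
      then have "(\<Sum>m\<in>{1..M}. (c m)\<^sup>2) = 4 * (\<Sum>m\<in>{1..M}. (alias_err N \<theta> m)\<^sup>2 * q ^ m)"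
        by (simp add: sum_distrib_left)
      also have "\<dots> \<le> 4 * (\<Sum>m\<le>M. (alias_err N \<theta> m)\<^sup>2 * q ^ m)"
        using q by (intro mult_left_mono sum_mono2) auto
      also have "\<dots> \<le> 4 * (q ^ N * ((1 + q) / (1 - q)))"
        using alias_energy[OF N q] by (intro mult_left_mono) auto
      also have "\<dots> = A\<^sup>2" unfolding A_def using q by (simp add: power_mult_distrib)
      finally show ?thesis .
    qed
    define G where "G t = B * (((cmod (S t))\<^sup>2 / A + A) / 2 + C * (1 / r) ^ M)" for t
    have G: "(G has_integral B * (((\<Sum>m\<in>{1..M}. (c m)\<^sup>2) / A + A) / 2 + C * (1 / r) ^ M)) {0..1}"
    proof -
      have const: "((\<lambda>t::real. a) has_integral a) {0..1}" for a :: real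
        using has_integral_const_real[of a 0 1] by simp
      show ?thesis unfolding G_def S_def
        by (intro has_integral_mult_right has_integral_add has_integral_divide const has_integral_trig_poly_square) auto
    qed
    have "cmod (f (joukowski (v t)) * k t) \<le> G t" for t
    proof -
      \<comment> \<open>A pointwise substitute for Cauchy--Schwarz in the integral: with A the bound
        for the L2 norm, the integral of the right side is at most A, so nothing is lost.\<close>
      have "cmod (S t) \<le> ((cmod (S t))\<^sup>2 / A + A) / 2"
      proof -
        have "2 * cmod (S t) * A \<le> (cmod (S t))\<^sup>2 + A\<^sup>2" by (rule sum_squares_bound)
        then show ?thesis using A by (simp add: field_simps power2_eq_square)
      qed
      then have "cmod (k t) \<le> ((cmod (S t))\<^sup>2 / A + A) / 2 + C * (1 / r) ^ M"
        unfolding k using tail[of t] by (intro order_trans[OF norm_triangle_ineq] add_mono) simp_all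
      then show ?thesis unfolding norm_mult G_def using fB[of t] B0 by (intro mult_mono) auto
    qed
    then have "cmod (integral {0..1} (\<lambda>t. f (joukowski (v t)) * k t)) \<le> integral {0..1} G"
      by (intro Henstock_Kurzweil_Integration.integral_norm_bound_integral
          has_integral_integrable[OF int] has_integral_integrable[OF G])
    then have "cmod E \<le> B * (((\<Sum>m\<in>{1..M}. (c m)\<^sup>2) / A + A) / 2 + C * (1 / r) ^ M)"
      unfolding integral_unique[OF int] integral_unique[OF G] .
    also have "\<dots> \<le> B * ((A\<^sup>2 / A + A) / 2 + C * (1 / r) ^ M)"
      using energy A B0 by (intro mult_left_mono add_right_mono divide_right_mono) auto
    also have "\<dots> = B * (A + C * (1 / r) ^ M)" using A by (simp add: power2_eq_square)
    finally show ?thesis .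
  qed
  have "(\<lambda>M. B * (A + C * (1 / r) ^ M)) \<longlonglongrightarrow> B * (A + C * 0)"
    using r by (intro tendsto_intros LIMSEQ_power_zero) auto
  then have "cmod E \<le> B * A" using bound by (intro LIMSEQ_le_const[of _ "B * A"]) auto
  then show ?thesis unfolding E_def A_def .
qed

definition node_interp :: "nat \<Rightarrow> real \<Rightarrow> (complex \<Rightarrow> complex) \<Rightarrow> complex" where
  "node_interp N \<theta> f = (\<Sum>k\<le>N. of_real (lobatto_cardinal N k \<theta>) * f (of_real (cos (lobatto_angle N k))))"

text \<open>f is given only on the open ellipse, so the estimate is made on circles of radius r <
  \<rho>; the bound is continuous in r, and r tends to \<rho> from below.\<close>

lemma interp_error:
  assumes f: "f holomorphic_on bernstein_ellipse \<rho>" and \<rho>: "1 < \<rho>" and N: "0 < N"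
    and B: "\<And>z. z \<in> bernstein_ellipse \<rho> \<Longrightarrow> cmod (f z) \<le> B"
  defines "q \<equiv> 1 / \<rho>\<^sup>2"
  shows "cmod (f (of_real (cos \<theta>)) - node_interp N \<theta> f) \<le> B * (2 * sqrt (q ^ N * ((1 + q) / (1 - q))))"
proof -
  define e where "e r = B * (2 * sqrt ((1 / r\<^sup>2) ^ N * ((1 + 1 / r\<^sup>2) / (1 - 1 / r\<^sup>2))))" for r :: real
  have "\<rho>\<^sup>2 \<noteq> 0" "1 - 1 / \<rho>\<^sup>2 \<noteq> 0" using \<rho> by (auto simp: power2_eq_1_iff)
  then have "isCont e \<rho>" unfolding e_def by (intro continuous_intros) (use \<rho> in auto)
  then have "(e \<longlongrightarrow> e \<rho>) (at_left \<rho>)" by (simp add: isCont_def filterlim_at_split)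
  moreover have "\<forall>\<^sub>F r in at_left \<rho>. cmod (f (of_real (cos \<theta>)) - node_interp N \<theta> f) \<le> e r"
  proof -
    have "\<forall>\<^sub>F r in at_left \<rho>. r \<in> {1<..<\<rho>}" using eventually_at_left_real[OF \<rho>] .
    then show ?thesis
      by eventually_elim (use interp_error_circle[OF f _ _ N B] in \<open>auto simp: e_def node_interp_def\<close>)
  qed
  ultimately have "cmod (f (of_real (cos \<theta>)) - node_interp N \<theta> f) \<le> e \<rho>"
    by (intro tendsto_lowerbound[where F = "at_left \<rho>"]) auto
  then show ?thesis unfolding e_def q_def .
qed

lemma interp_norm_cot_mean:
  assumes N: "0 < N" and "0 \<le> \<theta>" and B: "\<And>x. \<bar>x\<bar> \<le> 1 \<Longrightarrow> cmod (f (of_real x)) \<le> B"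
  shows "cmod (node_interp N \<theta> f) \<le> B * cot_mean N"
proof -
  have B0: "0 \<le> B" using order_trans[OF norm_ge_zero B[of 0]] by simp
  have "cmod (node_interp N \<theta> f) \<le> (\<Sum>k\<le>N. \<bar>lobatto_cardinal N k \<theta>\<bar> * B)"
    unfolding node_interp_def
    by (intro sum_norm_le) (unfold norm_mult norm_of_real, intro mult_left_mono B, auto)
  also have "\<dots> \<le> B * cot_mean N"
    unfolding sum_distrib_right[symmetric] using sum_abs_cardinal_le[OF N assms(2)] B0
    by (simp add: mult.commute mult_left_mono)
  finally show ?thesis .
qed

section \<open>A bound for the interpolant that is uniform in the degree\<close>

lemma ln_one_minus_le:
  fixes x :: real
  assumes "0 \<le> x" "x < 1"
  shows "ln (1 - x) \<le> - x - x\<^sup>2 / 2"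
proof -
  have "- 0 - 0\<^sup>2 / 2 - ln (1 - 0) \<le> - x - x\<^sup>2 / 2 - ln (1 - x)"
  proof (rule DERIV_nonneg_imp_nondecreasing[OF assms(1), where f = "\<lambda>x. - x - x\<^sup>2 / 2 - ln (1 - x)"])
    fix t :: real assume t: "0 \<le> t" "t \<le> x"
    have "((\<lambda>x. - x - x\<^sup>2 / 2 - ln (1 - x)) has_real_derivative t\<^sup>2 / (1 - t)) (at t)"
      using t assms by (auto intro!: derivative_eq_intros simp: field_simps power2_eq_square)
    moreover have "0 \<le> t\<^sup>2 / (1 - t)" using t assms by simp
    ultimately show "\<exists>y. ((\<lambda>x. - x - x\<^sup>2 / 2 - ln (1 - x)) has_real_derivative y) (at t) \<and> 0 \<le> y" by blast
  qed
  then show ?thesis by simp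
qed

text \<open>With N x > 2, the second-order bound for ln(1-x) gives N ln(1-x) \<le> -N x (1 + x/2)
  \<le> -2 - x. The version with exponent N-1 saves one factor 1-x, which is wanted explicitly when
  x is not small.\<close>

lemma power_le_exp:
  fixes x :: real
  assumes x: "0 < x" "x < 1" and N: "2 / real N < x" "0 < N"
  shows "(1 - x) ^ N \<le> exp (- 2 - x)" "(1 - x) ^ (N - 1) \<le> exp (- 2 + x\<^sup>2 / 2)"
proof -
  note ln = ln_one_minus_le[of x]
  have pw: "(1 - x) ^ n = exp (real n * ln (1 - x))" for n using x by (simp add: exp_of_nat_mult)
  have "real N * (- x - x\<^sup>2 / 2) = - (real N * x) * (1 + x / 2)" by (simp add: power2_eq_square algebra_simps)
  also have "\<dots> \<le> - 2 * (1 + x / 2)" using N x by (intro mult_right_mono) (auto simp: field_simps)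
  finally have le: "real N * (- x - x\<^sup>2 / 2) \<le> - 2 - x" by (simp add: algebra_simps)
  have "real N * ln (1 - x) \<le> real N * (- x - x\<^sup>2 / 2)" using ln x by (intro mult_left_mono) auto
  with le show "(1 - x) ^ N \<le> exp (- 2 - x)" unfolding pw by simp
  have "real (N - 1) * ln (1 - x) \<le> real (N - 1) * (- x - x\<^sup>2 / 2)" using ln x by (intro mult_left_mono) auto
  also have "\<dots> = real N * (- x - x\<^sup>2 / 2) + x + x\<^sup>2 / 2"
  proof -
    have "real (N - 1) = real N - 1" using N by (simp add: of_nat_diff)
    then show ?thesis by algebra
  qed
  finally show "(1 - x) ^ (N - 1) \<le> exp (- 2 + x\<^sup>2 / 2)" using le unfolding pw by simp
qed

text \<open>The fraction 545/512 is 1 + 1/16 + (1/16)^2/2, the quadratic Taylor bound at 1/16; its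
  powers 32 and 24 reach the exponents 2 and 3/2.\<close>

lemma exp_lower_numeric: "(184 / 25) \<le> exp (2::real)" "(223 / 50) \<le> exp (3 / 2 :: real)"
proof -
  have e: "545 / 512 \<le> exp (1 / 16 :: real)"
    using exp_lower_Taylor_quadratic[of "1 / 16 :: real"] by (simp add: power2_eq_square)
  have "(184 / 25) \<le> (545 / 512 :: real) ^ 32" by (simp add: power_divide)
  also have "\<dots> \<le> exp (1 / 16) ^ 32" using e by (intro power_mono) auto
  also have "\<dots> = exp (2 :: real)" by (simp flip: exp_of_nat_mult)
  finally show "(184 / 25) \<le> exp (2::real)" .
  have "(223 / 50) \<le> (545 / 512 :: real) ^ 24" by (simp add: power_divide)
  also have "\<dots> \<le> exp (1 / 16) ^ 24" using e by (intro power_mono) auto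
  also have "\<dots> = exp (3 / 2 :: real)" by (simp flip: exp_of_nat_mult)
  finally show "(223 / 50) \<le> exp (3 / 2 :: real)" .
qed

text \<open>Up to x = 177/200 the bound exp(-x^2/2) \<ge> 1 - x^2/2 leaves a quadratic inequality
  that holds between 1/4 and 177/200. Beyond it the constant exp(3/2) suffices:
  \<open>4 * (2 - 177/200)\<close> is exactly 223/50.\<close>

lemma exp_dominates_linear:
  fixes x :: real
  assumes "1 / 4 \<le> x" "x \<le> 1"
  shows "4 * (2 - x) \<le> exp (2 - x\<^sup>2 / 2)"
proof (cases "x \<le> 177 / 200")
  case True
  have "0 \<le> (x - 1/4) * (177 / 200 - x)" using assms True by simp
  also have "\<dots> = 227 / 200 * x - 177 / 800 - x\<^sup>2" by (simp add: field_simps power2_eq_square)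
  finally have "4 * (2 - x) \<le> (184 / 25) * (1 - x\<^sup>2 / 2)" using True by simp
  also have "\<dots> \<le> exp 2 * exp (- (x\<^sup>2 / 2))"
  proof (rule mult_mono)
    show "1 - x\<^sup>2 / 2 \<le> exp (- (x\<^sup>2 / 2))" using exp_ge_add_one_self[of "- (x\<^sup>2 / 2)"] by simp
    show "0 \<le> 1 - x\<^sup>2 / 2" using assms power_le_one[of x 2] by simp
  qed (use exp_lower_numeric in auto)
  also have "\<dots> = exp (2 - x\<^sup>2 / 2)" unfolding exp_add[symmetric] by simp
  finally show ?thesis .
next
  case False
  have "4 * (2 - x) \<le> (223 / 50)" using False by simp
  also have "\<dots> \<le> exp (3 / 2)" by (rule exp_lower_numeric)
  also have "\<dots> \<le> exp (2 - x\<^sup>2 / 2)" using assms power_le_one[of x 2] by simp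
  finally show ?thesis .
qed

text \<open>Multiplied by sqrt x with x = 1 - q, the claim is sqrt x + sqrt t \<le> sqrt 2. For x
  \<ge> 1/4 one has t \<le> 1 - x, and (sqrt x + sqrt t)^2 \<le> 2(x + t) is enough. For small x
  this fails, as t may approach 8 exp(-2) > 1, and an unequal weighting of the two terms is
  needed.\<close>

lemma one_plus_error_le:
  fixes q :: real
  assumes q: "0 < q" "q < 1" and N: "2 / real N < 1 - q" "0 < N"
  shows "1 + 2 * sqrt (q ^ N * ((1 + q) / (1 - q))) \<le> sqrt (2 / (1 - q))"
proof -
  define x where "x = 1 - q"
  define t where "t = 4 * q ^ N * (2 - x)"
  have x: "0 < x" "x < 1" unfolding x_def using q by auto
  have qx: "q = 1 - x" unfolding x_def by simp
  have Nx: "2 / real N < x" using N unfolding x_def by simp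
  have t: "0 \<le> t" unfolding t_def using q x by simp
  have "(sqrt x + sqrt t)\<^sup>2 \<le> 2"
  proof (cases "1 / 4 \<le> x")
    case True
    have "t = (1 - x) * (4 * (2 - x) * (1 - x) ^ (N - 1))"
      unfolding t_def qx using N by (cases N) auto
    also have "\<dots> \<le> (1 - x) * (exp (2 - x\<^sup>2 / 2) * exp (- 2 + x\<^sup>2 / 2))"
      using power_le_exp(2)[OF x Nx N(2)] exp_dominates_linear[OF True] x
      by (intro mult_left_mono mult_mono) auto
    also have "exp (2 - x\<^sup>2 / 2) * exp (- 2 + x\<^sup>2 / 2) = 1" by (simp flip: exp_add)
    finally have "t \<le> 1 - x" by simp
    moreover have "2 * sqrt x * sqrt t \<le> (sqrt x)\<^sup>2 + (sqrt t)\<^sup>2" by (rule sum_squares_bound)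
    ultimately show ?thesis using x t by (simp add: power2_sum)
  next
    case False
    have "exp (- 2 - x) \<le> 1 / ((184 / 25) * (1 + x))"
    proof -
      have "(184 / 25) * (1 + x) \<le> exp 2 * exp x"
        using exp_lower_numeric(1) x by (intro mult_mono exp_ge_add_one_self) auto
      then have "1 / (exp 2 * exp x) \<le> 1 / ((184 / 25) * (1 + x))" using x by (intro divide_left_mono) auto
      moreover have "exp (- 2 - x) = 1 / (exp 2 * exp x)" by (simp add: exp_diff exp_minus field_simps)
      ultimately show ?thesis by simp
    qed
    then have "q ^ N \<le> 1 / ((184 / 25) * (1 + x))"
      using power_le_exp(1)[OF x Nx N(2)] unfolding qx by linarith
    then have "t \<le> 4 * (1 / ((184 / 25) * (1 + x))) * (2 - x)"
      unfolding t_def using x by (intro mult_right_mono mult_left_mono) auto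
    also have "\<dots> \<le> (4 - 6 * x) / 3"
    proof -
      have "0 \<le> x * (1 / 4 - x)" using x False by simp
      also have "\<dots> = x / 4 - x * x" by (simp add: algebra_simps)
      finally have xx: "x * x \<le> x / 4" by simp
      have e: "(4 - 6 * x) * ((184 / 25) * (1 + x)) = 736 / 25 - 368 / 25 * x - 1104 / 25 * (x * x)" by (simp add: field_simps)
      have "4 * (2 - x) * 3 \<le> (4 - 6 * x) * ((184 / 25) * (1 + x))" unfolding e using xx False by simp
      then show ?thesis using x by (simp add: divide_le_eq le_divide_eq mult.commute)
    qed
    finally have "t \<le> (4 - 6 * x) / 3" .
    \<comment> \<open>With weights 2x and t/2 the square of the sum is at most 3x + 3t/2, which is
      at most 2 precisely when t \<le> (4 - 6x)/3; this is the origin of that bound.\<close>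
    moreover have "2 * sqrt (2 * x) * sqrt (t / 2) \<le> (sqrt (2 * x))\<^sup>2 + (sqrt (t / 2))\<^sup>2" by (rule sum_squares_bound)
    moreover have "sqrt (2 * x) * sqrt (t / 2) = sqrt x * sqrt t" by (simp flip: real_sqrt_mult)
    ultimately show ?thesis using x t by (simp add: power2_sum)
  qed
  then have "sqrt x + sqrt t \<le> sqrt 2" using real_le_rsqrt by blast
  then have "(sqrt x + sqrt t) / sqrt x \<le> sqrt 2 / sqrt x" using x by (intro divide_right_mono) auto
  moreover have "2 * sqrt (q ^ N * ((1 + q) / (1 - q))) = sqrt t / sqrt x"
  proof -
    have "q ^ N * ((1 + q) / (1 - q)) = t / 4 / x" unfolding t_def x_def by simp
    then show ?thesis by (simp add: real_sqrt_divide real_sqrt_mult)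
  qed
  ultimately show ?thesis using x by (simp add: add_divide_distrib real_sqrt_divide x_def)
qed

lemma interp_norm:
  assumes f: "f holomorphic_on bernstein_ellipse \<rho>" and \<rho>: "1 < \<rho>" and N: "0 < N" and th: "0 \<le> \<theta>"
    and B: "\<And>z. z \<in> bernstein_ellipse \<rho> \<Longrightarrow> cmod (f z) \<le> B"
  defines "q \<equiv> 1 / \<rho>\<^sup>2"
  shows "cmod (node_interp N \<theta> f) \<le> B * sqrt (2 / (1 - q))"
proof -
  have q: "0 < q" "q < 1" unfolding q_def using \<rho> by (auto simp: divide_less_eq_1_pos one_less_power)
  have Bx: "cmod (f (of_real x)) \<le> B" if "\<bar>x\<bar> \<le> 1" for x using that \<rho> by (intro B real_in_ellipse)
  have B0: "0 \<le> B" using Bx[of 0] norm_ge_zero[of "f (of_real 0)"] by linarith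
  \<comment> \<open>If \<open>N\<close> is large compared with \<open>1 / (1 - q)\<close>, the interpolation error is small enough; otherwise
    the Lebesgue constant, at most \<open>sqrt N\<close>, is.\<close>
  show ?thesis
  proof (cases "2 / real N < 1 - q")
    case True
    have "cmod (node_interp N \<theta> f) \<le> cmod (f (of_real (cos \<theta>))) + cmod (f (of_real (cos \<theta>)) - node_interp N \<theta> f)"
      by (metis norm_minus_commute norm_triangle_sub add.commute)
    also have "\<dots> \<le> B + B * (2 * sqrt (q ^ N * ((1 + q) / (1 - q))))"
      unfolding q_def by (intro add_mono Bx interp_error[OF f \<rho> N B]) auto
    also have "\<dots> = B * (1 + 2 * sqrt (q ^ N * ((1 + q) / (1 - q))))" by (simp add: algebra_simps)
    also have "\<dots> \<le> B * sqrt (2 / (1 - q))"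
      using one_plus_error_le[OF q True N] B0 by (intro mult_left_mono)
    finally show ?thesis .
  next
    case False
    have "cot_mean N \<le> sqrt (2 / (1 - q))"
    proof (cases "N = 1")
      case True
      have "cot_mean N = 1" unfolding True cot_mean_def by (simp add: cot_def sin_45 cos_45)
      also have "1 \<le> sqrt (2 / (1 - q))" using q by simp
      finally show ?thesis .
    next
      case N2: False
      then have "(cot_mean N)\<^sup>2 \<le> real N" using N by (intro cot_mean_sq_le) auto
      also have "\<dots> \<le> 2 / (1 - q)" using False q N by (simp add: field_simps)
      finally show ?thesis by (rule real_le_rsqrt)
    qed
    then have "B * cot_mean N \<le> B * sqrt (2 / (1 - q))" using B0 by (rule mult_left_mono)
    moreover have "cmod (node_interp N \<theta> f) \<le> B * cot_mean N"
      using N th Bx by (rule interp_norm_cot_mean)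
    ultimately show ?thesis by linarith
  qed
qed

section \<open>Tensor product interpolation\<close>

definition separately_bounded_holomorphic ::
  "('d::finite \<Rightarrow> real) \<Rightarrow> real \<Rightarrow> (('d \<Rightarrow> complex) \<Rightarrow> complex) \<Rightarrow> bool" where
  "separately_bounded_holomorphic \<rho> B G \<longleftrightarrow>
     (\<forall>w. (\<forall>i. w i \<in> bernstein_ellipse (\<rho> i)) \<longrightarrow>
        cmod (G w) \<le> B \<and> (\<forall>i. (\<lambda>z. G (w(i := z))) holomorphic_on bernstein_ellipse (\<rho> i)))"

definition coord_interp ::
  "('d \<Rightarrow> nat) \<Rightarrow> ('d \<Rightarrow> real) \<Rightarrow> 'd \<Rightarrow> (('d \<Rightarrow> complex) \<Rightarrow> complex) \<Rightarrow> ('d \<Rightarrow> complex) \<Rightarrow> complex" where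
  "coord_interp N \<theta> i G w = node_interp (N i) (\<theta> i) (\<lambda>z. G (w(i := z)))"

lemma coord_interp_separately_bounded:
  assumes G: "separately_bounded_holomorphic \<rho> B G"
    and \<rho>: "\<And>i. 1 < \<rho> i" and N: "\<And>i. 0 < N i" and th: "\<And>i. 0 \<le> \<theta> i"
  shows "separately_bounded_holomorphic \<rho> (B * sqrt (2 / (1 - 1 / (\<rho> i)\<^sup>2))) (coord_interp N \<theta> i G)"
  unfolding separately_bounded_holomorphic_def
proof (intro allI impI conjI)
  fix w assume w: "\<forall>j. w j \<in> bernstein_ellipse (\<rho> j)"
  show "cmod (coord_interp N \<theta> i G w) \<le> B * sqrt (2 / (1 - 1 / (\<rho> i)\<^sup>2))"
    unfolding coord_interp_def
    by (rule interp_norm[OF _ \<rho> N th])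
       (use G w in \<open>auto simp: separately_bounded_holomorphic_def\<close>)
  fix j
  show "(\<lambda>z. coord_interp N \<theta> i G (w(j := z))) holomorphic_on bernstein_ellipse (\<rho> j)"
  proof (cases "j = i")
    case True
    then show ?thesis unfolding coord_interp_def by simp
  next
    case False
    have node: "of_real (cos a) \<in> bernstein_ellipse (\<rho> i)" for a using \<rho> by (intro real_in_ellipse) auto
    have "(\<lambda>z. G (w(i := of_real (cos a), j := z))) holomorphic_on bernstein_ellipse (\<rho> j)" for a
      using G w node unfolding separately_bounded_holomorphic_def by simp
    moreover have "w(j := z, i := c) = w(i := c, j := z)" for z c using False by auto
    ultimately show ?thesis unfolding coord_interp_def node_interp_def
      by (intro holomorphic_intros) simp
  qed
qed

lemma coord_interp_error:
  assumes G: "separately_bounded_holomorphic \<rho> B G" and w: "\<And>j. w j \<in> bernstein_ellipse (\<rho> j)"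
    and \<rho>: "1 < \<rho> i" and N: "0 < N i" and wi: "w i = of_real (cos (\<theta> i))"
  shows "cmod (G w - coord_interp N \<theta> i G w)
     \<le> B * (2 * sqrt ((1 / (\<rho> i)\<^sup>2) ^ N i * ((1 + 1 / (\<rho> i)\<^sup>2) / (1 - 1 / (\<rho> i)\<^sup>2))))"
proof -
  have "cmod (G (w(i := of_real (cos (\<theta> i)))) - node_interp (N i) (\<theta> i) (\<lambda>z. G (w(i := z))))
     \<le> B * (2 * sqrt ((1 / (\<rho> i)\<^sup>2) ^ N i * ((1 + 1 / (\<rho> i)\<^sup>2) / (1 - 1 / (\<rho> i)\<^sup>2))))"
    by (rule interp_error[OF _ \<rho> N])
       (use G w in \<open>auto simp: separately_bounded_holomorphic_def\<close>)
  then show ?thesis unfolding coord_interp_def wi[symmetric] by simp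
qed

text \<open>Cauchy--Schwarz for the vectors (1, sqrt k) and (sqrt \<sigma>, sqrt Q), with k =
  (1+q)/(1-q).\<close>

lemma error_recursion:
  fixes q :: real
  assumes q: "0 < q" "q < 1" and "0 \<le> Q" "0 \<le> \<sigma>"
  shows "sqrt \<sigma> + sqrt (Q * ((1 + q) / (1 - q))) \<le> sqrt (2 / (1 - q)) * sqrt (Q + \<sigma>)"
proof -
  define k where "k = (1 + q) / (1 - q)"
  have k: "0 < k" "2 / (1 - q) = 1 + k" unfolding k_def using q by (auto simp: field_simps)
  have "2 * sqrt (\<sigma> * k) * sqrt Q \<le> \<sigma> * k + Q"
    using sum_squares_bound[of "sqrt (\<sigma> * k)" "sqrt Q"] assms k by simp
  then have "(sqrt \<sigma> + sqrt (Q * k))\<^sup>2 \<le> (1 + k) * (Q + \<sigma>)"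
    using assms k by (simp add: power2_sum real_sqrt_mult algebra_simps)
  then show ?thesis unfolding k(2) k_def[symmetric] real_sqrt_mult[symmetric] by (rule real_le_rsqrt)
qed

text \<open>Both claims are carried through one induction: the error made in coordinate i is that of
  interpolating the partial interpolant \<open>J L\<close>, whose bound is given by the first
  claim.\<close>

lemma fold_coord_interp:
  assumes G: "separately_bounded_holomorphic \<rho> B G" and B: "0 \<le> B"
    and \<rho>: "\<And>i. 1 < \<rho> i" and N: "\<And>i. 0 < N i" and th: "\<And>i. 0 \<le> \<theta> i"
  defines "s \<equiv> \<lambda>i. sqrt (2 / (1 - 1 / (\<rho> i)\<^sup>2))" and "Q \<equiv> \<lambda>i. (1 / (\<rho> i)\<^sup>2) ^ N i"
    and "J \<equiv> \<lambda>L. foldr (coord_interp N \<theta>) L G" and "x \<equiv> \<lambda>i. complex_of_real (cos (\<theta> i))"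
  shows "separately_bounded_holomorphic \<rho> (B * prod_list (map s L)) (J L)"
    and "cmod (G x - J L x) \<le> B * (2 * (prod_list (map s L) * sqrt (sum_list (map Q L))))"
proof (induction L)
  case Nil
  { case 1 show ?case using G unfolding J_def by simp }
  { case 2 show ?case unfolding J_def by simp }
next
  case (Cons i L)
  define R where "R = prod_list (map s L)"
  define \<sigma> where "\<sigma> = sum_list (map Q L)"
  define q where "q = 1 / (\<rho> i)\<^sup>2"
  have q: "0 < q" "q < 1" unfolding q_def using \<rho>[of i] by (auto simp: divide_less_eq_1_pos one_less_power)
  have sQ: "0 \<le> s j" "0 \<le> Q j" for j
    unfolding s_def Q_def using \<rho>[of j] by (auto simp: divide_le_eq_1_pos one_le_power)
  have R: "0 \<le> R" unfolding R_def using sQ by (intro prod_list_nonneg) auto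
  have \<sigma>: "0 \<le> \<sigma>" unfolding \<sigma>_def using sQ by (intro sum_list_nonneg) auto
  have step: "J (i # L) = coord_interp N \<theta> i (J L)" unfolding J_def by simp
  { case 1
    show ?case
      using coord_interp_separately_bounded[OF Cons.IH(1), of N \<theta> i, OF \<rho> N th] unfolding step s_def by (simp add: mult_ac) }
  { case 2
    have "cmod (G x - J (i # L) x) \<le> cmod (G x - J L x) + cmod (J L x - J (i # L) x)"
      by (metis diff_add_cancel diff_diff_eq2 norm_triangle_ineq add_diff_eq)
    also have "\<dots> \<le> B * (2 * (R * sqrt \<sigma>)) + (B * R) * (2 * sqrt (Q i * ((1 + q) / (1 - q))))"
      using Cons.IH(2) coord_interp_error[OF Cons.IH(1), of x i N \<theta>] \<rho> N
      unfolding step R_def \<sigma>_def Q_def q_def x_def by (intro add_mono) (auto simp: real_in_ellipse)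
    also have "\<dots> = 2 * (B * R) * (sqrt \<sigma> + sqrt (Q i * ((1 + q) / (1 - q))))" by (simp add: algebra_simps)
    also have "\<dots> \<le> 2 * (B * R) * (s i * sqrt (Q i + \<sigma>))"
      unfolding s_def q_def[symmetric] using q sQ \<sigma> B R by (intro mult_left_mono error_recursion) auto
    finally show ?case unfolding R_def \<sigma>_def by (simp add: mult_ac) }
qed

text \<open>Indices of coordinates outside L are pinned to 0, so the sum runs over a finite set of
  total functions. Prepending coordinate i is then the bijection sending (m, k) to
  \<open>k(i := m)\<close>.\<close>

lemma coord_interp_fold_eq:
  fixes N :: "'d::finite \<Rightarrow> nat"
  assumes "distinct L"
  shows "foldr (coord_interp N \<theta>) L G w =
    (\<Sum>k | \<forall>i. k i \<le> (if i \<in> set L then N i else 0).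
       of_real (\<Prod>i\<in>set L. lobatto_cardinal (N i) (k i) (\<theta> i)) *
       G (\<lambda>i. if i \<in> set L then of_real (cos (lobatto_angle (N i) (k i))) else w i))"
  using assms
proof (induction L arbitrary: w)
  case Nil
  have "{k. \<forall>i. k i \<le> (0::nat)} = {\<lambda>_::'d. 0}" by auto
  then show ?case by simp
next
  case (Cons i L)
  define K where "K = {k. \<forall>j. k j \<le> (if j \<in> set L then N j else 0)}"
  have i: "i \<notin> set L" using Cons.prems by simp
  define summand where "summand w k = of_real (\<Prod>j\<in>set L. lobatto_cardinal (N j) (k j) (\<theta> j)) *
       G (\<lambda>j. if j \<in> set L then of_real (cos (lobatto_angle (N j) (k j))) else w j)" for w k
  have "foldr (coord_interp N \<theta>) (i # L) G w = (\<Sum>m\<le>N i. \<Sum>k\<in>K. of_real (lobatto_cardinal (N i) m (\<theta> i)) *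
      summand (w(i := of_real (cos (lobatto_angle (N i) m)))) k)"
  proof -
    have IH: "foldr (coord_interp N \<theta>) L G w' = (\<Sum>k\<in>K. summand w' k)" for w'
      using Cons unfolding K_def summand_def by simp
    have "foldr (coord_interp N \<theta>) (i # L) G w = node_interp (N i) (\<theta> i) (\<lambda>z. foldr (coord_interp N \<theta>) L G (w(i := z)))"
      by (simp add: coord_interp_def)
    then show ?thesis unfolding IH node_interp_def sum_distrib_left .
  qed
  also have "\<dots> = (\<Sum>(m, k)\<in>{..N i} \<times> K. of_real (lobatto_cardinal (N i) m (\<theta> i)) *
      summand (w(i := of_real (cos (lobatto_angle (N i) m)))) k)"
    by (rule sum.cartesian_product)
  also have "\<dots> = (\<Sum>k | \<forall>j. k j \<le> (if j \<in> set (i # L) then N j else 0).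
       of_real (\<Prod>j\<in>set (i # L). lobatto_cardinal (N j) (k j) (\<theta> j)) *
       G (\<lambda>j. if j \<in> set (i # L) then of_real (cos (lobatto_angle (N j) (k j))) else w j))"
  proof (rule sum.reindex_bij_witness[where i = "\<lambda>k. (k i, k(i := 0))" and j = "\<lambda>(m, k). k(i := m)"])
    fix a assume "a \<in> {..N i} \<times> K"
    then obtain m k where a: "a = (m, k)" "m \<le> N i" "k \<in> K" by auto
    have k0: "k i = 0" using a(3) i unfolding K_def by (auto dest: spec[of _ i])
    show "((case a of (m, k) \<Rightarrow> k(i := m)) i, (case a of (m, k) \<Rightarrow> k(i := m))(i := 0)) = a"
      unfolding a using k0 by auto
    show "(case a of (m, k) \<Rightarrow> k(i := m)) \<in> {k. \<forall>j. k j \<le> (if j \<in> set (i # L) then N j else 0)}"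
    proof (intro CollectI allI)
      fix j
      have "k j \<le> (if j \<in> set L then N j else 0)" using a(3) unfolding K_def by blast
      then show "(case a of (m, k) \<Rightarrow> k(i := m)) j \<le> (if j \<in> set (i # L) then N j else 0)"
        unfolding a using a(2) i by (auto split: if_splits)
    qed
    have "(\<Prod>j\<in>set L. lobatto_cardinal (N j) ((k(i := m)) j) (\<theta> j)) = (\<Prod>j\<in>set L. lobatto_cardinal (N j) (k j) (\<theta> j))"
      using i by (intro prod.cong) auto
    moreover have "(\<lambda>j. if j \<in> set (i # L) then complex_of_real (cos (lobatto_angle (N j) ((k(i := m)) j))) else w j)
      = (\<lambda>j. if j \<in> set L then of_real (cos (lobatto_angle (N j) (k j))) else (w(i := of_real (cos (lobatto_angle (N i) m)))) j)"
      using i by auto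
    ultimately show "of_real (\<Prod>j\<in>set (i # L). lobatto_cardinal (N j) ((case a of (m, k) \<Rightarrow> k(i := m)) j) (\<theta> j)) *
       G (\<lambda>j. if j \<in> set (i # L) then of_real (cos (lobatto_angle (N j) ((case a of (m, k) \<Rightarrow> k(i := m)) j))) else w j)
      = (case a of (m, k) \<Rightarrow> of_real (lobatto_cardinal (N i) m (\<theta> i)) * summand (w(i := of_real (cos (lobatto_angle (N i) m)))) k)"
      unfolding a prod.case summand_def using i by simp
  next
    fix k assume "k \<in> {k. \<forall>j. k j \<le> (if j \<in> set (i # L) then N j else 0)}"
    then show "(case (k i, k(i := 0)) of (m, k) \<Rightarrow> k(i := m)) = k"
      "(k i, k(i := 0)) \<in> {..N i} \<times> K"
      unfolding K_def using i by (auto split: if_splits)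
  qed
  finally show ?case .
qed

section \<open>The tensor interpolant in cardinal form\<close>

lemma multi_indices_eq_PiE: "multi_indices N = (\<Pi>\<^sub>E i\<in>UNIV. {..N i})"
  unfolding multi_indices_def PiE_def Pi_def by auto

lemma finite_multi_indices [simp]: "finite (multi_indices N)"
  unfolding multi_indices_eq_PiE by (rule finite_PiE) auto

lemma sum_multi_indices_prod:
  fixes f :: "'d::finite \<Rightarrow> nat \<Rightarrow> real"
  shows "(\<Sum>k\<in>multi_indices N. \<Prod>i\<in>UNIV. f i (k i)) = (\<Prod>i\<in>UNIV. \<Sum>m\<le>N i. f i m)"
  unfolding multi_indices_eq_PiE by (subst prod_sum_PiE) auto

lemma lobatto_angle_range:
  assumes "k \<le> N" shows "0 \<le> lobatto_angle N k" "lobatto_angle N k \<le> pi"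
  unfolding lobatto_angle_def using assms by (auto simp: divide_le_eq)

definition cheb_angle :: "real^'d \<Rightarrow> real^'d \<Rightarrow> real^'d \<Rightarrow> 'd \<Rightarrow> real" where
  "cheb_angle lo hi x i = arccos (inv_into (cbox (-1) 1) (box_map lo hi) x $ i)"

lemma box_map_image:
  assumes "\<And>i. lo $ i < hi $ i"
  shows "box_map lo hi ` cbox (-1) 1 = cbox lo hi"
proof (intro equalityI subsetI)
  fix x assume "x \<in> box_map lo hi ` cbox (-1) 1"
  then obtain z where z: "x = box_map lo hi z" "\<And>i. -1 \<le> z $ i" "\<And>i. z $ i \<le> 1"
    by (auto simp: mem_box_cart)
  show "x \<in> cbox lo hi" unfolding mem_box_cart
  proof (intro allI conjI)
    fix i
    have "0 \<le> (hi $ i - lo $ i) * (1 - z $ i)" "0 \<le> (hi $ i - lo $ i) * (1 + z $ i)"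
      using assms[of i] z(2,3)[of i] by (auto intro!: mult_nonneg_nonneg)
    then show "lo $ i \<le> x $ i" "x $ i \<le> hi $ i" unfolding z(1) box_map_def by (auto simp: field_simps)
  qed
next
  fix x assume x: "x \<in> cbox lo hi"
  define z :: "real^'a" where "z = (\<chi> i. 1 - 2 * (hi $ i - x $ i) / (hi $ i - lo $ i))"
  have "x = box_map lo hi z"
    unfolding box_map_def z_def vec_eq_iff using assms by (simp add: field_simps less_imp_neq[symmetric])
  moreover have "z \<in> cbox (-1) 1"
    unfolding mem_box_cart z_def using x assms by (auto simp: mem_box_cart divide_le_eq le_divide_eq algebra_simps)
  ultimately show "x \<in> box_map lo hi ` cbox (-1) 1" by blast
qed

lemma cheb_angle_props:
  assumes box: "\<And>i. lo $ i < hi $ i" and x: "x \<in> cbox lo hi"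
  shows "0 \<le> cheb_angle lo hi x i" "cheb_angle lo hi x i \<le> pi"
    "x = box_map lo hi (\<chi> i. cos (cheb_angle lo hi x i))"
    "cheb_tensor j (inv_into (cbox (-1) 1) (box_map lo hi) x) = (\<Prod>i\<in>UNIV. cos (real (j i) * cheb_angle lo hi x i))"
proof -
  define z where "z = inv_into (cbox (-1) 1) (box_map lo hi) x"
  have "x \<in> box_map lo hi ` cbox (-1) 1" using box_map_image[OF box] x by auto
  then have z: "z \<in> cbox (-1) 1" "box_map lo hi z = x"
    unfolding z_def by (auto intro: inv_into_into f_inv_into_f)
  then have zi: "-1 \<le> z $ i" "z $ i \<le> 1" for i by (auto simp: mem_box_cart)
  show "0 \<le> cheb_angle lo hi x i" "cheb_angle lo hi x i \<le> pi"
    unfolding cheb_angle_def z_def[symmetric] using zi by (auto intro: arccos_lbound arccos_ubound)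
  have "(\<chi> i. cos (cheb_angle lo hi x i)) = z"
    unfolding cheb_angle_def z_def[symmetric] vec_eq_iff using zi by simp
  then show "x = box_map lo hi (\<chi> i. cos (cheb_angle lo hi x i))" using z by simp
  show "cheb_tensor j (inv_into (cbox (-1) 1) (box_map lo hi) x) = (\<Prod>i\<in>UNIV. cos (real (j i) * cheb_angle lo hi x i))"
    unfolding cheb_tensor_def cheb_poly_def cheb_angle_def ..
qed

lemma cheb_tensor_node:
  assumes "k \<in> multi_indices N"
  shows "cheb_tensor j (ref_node N k) = (\<Prod>i\<in>UNIV. cos (real (j i) * lobatto_angle (N i) (k i)))"
  unfolding cheb_tensor_def cheb_poly_def
proof (rule prod.cong[OF refl])
  fix i
  have "k i \<le> N i" using assms unfolding multi_indices_def by auto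
  then show "cos (real (j i) * arccos (ref_node N k $ i)) = cos (real (j i) * lobatto_angle (N i) (k i))"
    unfolding ref_node_def using arccos_cos[OF lobatto_angle_range[of "k i" "N i"]]
    by (simp add: lobatto_angle_def)
qed

definition tensor_cardinal :: "real^'d \<Rightarrow> real^'d \<Rightarrow> ('d \<Rightarrow> nat) \<Rightarrow> ('d \<Rightarrow> nat) \<Rightarrow> real^'d \<Rightarrow> real" where
  "tensor_cardinal lo hi N k x = (\<Prod>i\<in>UNIV. lobatto_cardinal (N i) (k i) (cheb_angle lo hi x i))"

text \<open>Once the coefficient formula is inserted, every factor splits over the coordinates;
  exchanging the sums over degrees and nodes leaves, for each node, a product of one-dimensional
  sums over degrees, which are the cardinal functions.\<close>

lemma cheb_interp_eq_cardinal:
  assumes box: "\<And>i. lo $ i < hi $ i" and x: "x \<in> cbox lo hi" and N: "\<And>i. 0 < N i"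
  shows "cheb_interp lo hi N v x = (\<Sum>k\<in>multi_indices N. v k * tensor_cardinal lo hi N k x)"
proof -
  define c where "c i j k = (2 / real (N i)) * lobatto_weight (N i) k * (lobatto_weight (N i) j *
      cos (real j * lobatto_angle (N i) k) * cos (real j * cheb_angle lo hi x i))" for i j k
  have "cheb_coeff N v j * cheb_basis lo hi j x = (\<Sum>k\<in>multi_indices N. v k * (\<Prod>i\<in>UNIV. c i (j i) (k i)))"
    if j: "j \<in> multi_indices N" for j
  proof -
    \<comment> \<open>The factor 2 for inner degrees and 1 for extreme ones is twice the trapezoidal
      weight, which restores the symmetry between degrees and nodes.\<close>
    have "(\<Prod>i\<in>UNIV. (if 0 < j i \<and> j i < N i then 2 else 1) / real (N i)) = (\<Prod>i\<in>UNIV. 2 / real (N i) * lobatto_weight (N i) (j i))"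
    proof (rule prod.cong[OF refl])
      fix i
      have "j i \<le> N i" using j unfolding multi_indices_def by auto
      then show "(if 0 < j i \<and> j i < N i then 2 else 1) / real (N i) = 2 / real (N i) * lobatto_weight (N i) (j i)"
        unfolding lobatto_weight_def by auto
    qed
    moreover have "(\<Prod>i\<in>UNIV. if k i = 0 \<or> k i = N i then 1/2 else 1) = (\<Prod>i\<in>UNIV. lobatto_weight (N i) (k i))" for k
      unfolding lobatto_weight_def ..
    moreover have "(\<Prod>i\<in>UNIV. c i (j i) (k i)) = (\<Prod>i\<in>UNIV. 2 / real (N i) * lobatto_weight (N i) (j i)) *
        ((\<Prod>i\<in>UNIV. lobatto_weight (N i) (k i)) * ((\<Prod>i\<in>UNIV. cos (real (j i) * lobatto_angle (N i) (k i))) *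
         (\<Prod>i\<in>UNIV. cos (real (j i) * cheb_angle lo hi x i))))" for k
      unfolding prod.distrib[symmetric] c_def by (intro prod.cong refl) (simp add: mult_ac)
    ultimately show ?thesis
      unfolding cheb_coeff_def cheb_basis_def cheb_angle_props(4)[OF box x]
      using x by (simp add: cheb_tensor_node sum_distrib_left sum_distrib_right mult_ac cong: sum.cong)
  qed
  then have "cheb_interp lo hi N v x = (\<Sum>j\<in>multi_indices N. \<Sum>k\<in>multi_indices N. v k * (\<Prod>i\<in>UNIV. c i (j i) (k i)))"
    unfolding cheb_interp_def by (intro sum.cong) auto
  also have "\<dots> = (\<Sum>k\<in>multi_indices N. v k * (\<Sum>j\<in>multi_indices N. \<Prod>i\<in>UNIV. c i (j i) (k i)))"
    by (subst sum.swap) (simp add: sum_distrib_left)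
  also have "\<dots> = (\<Sum>k\<in>multi_indices N. v k * tensor_cardinal lo hi N k x)"
  proof (rule sum.cong[OF refl])
    fix k
    have "(\<Sum>j\<in>multi_indices N. \<Prod>i\<in>UNIV. c i (j i) (k i)) = tensor_cardinal lo hi N k x"
      unfolding sum_multi_indices_prod[of "\<lambda>i j. c i j (k i)"] tensor_cardinal_def
      by (simp add: c_def lobatto_cardinal_def sum_distrib_left mult_ac)
    then show "v k * (\<Sum>j\<in>multi_indices N. \<Prod>i\<in>UNIV. c i (j i) (k i)) = v k * tensor_cardinal lo hi N k x" by simp
  qed
  finally show ?thesis .
qed

section \<open>Cardinal functions as Lagrange polynomials\<close>

lemma cos_multiple_poly: "\<exists>p::real poly. degree p \<le> j \<and> (\<forall>\<theta>. poly p (cos \<theta>) = cos (real j * \<theta>))"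
proof (induction j rule: less_induct)
  case (less j)
  consider "j = 0" | "j = 1" | m where "j = Suc (Suc m)" by (metis One_nat_def not0_implies_Suc)
  then show ?case
  proof cases
    case 1
    then show ?thesis by (intro exI[of _ 1]) auto
  next
    case 2
    then show ?thesis by (intro exI[of _ "[:0, 1:]"]) auto
  next
    case 3
    obtain p where p: "degree p \<le> Suc m" "\<And>\<theta>. poly p (cos \<theta>) = cos (real (Suc m) * \<theta>)" using less[of "Suc m"] 3 by auto
    obtain r where r: "degree r \<le> m" "\<And>\<theta>. poly r (cos \<theta>) = cos (real m * \<theta>)" using less[of m] 3 by auto
    have "degree (smult 2 (pCons 0 p) - r) \<le> j"
      using p r 3 by (intro degree_diff_le order_trans[OF degree_smult_le] order_trans[OF degree_pCons_le]) auto
    moreover have "poly (smult 2 (pCons 0 p) - r) (cos \<theta>) = cos (real j * \<theta>)" for \<theta>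
    proof -
      have e: "real j * \<theta> = real (Suc m) * \<theta> + \<theta>" "real m * \<theta> = real (Suc m) * \<theta> - \<theta>"
        unfolding 3 by (simp_all add: algebra_simps)
      show ?thesis by (simp add: p(2) r(2) del: of_nat_Suc) (simp add: e cos_add cos_diff del: of_nat_Suc)
    qed
    ultimately show ?thesis by blast
  qed
qed

text \<open>Both sides are polynomials of degree at most N in cos \<theta> that agree at N+1
  distinct points, because cosine is injective on the node angles. The identification links the
  definition of \<open>lebesgue_const\<close> to the kernel estimates.\<close>

lemma lobatto_cardinal_eq_lagrange:
  assumes N: "0 < N" and k: "k \<le> N"
  shows "lobatto_cardinal N k \<theta> = (\<Prod>m\<in>{..N} - {k}. (cos \<theta> - cos (lobatto_angle N m)) /
      (cos (lobatto_angle N k) - cos (lobatto_angle N m)))"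
proof -
  define c where "c m = cos (lobatto_angle N m)" for m
  have inj: "inj_on c {..N}"
  proof (rule inj_onI)
    fix a b assume ab: "a \<in> {..N}" "b \<in> {..N}" "c a = c b"
    then have "lobatto_angle N a = lobatto_angle N b"
      using cos_inj_pi[of "lobatto_angle N a" "lobatto_angle N b"] lobatto_angle_range[of _ N]
      unfolding c_def by simp
    then show "a = b" unfolding lobatto_angle_def using N by simp
  qed
  define T :: "nat \<Rightarrow> real poly"
    where "T j = (SOME p. degree p \<le> j \<and> (\<forall>\<theta>. poly p (cos \<theta>) = cos (real j * \<theta>)))" for j
  have T: "degree (T j) \<le> j" "poly (T j) (cos \<theta>) = cos (real j * \<theta>)" for j \<theta>
    using someI_ex[OF cos_multiple_poly[of j]] unfolding T_def by blast+
  define P where "P = smult (lobatto_weight N k * (2 / real N))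
      (\<Sum>j\<le>N. smult (lobatto_weight N j * cos (real j * lobatto_angle N k)) (T j))"
  define L where "L = (\<Prod>m\<in>{..N} - {k}. smult (1 / (c k - c m)) [:- c m, 1:])"
  have P: "poly P (cos \<phi>) = lobatto_cardinal N k \<phi>" for \<phi>
    unfolding P_def lobatto_cardinal_def by (simp add: poly_sum T(2))
  have L: "poly L y = (\<Prod>m\<in>{..N} - {k}. (y - c m) / (c k - c m))" for y
    unfolding L_def by (simp add: poly_prod diff_divide_distrib)
  have dP: "degree P \<le> N"
  proof -
    have "degree (smult a (T j)) \<le> N" if "j \<le> N" for a j
      using degree_smult_le[of a "T j"] T(1)[of j] that by linarith
    then have "degree (\<Sum>j\<le>N. smult (lobatto_weight N j * cos (real j * lobatto_angle N k)) (T j)) \<le> N"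
      by (intro degree_sum_le) (simp_all only: atMost_iff finite_atMost)
    then show ?thesis unfolding P_def by (rule order_trans[OF degree_smult_le])
  qed
  have dL: "degree L \<le> N"
  proof -
    have "degree L \<le> (\<Sum>m\<in>{..N} - {k}. degree (smult (1 / (c k - c m)) [:- c m, 1:]))"
      unfolding L_def using degree_prod_sum_le[of "{..N} - {k}" "\<lambda>m. smult (1 / (c k - c m)) [:- c m, 1:]"] by (simp add: o_def)
    also have "\<dots> \<le> (\<Sum>m\<in>{..N} - {k}. 1)" by (intro sum_mono order_trans[OF degree_smult_le]) auto
    also have "\<dots> = N" using k by simp
    finally show ?thesis .
  qed
  have "P - L = 0"
  proof (rule ccontr)
    assume ne: "P - L \<noteq> 0"
    have "poly (P - L) (c m) = 0" if m: "m \<le> N" for m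
    proof (cases "m = k")
      case True
      have "poly L (c k) = 1" unfolding L using inj k
        by (intro prod.neutral) (auto dest: inj_onD)
      then show ?thesis using True P[of "lobatto_angle N k"] lobatto_cardinal_node[OF N k k] unfolding c_def by simp
    next
      case False
      then have "poly L (c m) = 0" unfolding L using m by (intro prod_zero) auto
      then show ?thesis using False P[of "lobatto_angle N m"] lobatto_cardinal_node[OF N k m] unfolding c_def by simp
    qed
    then have "c ` {..N} \<subseteq> {x. poly (P - L) x = 0}" by auto
    then have "card (c ` {..N}) \<le> card {x. poly (P - L) x = 0}" using ne by (intro card_mono poly_roots_finite)
    also have "\<dots> \<le> degree (P - L)" using ne by (rule card_poly_roots_bound)
    also have "\<dots> \<le> N" using dP dL by (intro degree_diff_le)
    finally show False using card_image[OF inj] by simp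
  qed
  then have "P = L" by simp
  then show ?thesis using P[of \<theta>] L[of "cos \<theta>"] unfolding c_def by simp
qed

lemma tensor_cardinal_eq_lagrange:
  assumes box: "\<And>i. lo $ i < hi $ i" and x: "x \<in> cbox lo hi" and N: "\<And>i. 0 < N i"
    and k: "k \<in> multi_indices N"
  shows "tensor_cardinal lo hi N k x = lagrange_poly lo hi N k x"
  unfolding tensor_cardinal_def lagrange_poly_def
proof (intro prod.cong refl)
  fix i
  define \<theta> where "\<theta> = cheb_angle lo hi x i"
  have "k i \<le> N i" using k unfolding multi_indices_def by auto
  have xi: "x $ i = hi $ i + 1/2 * (lo $ i - hi $ i) * (1 - cos \<theta>)"
    by (subst cheb_angle_props(3)[OF box x]) (simp add: box_map_def \<theta>_def)
  have ni: "cheb_node lo hi N j $ i = hi $ i + 1/2 * (lo $ i - hi $ i) * (1 - cos (lobatto_angle (N i) (j i)))" for j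
    unfolding cheb_node_def box_map_def ref_node_def lobatto_angle_def by simp
  \<comment> \<open>The affine map of the box cancels in the quotient, since lo < hi makes its slope
    nonzero.\<close>
  have quot: "(hi $ i + 1/2 * (lo $ i - hi $ i) * (1 - a) - (hi $ i + 1/2 * (lo $ i - hi $ i) * (1 - b))) /
      (hi $ i + 1/2 * (lo $ i - hi $ i) * (1 - c) - (hi $ i + 1/2 * (lo $ i - hi $ i) * (1 - b))) = (a - b) / (c - b)" for a b c
  proof -
    define h where "h = 1/2 * (lo $ i - hi $ i)"
    have "h \<noteq> 0" unfolding h_def using box[of i] by simp
    have "(hi $ i + h * (1 - a) - (hi $ i + h * (1 - b))) / (hi $ i + h * (1 - c) - (hi $ i + h * (1 - b)))
        = (- h * (a - b)) / (- h * (c - b))" by (simp add: algebra_simps)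
    also have "\<dots> = (a - b) / (c - b)" using \<open>h \<noteq> 0\<close> by (subst mult_divide_mult_cancel_left) auto
    finally show ?thesis unfolding h_def .
  qed
  show "lobatto_cardinal (N i) (k i) (cheb_angle lo hi x i) = (\<Prod>m\<in>{..N i} - {k i}.
      (x $ i - cheb_node lo hi N (\<lambda>_. m) $ i) / (cheb_node lo hi N k $ i - cheb_node lo hi N (\<lambda>_. m) $ i))"
    unfolding lobatto_cardinal_eq_lagrange[OF N \<open>k i \<le> N i\<close>] \<theta>_def[symmetric] xi ni quot ..
qed

lemma sum_abs_tensor_cardinal_le:
  assumes box: "\<And>i. lo $ i < hi $ i" and x: "x \<in> cbox lo hi" and N: "\<And>i. 0 < N i"
  shows "(\<Sum>k\<in>multi_indices N. \<bar>tensor_cardinal lo hi N k x\<bar>) \<le> (\<Prod>i\<in>UNIV. cot_mean (N i))"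
  unfolding tensor_cardinal_def abs_prod sum_multi_indices_prod[of "\<lambda>i m. \<bar>lobatto_cardinal (N i) m (cheb_angle lo hi x i)\<bar>"]
  using N cheb_angle_props(1)[OF box x] by (intro prod_mono conjI sum_abs_cardinal_le sum_nonneg) auto

text \<open>The cotangent product does double duty: it bounds the supremum and also shows that the
  set is bounded above, without which a real supremum would not dominate its members.\<close>

lemma lebesgue_const_bounds:
  assumes box: "\<And>i. lo $ i < hi $ i" and N: "\<And>i. 0 < N i"
  shows "lebesgue_const lo hi N \<le> (\<Prod>i\<in>UNIV. cot_mean (N i))"
    and "x \<in> cbox lo hi \<Longrightarrow> (\<Sum>k\<in>multi_indices N. \<bar>tensor_cardinal lo hi N k x\<bar>) \<le> lebesgue_const lo hi N"
proof -
  have eq: "(\<Sum>k\<in>multi_indices N. \<bar>lagrange_poly lo hi N k x\<bar>) = (\<Sum>k\<in>multi_indices N. \<bar>tensor_cardinal lo hi N k x\<bar>)"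
    if "x \<in> cbox lo hi" for x
    using tensor_cardinal_eq_lagrange[OF box that N] by simp
  have "lo \<in> cbox lo hi" using box by (auto simp: mem_box_cart less_imp_le)
  then have ne: "cbox lo hi \<noteq> {}" by blast
  have le: "(\<Sum>k\<in>multi_indices N. \<bar>lagrange_poly lo hi N k x\<bar>) \<le> (\<Prod>i\<in>UNIV. cot_mean (N i))"
    if "x \<in> cbox lo hi" for x
    unfolding eq[OF that] by (rule sum_abs_tensor_cardinal_le[OF box that N])
  show "lebesgue_const lo hi N \<le> (\<Prod>i\<in>UNIV. cot_mean (N i))"
    unfolding lebesgue_const_def by (rule cSUP_least[OF ne le])
  assume x: "x \<in> cbox lo hi"
  show "(\<Sum>k\<in>multi_indices N. \<bar>tensor_cardinal lo hi N k x\<bar>) \<le> lebesgue_const lo hi N"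
    unfolding lebesgue_const_def eq[OF x, symmetric]
    by (rule cSUP_upper[OF x]) (use le in \<open>auto intro!: bdd_aboveI2\<close>)
qed

section \<open>From power series in several variables to the error bound\<close>

lemma holomorphic_on_coordinate_line:
  fixes p :: "complex^'d"
  assumes F: "\<And>z. z \<in> ball p r \<Longrightarrow> ((\<lambda>k. a k * (\<Prod>j\<in>UNIV. (z $ j - p $ j) ^ k j)) has_sum F z) UNIV"
  shows "(\<lambda>\<zeta>. F (\<chi> j. if j = i then \<zeta> else p $ j)) holomorphic_on ball (p $ i) r"
proof -
  define \<iota> where "\<iota> m = (\<lambda>j. if j = i then m else 0)" for m :: nat
  have inj: "inj \<iota>" unfolding \<iota>_def by (rule injI) (metis)
  have "(\<lambda>m. a (\<iota> m) * (\<zeta> - p $ i) ^ m) sums F (\<chi> j. if j = i then \<zeta> else p $ j)"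
    if \<zeta>: "\<zeta> \<in> ball (p $ i) r" for \<zeta>
  proof -
    define z :: "complex^'d" where "z = (\<chi> j. if j = i then \<zeta> else p $ j)"
    define g where "g k = a k * (\<Prod>j\<in>UNIV. (z $ j - p $ j) ^ k j)" for k
    have "p - z = axis i (p $ i - \<zeta>)" unfolding z_def axis_def vec_eq_iff by simp
    then have "dist p z = dist (p $ i) \<zeta>"
      unfolding dist_norm norm_vec_def L2_set_def axis_def by (simp add: if_distrib[of norm] if_distrib[of "\<lambda>x. x\<^sup>2"] cong: if_cong)
    then have "(g has_sum F z) UNIV" using F[of z] \<zeta> unfolding g_def by simp
    \<comment> \<open>On the line every other coordinate equals the centre, so each monomial with a
      positive exponent off i vanishes and only the pure powers in coordinate i survive.\<close>
    moreover have "g k = 0" if "k \<notin> range \<iota>" for k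
    proof -
      have "\<exists>j. j \<noteq> i \<and> k j \<noteq> 0"
      proof (rule ccontr)
        assume "\<not> ?thesis"
        then have "k = \<iota> (k i)" unfolding \<iota>_def fun_eq_iff by auto
        with that show False by blast
      qed
      then obtain j where "j \<noteq> i" "k j \<noteq> 0" by blast
      then have "(z $ j - p $ j) ^ k j = 0" unfolding z_def by simp
      then have "(\<Prod>j\<in>UNIV. (z $ j - p $ j) ^ k j) = 0" by (intro prod_zero) auto
      then show ?thesis unfolding g_def by simp
    qed
    ultimately have "(g has_sum F z) (range \<iota>)"
      by (subst has_sum_cong_neutral[of UNIV "range \<iota>" g g]) auto
    then have "(g \<circ> \<iota>) sums F z" unfolding has_sum_reindex[OF inj] by (rule has_sum_imp_sums)
    moreover have "g \<circ> \<iota> = (\<lambda>m. a (\<iota> m) * (\<zeta> - p $ i) ^ m)"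
    proof
      fix m
      have "(\<Prod>j\<in>UNIV. (z $ j - p $ j) ^ \<iota> m j) = (\<Prod>j\<in>UNIV. if j = i then (\<zeta> - p $ i) ^ m else 1)"
        unfolding \<iota>_def z_def by (intro prod.cong) auto
      then show "(g \<circ> \<iota>) m = a (\<iota> m) * (\<zeta> - p $ i) ^ m" unfolding g_def by simp
    qed
    ultimately show ?thesis unfolding z_def by (simp only:)
  qed
  then show ?thesis by (rule power_series_holomorphic)
qed

definition complex_box_map :: "real^'d \<Rightarrow> real^'d \<Rightarrow> ('d \<Rightarrow> complex) \<Rightarrow> complex^'d" where
  "complex_box_map lo hi w = (\<chi> i. of_real (hi $ i) + 1/2 * of_real (lo $ i - hi $ i) * (1 - w i))"

lemma complex_box_map_real:
  "complex_box_map lo hi (\<lambda>i. of_real (y i)) = (\<chi> i. of_real (box_map lo hi (\<chi> i. y i) $ i))"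
  unfolding complex_box_map_def box_map_def by (simp add: vec_eq_iff)

text \<open>Differentiability is checked at one point at a time: the local power series at the image
  point is restricted to a coordinate line and composed with the affine map A.\<close>

lemma multi_analytic_separately_bounded:
  assumes F: "multi_analytic_on F (bernstein_box lo hi \<rho>)"
    and B: "\<And>z. z \<in> bernstein_box lo hi \<rho> \<Longrightarrow> cmod (F z) \<le> B"
  shows "separately_bounded_holomorphic (\<lambda>i. \<rho> $ i) B (\<lambda>w. F (complex_box_map lo hi w))"
  unfolding separately_bounded_holomorphic_def
proof (intro allI impI conjI)
  fix w assume w: "\<forall>i. w i \<in> bernstein_ellipse (\<rho> $ i)"
  have mem: "complex_box_map lo hi w' \<in> bernstein_box lo hi \<rho>" if "\<forall>i. w' i \<in> bernstein_ellipse (\<rho> $ i)" for w'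
    unfolding complex_box_map_def bernstein_box_def using that by auto
  show "cmod (F (complex_box_map lo hi w)) \<le> B" by (rule B[OF mem[OF w]])
  fix i
  show "(\<lambda>z. F (complex_box_map lo hi (w(i := z)))) holomorphic_on bernstein_ellipse (\<rho> $ i)"
    unfolding holomorphic_on_def
  proof
    fix z0 assume z0: "z0 \<in> bernstein_ellipse (\<rho> $ i)"
    define p where "p = complex_box_map lo hi (w(i := z0))"
    have "p \<in> bernstein_box lo hi \<rho>" unfolding p_def using w z0 by (intro mem) auto
    then have "\<exists>r>0. \<exists>a. \<forall>z\<in>ball p r. ((\<lambda>k. a k * (\<Prod>j\<in>UNIV. (z $ j - p $ j) ^ k j)) has_sum F z) UNIV"
      using F unfolding multi_analytic_on_def by blast
    then obtain r a where r: "0 < r"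
      and a: "\<And>z. z \<in> ball p r \<Longrightarrow> ((\<lambda>k. a k * (\<Prod>j\<in>UNIV. (z $ j - p $ j) ^ k j)) has_sum F z) UNIV"
      by blast
    define A where "A z = complex_of_real (hi $ i) + 1/2 * of_real (lo $ i - hi $ i) * (1 - z)" for z
    have "(\<lambda>\<zeta>. F (\<chi> j. if j = i then \<zeta> else p $ j)) field_differentiable at (A z0)"
    proof -
      have "A z0 = p $ i" unfolding A_def p_def complex_box_map_def by simp
      then show ?thesis
        using holomorphic_on_imp_differentiable_at[OF holomorphic_on_coordinate_line[OF a, where i = i] open_ball] r
        by simp
    qed
    moreover have "A field_differentiable at z0" unfolding A_def by (intro derivative_intros) auto
    ultimately have "((\<lambda>\<zeta>. F (\<chi> j. if j = i then \<zeta> else p $ j)) \<circ> A) field_differentiable at z0"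
      by (intro field_differentiable_compose)
    moreover have "((\<lambda>\<zeta>. F (\<chi> j. if j = i then \<zeta> else p $ j)) \<circ> A) = (\<lambda>z. F (complex_box_map lo hi (w(i := z))))"
    proof
      fix z
      have "(\<chi> j. if j = i then A z else p $ j) = complex_box_map lo hi (w(i := z))"
        unfolding A_def p_def complex_box_map_def vec_eq_iff by simp
      then show "((\<lambda>\<zeta>. F (\<chi> j. if j = i then \<zeta> else p $ j)) \<circ> A) z = F (complex_box_map lo hi (w(i := z)))" by simp
    qed
    ultimately show "(\<lambda>z. F (complex_box_map lo hi (w(i := z)))) field_differentiable at z0 within bernstein_ellipse (\<rho> $ i)"
      by (simp add: field_differentiable_at_within)
  qed
qed

lemma sqrt_prod: "sqrt (prod f A) = (\<Prod>x\<in>A. sqrt (f x))"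
  by (induction A rule: infinite_finite_induct) (auto simp: real_sqrt_mult)

text \<open>The power \<open>2 powr (D/2)\<close> is distributed as one factor sqrt 2 per
  coordinate; this brings the bound into the shape produced by the coordinate recursion.\<close>

lemma eps_int_eq:
  assumes \<rho>: "\<And>i. 1 < \<rho> $ i"
  shows "eps_int \<rho> N B = B * (2 * ((\<Prod>i\<in>UNIV. sqrt (2 / (1 - 1 / (\<rho> $ i)\<^sup>2))) * sqrt (\<Sum>i\<in>UNIV. (1 / (\<rho> $ i)\<^sup>2) ^ N i)))"
proof -
  have \<rho>0: "0 < \<rho> $ i" for i using \<rho>[of i] by simp
  have p2: "(\<rho> $ i) powr (- 2) = 1 / (\<rho> $ i)\<^sup>2" for i
    using \<rho>0[of i] by (simp add: powr_minus divide_inverse powr_numeral)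
  have pN: "(\<rho> $ i) powr (- 2 * real (N i)) = (1 / (\<rho> $ i)\<^sup>2) ^ N i" for i
  proof -
    have "(\<rho> $ i) powr (- 2 * real (N i)) = ((\<rho> $ i) powr (- 2)) powr real (N i)" by (simp add: powr_powr)
    also have "\<dots> = ((\<rho> $ i) powr (- 2)) ^ N i" using \<rho>0[of i] by (simp add: powr_realpow)
    finally show ?thesis unfolding p2 .
  qed
  define P where "P = (\<Prod>j\<in>UNIV. 1 / (1 - 1 / (\<rho> $ j)\<^sup>2))"
  have "2 powr (real CARD('a) / 2 + 1) = 2 * sqrt 2 ^ CARD('a)"
    by (simp add: powr_add powr_half_sqrt[symmetric] powr_powr mult.commute flip: powr_realpow)
  moreover have "sqrt (\<Sum>i\<in>UNIV. (1 / (\<rho> $ i)\<^sup>2) ^ N i * P) = sqrt (\<Sum>i\<in>UNIV. (1 / (\<rho> $ i)\<^sup>2) ^ N i) * sqrt P"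
    unfolding sum_distrib_right[symmetric] real_sqrt_mult ..
  moreover have "(\<Prod>i\<in>UNIV. sqrt (2 / (1 - 1 / (\<rho> $ i)\<^sup>2))) = sqrt 2 ^ CARD('a) * sqrt P"
  proof -
    have "sqrt P = (\<Prod>j\<in>UNIV. sqrt (1 / (1 - 1 / (\<rho> $ j)\<^sup>2)))" unfolding P_def by (rule sqrt_prod)
    moreover have "sqrt 2 ^ CARD('a) = (\<Prod>j\<in>(UNIV :: 'a set). sqrt 2)" by simp
    ultimately show ?thesis by (simp only: prod.distrib[symmetric] real_sqrt_mult[symmetric] times_divide_eq_right mult_1_right)
  qed
  ultimately show ?thesis unfolding eps_int_def p2 pN P_def[symmetric] by simp
qed

theorem cheb_interp_error:
  fixes lo hi \<rho> :: "real^'d"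
  assumes box: "\<And>i. lo $ i < hi $ i" and \<rho>: "\<And>i. 1 < \<rho> $ i" and N: "\<And>i. 0 < N i"
    and h: "bounded_analytic_extension lo hi \<rho> B h" and x: "x \<in> cbox lo hi"
  shows "\<bar>h x - cheb_interp lo hi N (\<lambda>k. h (cheb_node lo hi N k)) x\<bar> \<le> eps_int \<rho> N B"
proof -
  obtain F where F: "multi_analytic_on F (bernstein_box lo hi \<rho>)"
    and Fh: "\<And>x. x \<in> cbox lo hi \<Longrightarrow> F (\<chi> i. of_real (x $ i)) = of_real (h x)"
    and FB: "\<And>z. z \<in> bernstein_box lo hi \<rho> \<Longrightarrow> cmod (F z) \<le> B"
    using h unfolding bounded_analytic_extension_def by blast
  define G where "G w = F (complex_box_map lo hi w)" for w
  define \<theta> where "\<theta> = cheb_angle lo hi x"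
  have G: "separately_bounded_holomorphic (\<lambda>i. \<rho> $ i) B G"
    unfolding G_def by (rule multi_analytic_separately_bounded[OF F FB])
  have Greal: "G (\<lambda>i. of_real (y i)) = of_real (h (box_map lo hi (\<chi> i. y i)))"
    if "\<And>i. -1 \<le> y i" "\<And>i. y i \<le> 1" for y
  proof -
    have "box_map lo hi (\<chi> i. y i) \<in> cbox lo hi"
    proof -
      have "(\<chi> i. y i) \<in> cbox (-1) 1" using that by (simp add: mem_box_cart)
      then show ?thesis using box_map_image[OF box] by blast
    qed
    then show ?thesis unfolding G_def complex_box_map_real by (rule Fh)
  qed
  have "(\<lambda>_. of_real 0) \<in> Collect (\<lambda>w. \<forall>i. w i \<in> bernstein_ellipse (\<rho> $ i))"
    using \<rho> real_in_ellipse[of _ 0] by auto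
  then have B: "0 \<le> B" using G unfolding separately_bounded_holomorphic_def
    by (metis mem_Collect_eq norm_ge_zero order_trans)
  \<comment> \<open>Any enumeration of the coordinates will do: once all of them are interpolated,
    the fold is the full tensor sum, independent of order and of the starting point.\<close>
  obtain L where L: "set L = (UNIV :: 'd set)" "distinct L" using finite_distinct_list[of "UNIV :: 'd set"] by auto
  have "G (\<lambda>i. of_real (cos (\<theta> i))) = of_real (h x)"
    using Greal[of "\<lambda>i. cos (\<theta> i)"] cheb_angle_props(3)[OF box x] unfolding \<theta>_def by simp
  moreover have "foldr (coord_interp N \<theta>) L G w = of_real (cheb_interp lo hi N (\<lambda>k. h (cheb_node lo hi N k)) x)" for w
  proof -
    have "G (\<lambda>i. of_real (cos (lobatto_angle (N i) (k i)))) = of_real (h (cheb_node lo hi N k))" for k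
      unfolding cheb_node_def ref_node_def lobatto_angle_def[symmetric] by (rule Greal) auto
    then show ?thesis
      unfolding coord_interp_fold_eq[OF L(2)] cheb_interp_eq_cardinal[OF box x N] tensor_cardinal_def L(1) \<theta>_def
      by (simp add: multi_indices_def mult.commute)
  qed
  moreover have "cmod (G (\<lambda>i. of_real (cos (\<theta> i))) - foldr (coord_interp N \<theta>) L G (\<lambda>i. of_real (cos (\<theta> i))))
     \<le> B * (2 * (prod_list (map (\<lambda>i. sqrt (2 / (1 - 1 / (\<rho> $ i)\<^sup>2))) L) * sqrt (sum_list (map (\<lambda>i. (1 / (\<rho> $ i)\<^sup>2) ^ N i) L))))"
    by (rule fold_coord_interp(2)[OF G B \<rho> N]) (use cheb_angle_props(1)[OF box x] in \<open>simp add: \<theta>_def\<close>)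
  moreover have "prod_list (map f L) = prod f UNIV" "sum_list (map f L) = sum f UNIV" for f :: "'d \<Rightarrow> real"
    using L prod.distinct_set_conv_list[OF L(2), of f] sum.distinct_set_conv_list[OF L(2), of f] by auto
  ultimately show ?thesis unfolding eps_int_eq[OF \<rho>] by (simp flip: of_real_diff)
qed

section \<open>Generalized moments\<close>

lemma cheb_basis_box:
  assumes box: "\<And>i. lo $ i < hi $ i" and x: "x \<in> cbox lo hi"
  shows "cheb_basis lo hi j x = (\<Prod>i\<in>UNIV. cos (real (j i) * cheb_angle lo hi x i))"
  unfolding cheb_basis_def cheb_angle_props(4)[OF box x] using x by simp

lemma abs_cheb_basis_le_1:
  assumes box: "\<And>i. lo $ i < hi $ i"
  shows "\<bar>cheb_basis lo hi j x\<bar> \<le> 1"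
proof (cases "x \<in> cbox lo hi")
  case True
  show ?thesis unfolding cheb_basis_box[OF box True] abs_prod by (intro prod_le_1) auto
qed (simp add: cheb_basis_def)

lemma cheb_basis_outside: "x \<notin> cbox lo hi \<Longrightarrow> cheb_basis lo hi j x = 0"
  unfolding cheb_basis_def by simp

text \<open>The definition passes through \<open>inv_into\<close> and \<open>arccos\<close>;
  rewriting it as a polynomial in the coordinates times the indicator of the box makes measurability
  visible.\<close>

lemma cheb_basis_measurable [measurable]:
  fixes lo hi :: "real^'d"
  assumes box: "\<And>i. lo $ i < hi $ i"
  shows "cheb_basis lo hi j \<in> borel_measurable borel"
proof -
  define T :: "nat \<Rightarrow> real poly"
    where "T j = (SOME p. degree p \<le> j \<and> (\<forall>\<theta>. poly p (cos \<theta>) = cos (real j * \<theta>)))" for j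
  have T: "poly (T j) (cos \<theta>) = cos (real j * \<theta>)" for j \<theta>
    using someI_ex[OF cos_multiple_poly[of j]] unfolding T_def by blast
  have "cheb_basis lo hi j x = (\<Prod>i\<in>UNIV. poly (T (j i)) (1 - 2 * (hi $ i - x $ i) / (hi $ i - lo $ i))) * indicator (cbox lo hi) x" for x
  proof (cases "x \<in> cbox lo hi")
    case True
    have "1 - 2 * (hi $ i - x $ i) / (hi $ i - lo $ i) = cos (cheb_angle lo hi x i)" for i
      using box[of i] arg_cong[OF cheb_angle_props(3)[OF box True], of "\<lambda>v. v $ i"]
      by (simp add: box_map_def field_simps)
    then show ?thesis unfolding cheb_basis_box[OF box True] using True by (simp add: T)
  qed (simp add: cheb_basis_def)
  moreover have "(\<lambda>x::real^'d. (\<Prod>i\<in>UNIV. poly (T (j i)) (1 - 2 * (hi $ i - x $ i) / (hi $ i - lo $ i))) * indicator (cbox lo hi) x) \<in> borel_measurable borel"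
    by (intro borel_measurable_times borel_measurable_indicator borel_measurable_continuous_onI continuous_intros)
       (use box in \<open>auto simp: less_imp_neq[symmetric]\<close>)
  ultimately show ?thesis by presburger
qed

lemma cheb_node_in_box:
  assumes box: "\<And>i. lo $ i < hi $ i"
  shows "cheb_node lo hi N k \<in> cbox lo hi"
proof -
  have "ref_node N k \<in> cbox (-1) 1" unfolding ref_node_def by (simp add: mem_box_cart)
  then show ?thesis unfolding cheb_node_def using box_map_image[OF box] by blast
qed

lemma cheb_angle_node:
  assumes box: "\<And>i. lo $ i < hi $ i" and k: "k \<in> multi_indices N"
  shows "cheb_angle lo hi (cheb_node lo hi N k) i = lobatto_angle (N i) (k i)"
proof -
  define x where "x = cheb_node lo hi N k"
  have x: "x \<in> cbox lo hi" unfolding x_def by (rule cheb_node_in_box[OF box])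
  have "k i \<le> N i" using k unfolding multi_indices_def by auto
  have "x $ i = hi $ i + 1/2 * (lo $ i - hi $ i) * (1 - cos (cheb_angle lo hi x i))"
    by (subst cheb_angle_props(3)[OF box x]) (simp add: box_map_def)
  moreover have "x $ i = hi $ i + 1/2 * (lo $ i - hi $ i) * (1 - cos (lobatto_angle (N i) (k i)))"
    unfolding x_def cheb_node_def ref_node_def box_map_def lobatto_angle_def by simp
  ultimately have "(lo $ i - hi $ i) * (cos (cheb_angle lo hi x i) - cos (lobatto_angle (N i) (k i))) = 0"
    by (simp add: algebra_simps)
  then have "cos (cheb_angle lo hi x i) = cos (lobatto_angle (N i) (k i))" using box[of i] by simp
  then show ?thesis
    using cos_inj_pi cheb_angle_props(1,2)[OF box x] lobatto_angle_range[OF \<open>k i \<le> N i\<close>] unfolding x_def by blast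
qed

lemma cheb_basis_reproduced:
  assumes box: "\<And>i. lo $ i < hi $ i" and x: "x \<in> cbox lo hi" and N: "\<And>i. 0 < N i" and j: "j \<in> multi_indices N"
  shows "cheb_basis lo hi j x = (\<Sum>k\<in>multi_indices N. cheb_basis lo hi j (cheb_node lo hi N k) * tensor_cardinal lo hi N k x)"
proof -
  have jN: "j i \<le> N i" for i using j unfolding multi_indices_def by auto
  have "(\<Sum>k\<in>multi_indices N. cheb_basis lo hi j (cheb_node lo hi N k) * tensor_cardinal lo hi N k x)
     = (\<Sum>k\<in>multi_indices N. \<Prod>i\<in>UNIV. lobatto_cardinal (N i) (k i) (cheb_angle lo hi x i) * cos (real (j i) * lobatto_angle (N i) (k i)))"
    by (intro sum.cong refl)
       (simp add: cheb_basis_box[OF box cheb_node_in_box[OF box]] cheb_angle_node[OF box] tensor_cardinal_def prod.distrib)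
  also have "\<dots> = (\<Prod>i\<in>UNIV. \<Sum>m\<le>N i. lobatto_cardinal (N i) m (cheb_angle lo hi x i) * cos (real (j i) * lobatto_angle (N i) m))"
    by (rule sum_multi_indices_prod)
  also have "\<dots> = cheb_basis lo hi j x"
    unfolding cheb_basis_box[OF box x] by (intro prod.cong refl lobatto_interp_cos N jN)
  finally show ?thesis ..
qed

text \<open>Every basis function is reproduced from its nodal values, so a combination that vanishes
  at the nodes vanishes on the box, and outside it by definition. Linear independence of the basis
  is not asserted.\<close>

lemma cheb_space_zero:
  assumes box: "\<And>i. lo $ i < hi $ i" and N: "\<And>i. 0 < N i"
    and zero: "\<And>k. k \<in> multi_indices N \<Longrightarrow> (\<Sum>j\<in>multi_indices N. c j * cheb_basis lo hi j (cheb_node lo hi N k)) = 0"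
  shows "(\<lambda>x. \<Sum>j\<in>multi_indices N. c j * cheb_basis lo hi j x) = (\<lambda>x. 0)"
proof
  fix x
  show "(\<Sum>j\<in>multi_indices N. c j * cheb_basis lo hi j x) = 0"
  proof (cases "x \<in> cbox lo hi")
    case True
    have "(\<Sum>j\<in>multi_indices N. c j * cheb_basis lo hi j x)
      = (\<Sum>j\<in>multi_indices N. \<Sum>k\<in>multi_indices N. c j * cheb_basis lo hi j (cheb_node lo hi N k) * tensor_cardinal lo hi N k x)"
      by (intro sum.cong refl, subst cheb_basis_reproduced[OF box True N]) (auto simp: sum_distrib_left mult.assoc)
    also have "\<dots> = (\<Sum>k\<in>multi_indices N. (\<Sum>j\<in>multi_indices N. c j * cheb_basis lo hi j (cheb_node lo hi N k)) * tensor_cardinal lo hi N k x)"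
      by (subst sum.swap) (simp add: sum_distrib_right)
    also have "\<dots> = 0" using zero by simp
    finally show ?thesis .
  qed (simp add: cheb_basis_outside)
qed

lemma linear_functional_on_combination:
  assumes "linear_functional_on (cheb_space lo hi N) \<Phi>"
  shows "\<Phi> (\<lambda>x. \<Sum>j\<in>multi_indices N. c j * cheb_basis lo hi j x) = (\<Sum>j\<in>multi_indices N. c j * \<Phi> (cheb_basis lo hi j))"
proof -
  have lin: "\<Phi> (\<lambda>x. a * p x + b * q x) = a * \<Phi> p + b * \<Phi> q"
    if "p \<in> cheb_space lo hi N" "q \<in> cheb_space lo hi N" for p q a b
    using assms that unfolding linear_functional_on_def by blast
  \<comment> \<open>Partial sums lie in the space after padding with zero coefficients, which allows
    the two-term linearity to be iterated.\<close>
  have mem: "(\<lambda>x. \<Sum>j\<in>S. d j * cheb_basis lo hi j x) \<in> cheb_space lo hi N" if "S \<subseteq> multi_indices N" for S d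
  proof -
    have "(\<Sum>j\<in>S. d j * cheb_basis lo hi j x) = (\<Sum>j\<in>multi_indices N. (if j \<in> S then d j else 0) * cheb_basis lo hi j x)" for x
      by (rule sum.mono_neutral_cong_left) (use that in auto)
    then show ?thesis
      unfolding cheb_space_def by (intro CollectI exI[of _ "\<lambda>j. if j \<in> S then d j else 0"]) auto
  qed
  have one: "cheb_basis lo hi j \<in> cheb_space lo hi N" if "j \<in> multi_indices N" for j
    using mem[of "{j}" "\<lambda>_. 1"] that by simp
  have "\<Phi> (\<lambda>x. \<Sum>j\<in>S. c j * cheb_basis lo hi j x) = (\<Sum>j\<in>S. c j * \<Phi> (cheb_basis lo hi j))" if "S \<subseteq> multi_indices N" for S
    using finite_subset[OF that finite_multi_indices] that
  proof (induction S rule: finite_induct)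
    case empty
    have "(\<lambda>x. 0) \<in> cheb_space lo hi N" using mem[of "{}"] by simp
    then show ?case using lin[of "\<lambda>x. 0" "\<lambda>x. 0" 0 0] by simp
  next
    case (insert j S)
    have "\<Phi> (\<lambda>x. c j * cheb_basis lo hi j x + 1 * (\<Sum>j\<in>S. c j * cheb_basis lo hi j x))
        = c j * \<Phi> (cheb_basis lo hi j) + 1 * \<Phi> (\<lambda>x. \<Sum>j\<in>S. c j * cheb_basis lo hi j x)"
      using insert by (intro lin one mem) auto
    then show ?case using insert by simp
  qed
  then show ?thesis by blast
qed

lemma bernstein_ellipse_mono:
  assumes "1 < r" "r \<le> s"
  shows "bernstein_ellipse r \<subseteq> bernstein_ellipse s"
proof -
  have "r + 1 / r \<le> s + 1 / s"
    using ellipse_axis_mono[of r s] assms by (cases "r = s") simp_all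
  then show ?thesis unfolding bernstein_ellipse_def by auto
qed

lemma bounded_analytic_extension_mono:
  assumes h: "bounded_analytic_extension lo hi \<rho> B h" and \<rho>': "\<And>i. 1 < \<rho>' $ i" "\<And>i. \<rho>' $ i \<le> \<rho> $ i" and B: "B \<le> B'"
  shows "bounded_analytic_extension lo hi \<rho>' B' h"
proof -
  have "bernstein_box lo hi \<rho>' \<subseteq> bernstein_box lo hi \<rho>"
    unfolding bernstein_box_def using bernstein_ellipse_mono[OF \<rho>'] by blast
  moreover obtain F where F: "multi_analytic_on F (bernstein_box lo hi \<rho>)"
    "\<forall>x\<in>cbox lo hi. F (\<chi> i. of_real (x $ i)) = of_real (h x)" "\<forall>z\<in>bernstein_box lo hi \<rho>. cmod (F z) \<le> B"
    using h unfolding bounded_analytic_extension_def by blast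
  ultimately have "multi_analytic_on F (bernstein_box lo hi \<rho>')" "\<forall>z\<in>bernstein_box lo hi \<rho>'. cmod (F z) \<le> B'"
    using B unfolding multi_analytic_on_def by (blast, force)
  with F(2) show ?thesis unfolding bounded_analytic_extension_def by blast
qed

text \<open>The real box lies inside the Bernstein box. The resulting boundedness lets
  \<open>box_sup\<close> act as a genuine supremum for the value functions.\<close>

lemma bounded_analytic_extension_bound:
  assumes h: "bounded_analytic_extension lo hi \<rho> B h" and \<rho>: "\<And>i. 1 < \<rho> $ i"
    and box: "\<And>i. lo $ i < hi $ i" and x: "x \<in> cbox lo hi"
  shows "\<bar>h x\<bar> \<le> B"
proof -
  obtain F where Fh: "\<And>x. x \<in> cbox lo hi \<Longrightarrow> F (\<chi> i. of_real (x $ i)) = complex_of_real (h x)"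
    and FB: "\<And>z. z \<in> bernstein_box lo hi \<rho> \<Longrightarrow> cmod (F z) \<le> B"
    using h unfolding bounded_analytic_extension_def by blast
  have "complex_box_map lo hi (\<lambda>i. of_real (cos (cheb_angle lo hi x i))) \<in> bernstein_box lo hi \<rho>"
    unfolding complex_box_map_def bernstein_box_def using \<rho> by (auto simp: real_in_ellipse)
  then have "(\<chi> i. of_real (x $ i)) \<in> bernstein_box lo hi \<rho>"
    unfolding complex_box_map_real cheb_angle_props(3)[OF box x, symmetric] .
  from FB[OF this] show ?thesis unfolding Fh[OF x] by simp
qed

section \<open>Random polynomials and moment defects\<close>

lemma box_sup_mean_upper: "x \<in> cbox lo hi \<Longrightarrow> (\<integral>\<^sup>+w. ennreal \<bar>h w x\<bar> \<partial>Q) \<le> box_sup_mean Q lo hi h"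
  unfolding box_sup_mean_def by (rule SUP_upper)

text \<open>Random polynomials are handled through their coefficients, so that measurability jointly
  in the sample and the space variable is immediate.\<close>

definition random_combination where
  "random_combination lo hi N c w x = (\<Sum>j\<in>multi_indices N. c j w * cheb_basis lo hi j x)"

lemma cheb_basis_in_space:
  assumes "j \<in> multi_indices N" shows "cheb_basis lo hi j \<in> cheb_space lo hi N"
proof -
  have "cheb_basis lo hi j x = (\<Sum>i\<in>multi_indices N. (if i = j then 1 else 0) * cheb_basis lo hi i x)" for x
    using assms by (simp add: if_distrib[of "\<lambda>a. a * _"] cong: if_cong)
  then show ?thesis
    unfolding cheb_space_def by (intro CollectI exI[of _ "\<lambda>i. if i = j then 1 else 0"]) auto
qed

text \<open>Expansion in the basis separates the random coefficients from the defects of the basis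
  functions; both measurability and homogeneity of the defect are read off from this form.\<close>

lemma moment_defect_eq:
  fixes lo hi :: "real^'d"
  assumes lin: "linear_functional_on (cheb_space lo hi N) \<Phi>"
    and int: "\<And>j. integrable (K (t u) (t (Suc u)) (cheb_node lo hi N k)) (cheb_basis lo hi j)"
  shows "gen_moment K t lo hi N u k (random_combination lo hi N c w) - \<Phi> (random_combination lo hi N c w)
     = (\<Sum>j\<in>multi_indices N. c j w * (gen_moment K t lo hi N u k (cheb_basis lo hi j) - \<Phi> (cheb_basis lo hi j)))"
proof -
  have "gen_moment K t lo hi N u k (random_combination lo hi N c w)
      = (\<Sum>j\<in>multi_indices N. c j w * gen_moment K t lo hi N u k (cheb_basis lo hi j))"
    unfolding gen_moment_def random_combination_def using int by (subst Bochner_Integration.integral_sum) auto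
  moreover have "\<Phi> (random_combination lo hi N c w) = (\<Sum>j\<in>multi_indices N. c j w * \<Phi> (cheb_basis lo hi j))"
    using linear_functional_on_combination[OF lin, of "\<lambda>j. c j w"] unfolding random_combination_def by simp
  ultimately show ?thesis by (simp add: sum_subtractf right_diff_distrib)
qed

lemma moment_defect_measurable:
  fixes lo hi :: "real^'d"
  assumes gm: "GM_star Q K n t lo hi N \<Gamma>h \<delta>" and u: "u < n" and k: "k \<in> multi_indices N"
    and int: "\<And>j. integrable (K (t u) (t (Suc u)) (cheb_node lo hi N k)) (cheb_basis lo hi j)"
    and c: "\<And>j. j \<in> multi_indices N \<Longrightarrow> c j \<in> borel_measurable Q"
  shows "(\<lambda>w. gen_moment K t lo hi N u k (random_combination lo hi N c w) - \<Gamma>h u k w (random_combination lo hi N c w)) \<in> borel_measurable Q"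
proof -
  have lin: "linear_functional_on (cheb_space lo hi N) (\<Gamma>h u k w)" if "w \<in> space Q" for w
    using gm u k that unfolding GM_star_def by blast
  have "(\<lambda>w. \<Gamma>h u k w (cheb_basis lo hi j)) \<in> borel_measurable Q" if "j \<in> multi_indices N" for j
    using gm u k cheb_basis_in_space[OF that, of lo hi] unfolding GM_star_def by blast
  then have "(\<lambda>w. \<Sum>j\<in>multi_indices N. c j w * (gen_moment K t lo hi N u k (cheb_basis lo hi j) - \<Gamma>h u k w (cheb_basis lo hi j)))
      \<in> borel_measurable Q"
    using c by (intro borel_measurable_sum borel_measurable_times borel_measurable_diff) auto
  then show ?thesis
  proof (rule measurable_cong[THEN iffD2, rotated])
    fix w assume w: "w \<in> space Q"
    show "gen_moment K t lo hi N u k (random_combination lo hi N c w) - \<Gamma>h u k w (random_combination lo hi N c w)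
        = (\<Sum>j\<in>multi_indices N. c j w * (gen_moment K t lo hi N u k (cheb_basis lo hi j) - \<Gamma>h u k w (cheb_basis lo hi j)))"
      by (rule moment_defect_eq[where K = K and t = t and u = u and k = k, OF lin[OF w] int])
  qed
qed

text \<open>Homogeneity extends the stochastic moment bound from the unit sphere to all random polynomials
  of finite norm; a polynomial of norm zero vanishes almost surely at all nodes, hence identically.\<close>

lemma GM_star_scaled:
  fixes lo hi :: "real^'d"
  assumes gm: "GM_star Q K n t lo hi N \<Gamma>h \<delta>" and box: "\<And>i. lo $ i < hi $ i" and N: "\<And>i. 0 < N i"
    and u: "u < n" and k: "k \<in> multi_indices N"
    and int: "\<And>j. integrable (K (t u) (t (Suc u)) (cheb_node lo hi N k)) (cheb_basis lo hi j)"
    and c: "\<And>j. j \<in> multi_indices N \<Longrightarrow> c j \<in> borel_measurable Q"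
    and fin: "box_sup_mean Q lo hi (random_combination lo hi N c) < \<infinity>"
  shows "(\<integral>\<^sup>+w. ennreal \<bar>gen_moment K t lo hi N u k (random_combination lo hi N c w) - \<Gamma>h u k w (random_combination lo hi N c w)\<bar> \<partial>Q)
     \<le> ennreal \<delta> * box_sup_mean Q lo hi (random_combination lo hi N c)"
proof -
  define p where "p = random_combination lo hi N c"
  define s where "s = enn2real (box_sup_mean Q lo hi p)"
  have s: "box_sup_mean Q lo hi p = ennreal s" "0 \<le> s" unfolding s_def using fin unfolding p_def by auto
  have lin: "linear_functional_on (cheb_space lo hi N) (\<Gamma>h u k w)" if "w \<in> space Q" for w
    using gm u k that unfolding GM_star_def by blast
  define E where "E p w = gen_moment K t lo hi N u k (p w) - \<Gamma>h u k w (p w)" for p w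
  have Em: "E p \<in> borel_measurable Q" unfolding E_def p_def by (rule moment_defect_measurable[OF gm u k int c])
  have pm: "(\<lambda>w. p w x) \<in> borel_measurable Q" for x
    unfolding p_def random_combination_def using c by (intro borel_measurable_sum borel_measurable_times) auto
  have "(\<integral>\<^sup>+w. ennreal \<bar>E p w\<bar> \<partial>Q) \<le> ennreal \<delta> * ennreal s"
  proof (cases "s = 0")
    case True
    have "AE w in Q. p w (cheb_node lo hi N k) = 0" for k
    proof -
      have "(\<integral>\<^sup>+w. ennreal \<bar>p w (cheb_node lo hi N k)\<bar> \<partial>Q) = 0"
        using box_sup_mean_upper[OF cheb_node_in_box[OF box], of Q p N k] unfolding s(1) True by simp
      then show ?thesis using pm by (subst (asm) nn_integral_0_iff_AE) (auto simp: ennreal_eq_0_iff)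
    qed
    then have "AE w in Q. \<forall>k\<in>multi_indices N. p w (cheb_node lo hi N k) = 0"
      by (intro AE_finite_allI finite_multi_indices)
    then have "AE w in Q. ennreal \<bar>E p w\<bar> = 0"
    proof (rule AE_mp, intro AE_I2 impI)
      fix w assume w: "w \<in> space Q" and z: "\<forall>k\<in>multi_indices N. p w (cheb_node lo hi N k) = 0"
      have "p w = (\<lambda>x. 0)"
        using cheb_space_zero[OF box N, where c = "\<lambda>j. c j w"] z unfolding p_def random_combination_def by simp
      \<comment> \<open>The given coefficients need not vanish, but the same function also has the
        representation with zero coefficients, for which the defect is plainly zero.\<close>
      then have p0: "p w = random_combination lo hi N (\<lambda>_ _. 0) w" unfolding random_combination_def by simp
      show "ennreal \<bar>E p w\<bar> = 0" unfolding E_def p0 moment_defect_eq[where K = K and t = t and u = u and k = k, OF lin[OF w] int] by simp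
    qed
    then have "(\<integral>\<^sup>+w. ennreal \<bar>E p w\<bar> \<partial>Q) = (\<integral>\<^sup>+w. 0 \<partial>Q)" by (rule nn_integral_cong_AE)
    then show ?thesis by simp
  next
    case False
    define p' where "p' = random_combination lo hi N (\<lambda>j w. c j w / s)"
    have p': "p' w x = p w x / s" for w x
      unfolding p'_def p_def random_combination_def by (simp add: sum_divide_distrib)
    have sinv: "ennreal (1 / s) * ennreal s = 1" using False s(2) by (simp flip: ennreal_mult)
    have scale: "ennreal \<bar>a / s\<bar> = ennreal (1 / s) * ennreal \<bar>a\<bar>" for a
      using False s(2) by (simp flip: ennreal_mult)
    have "box_sup_mean Q lo hi p' = 1"
      unfolding box_sup_mean_def p' scale using pm
      by (subst nn_integral_cmult) (auto simp: SUP_mult_left_ennreal[symmetric] box_sup_mean_def[symmetric] s(1) sinv)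
    moreover have "p' \<in> random_cheb_space Q lo hi N"
      unfolding p'_def random_combination_def[abs_def] random_cheb_space_def using c
      by (intro CollectI exI[of _ "\<lambda>j w. c j w / s"]) auto
    ultimately have "(\<integral>\<^sup>+w. ennreal \<bar>E p' w\<bar> \<partial>Q) \<le> ennreal \<delta>"
      using gm u k unfolding GM_star_def E_def by blast
    also have "(\<integral>\<^sup>+w. ennreal \<bar>E p' w\<bar> \<partial>Q) = (\<integral>\<^sup>+w. ennreal (1 / s) * ennreal \<bar>E p w\<bar> \<partial>Q)"
    proof (rule nn_integral_cong)
      fix w assume w: "w \<in> space Q"
      have "E p' w = E p w / s"
        unfolding E_def p'_def p_def moment_defect_eq[where K = K and t = t and u = u and k = k, OF lin[OF w] int] by (simp add: sum_divide_distrib)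
      then show "ennreal \<bar>E p' w\<bar> = ennreal (1 / s) * ennreal \<bar>E p w\<bar>" using scale by simp
    qed
    also have "\<dots> = ennreal (1 / s) * (\<integral>\<^sup>+w. ennreal \<bar>E p w\<bar> \<partial>Q)"
      using Em by (intro nn_integral_cmult) auto
    finally have "ennreal s * (ennreal (1 / s) * (\<integral>\<^sup>+w. ennreal \<bar>E p w\<bar> \<partial>Q)) \<le> ennreal s * ennreal \<delta>"
      by (rule mult_left_mono) simp
    then show ?thesis using sinv by (simp add: mult.assoc[symmetric] mult.commute)
  qed
  then show ?thesis unfolding E_def p_def[symmetric] s(1) .
qed

text \<open>The difference splits into the integral of V' - p over the box, the integral of V'
  outside it, and the defect of the approximate operator on p; the split is exact because p vanishes
  off the box. The norm of p in the last part is at most \<open>Vb + e\<close>. For infinite e the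
  right side is infinite.\<close>

lemma moment_error_bound:
  fixes lo hi :: "real^'d" and V' :: "real^'d \<Rightarrow> real"
  assumes gm: "GM_star Q K n t lo hi N \<Gamma>h \<delta>" and box: "\<And>i. lo $ i < hi $ i" and N: "\<And>i. 0 < N i"
    and u: "u < n" and k: "k \<in> multi_indices N"
  defines "\<kappa> \<equiv> K (t u) (t (Suc u)) (cheb_node lo hi N k)"
  assumes \<kappa>: "prob_space \<kappa>" "sets \<kappa> = sets borel" and V': "integrable \<kappa> V'"
    and trunc: "\<bar>\<integral>y. V' y * indicator (UNIV - cbox lo hi) y \<partial>\<kappa>\<bar> \<le> \<epsilon>tr"
    and Vb: "\<And>x. x \<in> cbox lo hi \<Longrightarrow> \<bar>V' x\<bar> \<le> Vb" and Vb0: "0 \<le> Vb"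
    and c: "\<And>j. j \<in> multi_indices N \<Longrightarrow> c j \<in> borel_measurable Q"
  defines "e \<equiv> box_sup_mean Q lo hi (\<lambda>w x. V' x - random_combination lo hi N c w x)"
  shows "(\<integral>\<^sup>+w. ennreal \<bar>(\<integral>y. V' y \<partial>\<kappa>) - \<Gamma>h u k w (random_combination lo hi N c w)\<bar> \<partial>Q)
     \<le> ennreal \<epsilon>tr + e + ennreal \<delta> * (ennreal Vb + e)"
proof (cases "e = \<infinity>")
  case False
  interpret \<kappa>: prob_space \<kappa> by (rule \<kappa>)
  interpret Q: prob_space Q using gm unfolding GM_star_def by blast
  define p where "p = random_combination lo hi N c"
  have bm: "cheb_basis lo hi j \<in> borel_measurable \<kappa>" for j
    using cheb_basis_measurable[OF box] \<kappa>(2) by (simp cong: measurable_cong_sets)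
  have int: "integrable \<kappa> (cheb_basis lo hi j)" for j
    by (rule \<kappa>.integrable_const_bound[of _ 1]) (use bm abs_cheb_basis_le_1[OF box] in auto)
  have intp: "integrable \<kappa> (p w)" for w
    unfolding p_def random_combination_def[abs_def] using int by (intro Bochner_Integration.integrable_sum) auto
  have pout: "p w y = p w y * indicator (cbox lo hi) y" for w y
    unfolding p_def random_combination_def by (auto simp: cheb_basis_outside indicator_def)
  have Vm: "V' \<in> borel_measurable \<kappa>" using V' by auto
  have cb: "cbox lo hi \<in> sets \<kappa>" "UNIV - cbox lo hi \<in> sets \<kappa>" using \<kappa>(2) by auto
  define h where "h w y = (V' y - p w y) * indicator (cbox lo hi) y" for w y
  define E where "E w = gen_moment K t lo hi N u k (p w) - \<Gamma>h u k w (p w)" for w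
  have Em: "E \<in> borel_measurable Q"
    unfolding E_def p_def by (rule moment_defect_measurable[OF gm u k int[unfolded \<kappa>_def] c])
  have hm: "(\<lambda>(w, y). h w y) \<in> borel_measurable (Q \<Otimes>\<^sub>M \<kappa>)"
  proof -
    have "(\<lambda>x. c j (fst x)) \<in> borel_measurable (Q \<Otimes>\<^sub>M \<kappa>)" if "j \<in> multi_indices N" for j
      using c[OF that] by measurable
    moreover have "(\<lambda>x. cheb_basis lo hi j (snd x)) \<in> borel_measurable (Q \<Otimes>\<^sub>M \<kappa>)" for j
      using bm by measurable
    moreover have "(\<lambda>x. V' (snd x)) \<in> borel_measurable (Q \<Otimes>\<^sub>M \<kappa>)" using Vm by measurable
    moreover have "(\<lambda>x. indicator (cbox lo hi) (snd x) :: real) \<in> borel_measurable (Q \<Otimes>\<^sub>M \<kappa>)"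
      using cb by measurable
    ultimately show ?thesis
      unfolding h_def p_def random_combination_def split_beta
      by (intro borel_measurable_times borel_measurable_diff borel_measurable_sum) auto
  qed
  have split: "\<bar>(\<integral>y. V' y \<partial>\<kappa>) - \<Gamma>h u k w (p w)\<bar> \<le> \<epsilon>tr + \<bar>\<integral>y. h w y \<partial>\<kappa>\<bar> + \<bar>E w\<bar>" for w
  proof -
    have i1: "integrable \<kappa> (\<lambda>y. V' y * indicator (cbox lo hi) y)" "integrable \<kappa> (\<lambda>y. V' y * indicator (UNIV - cbox lo hi) y)"
      using V' cb by (auto intro: integrable_real_mult_indicator)
    have "(\<integral>y. V' y \<partial>\<kappa>) = (\<integral>y. V' y * indicator (cbox lo hi) y + V' y * indicator (UNIV - cbox lo hi) y \<partial>\<kappa>)"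
      by (intro Bochner_Integration.integral_cong) (auto simp: indicator_def)
    also have "\<dots> = (\<integral>y. V' y * indicator (cbox lo hi) y \<partial>\<kappa>) + (\<integral>y. V' y * indicator (UNIV - cbox lo hi) y \<partial>\<kappa>)"
      by (rule Bochner_Integration.integral_add[OF i1])
    also have "(\<integral>y. V' y * indicator (cbox lo hi) y \<partial>\<kappa>) = (\<integral>y. h w y + p w y \<partial>\<kappa>)"
      by (intro Bochner_Integration.integral_cong refl, subst pout) (auto simp: h_def algebra_simps indicator_def)
    also have "\<dots> = (\<integral>y. h w y \<partial>\<kappa>) + (\<integral>y. p w y \<partial>\<kappa>)"
    proof (rule Bochner_Integration.integral_add[OF _ intp])
      have "integrable \<kappa> (\<lambda>y. V' y * indicator (cbox lo hi) y - p w y)" using i1 intp by simp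
      moreover have "h w = (\<lambda>y. V' y * indicator (cbox lo hi) y - p w y)"
      proof
        fix y show "h w y = V' y * indicator (cbox lo hi) y - p w y"
          unfolding h_def by (subst (2) pout) (simp add: algebra_simps)
      qed
      ultimately show "integrable \<kappa> (h w)" by (simp only:)
    qed
    finally have "(\<integral>y. V' y \<partial>\<kappa>) - \<Gamma>h u k w (p w)
       = (\<integral>y. h w y \<partial>\<kappa>) + (\<integral>y. V' y * indicator (UNIV - cbox lo hi) y \<partial>\<kappa>) + E w"
      unfolding E_def gen_moment_def \<kappa>_def by simp
    then show ?thesis using trunc by linarith
  qed
  have e_fin: "e < \<infinity>" using False by (simp add: less_top)
  have H: "(\<integral>\<^sup>+w. (\<integral>\<^sup>+y. ennreal \<bar>h w y\<bar> \<partial>\<kappa>) \<partial>Q) \<le> e"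
  proof -
    \<comment> \<open>Tonelli puts the expectation inside the transition integral. The error is thus
      needed only as a supremum over x of expectations, which is what e measures, and not as the
      expectation of a supremum.\<close>
    interpret pair_sigma_finite Q \<kappa> ..
    have "(\<integral>\<^sup>+w. (\<integral>\<^sup>+y. ennreal \<bar>h w y\<bar> \<partial>\<kappa>) \<partial>Q) = (\<integral>\<^sup>+y. (\<integral>\<^sup>+w. ennreal \<bar>h w y\<bar> \<partial>Q) \<partial>\<kappa>)"
      using Fubini'[of "\<lambda>w y. ennreal \<bar>h w y\<bar>"] hm by (simp add: split_beta)
    also have "\<dots> \<le> (\<integral>\<^sup>+y. e \<partial>\<kappa>)"
    proof (rule nn_integral_mono)
      fix y
      show "(\<integral>\<^sup>+w. ennreal \<bar>h w y\<bar> \<partial>Q) \<le> e"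
      proof (cases "y \<in> cbox lo hi")
        case True
        show ?thesis using box_sup_mean_upper[OF True, of Q "\<lambda>w x. V' x - p w x"] True unfolding h_def e_def p_def by simp
      qed (simp add: h_def)
    qed
    also have "\<dots> = e" using \<kappa>.emeasure_space_1 by simp
    finally show ?thesis .
  qed
  have pnorm: "box_sup_mean Q lo hi p \<le> ennreal Vb + e"
    unfolding box_sup_mean_def
  proof (rule SUP_least)
    fix x assume x: "x \<in> cbox lo hi"
    have "(\<integral>\<^sup>+w. ennreal \<bar>p w x\<bar> \<partial>Q) \<le> (\<integral>\<^sup>+w. ennreal Vb + ennreal \<bar>V' x - p w x\<bar> \<partial>Q)"
      using Vb[OF x] Vb0 by (intro nn_integral_mono) (auto simp flip: ennreal_plus intro!: ennreal_leI)
    also have "\<dots> = ennreal Vb + (\<integral>\<^sup>+w. ennreal \<bar>V' x - p w x\<bar> \<partial>Q)"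
    proof (subst nn_integral_add)
      show "(\<lambda>w. ennreal \<bar>V' x - p w x\<bar>) \<in> borel_measurable Q"
        unfolding p_def random_combination_def using c
        by (intro measurable_compose[OF _ measurable_ennreal] borel_measurable_abs borel_measurable_diff borel_measurable_sum borel_measurable_times) auto
    qed (auto simp: Q.emeasure_space_1)
    also have "\<dots> \<le> ennreal Vb + e"
      using box_sup_mean_upper[OF x, of Q "\<lambda>w x. V' x - p w x"] unfolding e_def p_def by (rule add_left_mono)
    finally show "(\<integral>\<^sup>+w. ennreal \<bar>p w x\<bar> \<partial>Q) \<le> ennreal Vb + e" .
  qed
  then have pfin: "box_sup_mean Q lo hi p < \<infinity>"
    using e_fin by (auto intro: le_less_trans simp: ennreal_add_less_top)
  have "(\<integral>\<^sup>+w. ennreal \<bar>E w\<bar> \<partial>Q) \<le> ennreal \<delta> * box_sup_mean Q lo hi p"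
    unfolding E_def p_def by (rule GM_star_scaled[OF gm box N u k int[unfolded \<kappa>_def] c pfin[unfolded p_def]])
  also have "\<dots> \<le> ennreal \<delta> * (ennreal Vb + e)" using pnorm by (rule mult_left_mono) simp
  finally have EQ: "(\<integral>\<^sup>+w. ennreal \<bar>E w\<bar> \<partial>Q) \<le> ennreal \<delta> * (ennreal Vb + e)" .
  have \<epsilon>0: "0 \<le> \<epsilon>tr" using trunc by linarith
  have Hm: "(\<lambda>w. \<integral>\<^sup>+y. ennreal \<bar>h w y\<bar> \<partial>\<kappa>) \<in> borel_measurable Q"
    using hm by (intro \<kappa>.borel_measurable_nn_integral) (simp add: split_beta)
  have "(\<integral>\<^sup>+w. ennreal \<bar>(\<integral>y. V' y \<partial>\<kappa>) - \<Gamma>h u k w (p w)\<bar> \<partial>Q)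
      \<le> (\<integral>\<^sup>+w. (ennreal \<epsilon>tr + (\<integral>\<^sup>+y. ennreal \<bar>h w y\<bar> \<partial>\<kappa>)) + ennreal \<bar>E w\<bar> \<partial>Q)"
  proof (rule nn_integral_mono)
    fix w
    \<comment> \<open>If \<open>h w\<close> were not integrable, its Bochner integral would be 0 and
      the bound would be trivial.\<close>
    have "ennreal \<bar>\<integral>y. h w y \<partial>\<kappa>\<bar> \<le> (\<integral>\<^sup>+y. ennreal \<bar>h w y\<bar> \<partial>\<kappa>)"
      using integral_norm_bound_ennreal[of \<kappa> "h w"] by (cases "integrable \<kappa> (h w)") (auto simp: not_integrable_integral_eq)
    moreover have "ennreal \<bar>(\<integral>y. V' y \<partial>\<kappa>) - \<Gamma>h u k w (p w)\<bar> \<le> ennreal \<epsilon>tr + ennreal \<bar>\<integral>y. h w y \<partial>\<kappa>\<bar> + ennreal \<bar>E w\<bar>"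
      using split[of w] \<epsilon>0 by (simp flip: ennreal_plus add: ennreal_leI)
    ultimately show "ennreal \<bar>(\<integral>y. V' y \<partial>\<kappa>) - \<Gamma>h u k w (p w)\<bar>
        \<le> (ennreal \<epsilon>tr + (\<integral>\<^sup>+y. ennreal \<bar>h w y\<bar> \<partial>\<kappa>)) + ennreal \<bar>E w\<bar>"
      by (meson add_left_mono add_right_mono order_trans)
  qed
  also have "\<dots> = ennreal \<epsilon>tr + (\<integral>\<^sup>+w. (\<integral>\<^sup>+y. ennreal \<bar>h w y\<bar> \<partial>\<kappa>) \<partial>Q) + (\<integral>\<^sup>+w. ennreal \<bar>E w\<bar> \<partial>Q)"
    using Hm Em by (subst nn_integral_add, simp_all, subst nn_integral_add, simp_all add: Q.emeasure_space_1)
  also have "\<dots> \<le> ennreal \<epsilon>tr + e + ennreal \<delta> * (ennreal Vb + e)"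
    by (intro add_mono order_refl H EQ)
  finally show ?thesis unfolding p_def .
qed simp

section \<open>Propagation of the error\<close>

text \<open>The sample enters twice, through the operator and through its argument, whereas
  \<open>GM_star\<close> grants measurability for fixed arguments only; linearity reduces the mixed
  case to the basis functions.\<close>

lemma cheb_space_eval_measurable:
  assumes gm: "GM_star Q K n t lo hi N \<Gamma>h \<delta>" and u: "u < n" and k: "k \<in> multi_indices N"
    and c: "\<And>j. j \<in> multi_indices N \<Longrightarrow> c j \<in> borel_measurable Q"
  shows "(\<lambda>w. \<Gamma>h u k w (random_combination lo hi N c w)) \<in> borel_measurable Q"
proof -
  have lin: "linear_functional_on (cheb_space lo hi N) (\<Gamma>h u k w)" if "w \<in> space Q" for w
    using gm u k that unfolding GM_star_def by blast
  have "(\<lambda>w. \<Gamma>h u k w (cheb_basis lo hi j)) \<in> borel_measurable Q" if "j \<in> multi_indices N" for j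
    using gm u k cheb_basis_in_space[OF that, of lo hi] unfolding GM_star_def by blast
  then have "(\<lambda>w. \<Sum>j\<in>multi_indices N. c j w * \<Gamma>h u k w (cheb_basis lo hi j)) \<in> borel_measurable Q"
    using c by (intro borel_measurable_sum borel_measurable_times) auto
  then show ?thesis
  proof (rule measurable_cong[THEN iffD2, rotated])
    fix w assume w: "w \<in> space Q"
    show "\<Gamma>h u k w (random_combination lo hi N c w) = (\<Sum>j\<in>multi_indices N. c j w * \<Gamma>h u k w (cheb_basis lo hi j))"
      using linear_functional_on_combination[OF lin[OF w], of "\<lambda>j. c j w"] unfolding random_combination_def by simp
  qed
qed

lemma cheb_coeff_measurable:
  assumes "\<And>k. k \<in> multi_indices N \<Longrightarrow> (\<lambda>w. v w k) \<in> borel_measurable Q"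
  shows "(\<lambda>w. cheb_coeff N (v w) j) \<in> borel_measurable Q"
  unfolding cheb_coeff_def using assms
  by (intro borel_measurable_times borel_measurable_sum) auto

context dp_problem
begin

lemma Lf_nonneg: "0 \<le> Lf"
  using f_lipschitz[of 0 0 1 0] by simp

lemma f_measurable: "f a \<in> borel_measurable borel"
proof (rule borel_measurable_continuous_onI)
  have "Lf-lipschitz_on UNIV (f a)"
    using f_lipschitz[of a _ a] Lf_nonneg by (intro lipschitz_onI) (auto simp: dist_real_def)
  then show "continuous_on UNIV (f a)" by (rule lipschitz_on_continuous_on)
qed

lemma transition_kernel:
  assumes "u < n"
  shows "prob_space (K (t u) (t (Suc u)) x)" "sets (K (t u) (t (Suc u)) x) = sets borel"
proof -
  have mono: "t i \<le> t j" if "i \<le> j" "j \<le> n" for i j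
    using strict_mono_on_leD[OF time_mono, of i j] that by simp
  have "0 \<le> t u" "t u \<le> t (Suc u)" "t (Suc u) \<le> T"
    using mono[of 0 u] mono[of u "Suc u"] mono[of "Suc u" n] assms time_0 time_n by auto
  then have "K (t u) (t (Suc u)) \<in> borel \<rightarrow>\<^sub>M prob_algebra borel" by (rule K_kernel)
  from measurable_space[OF this, of x] show "prob_space (K (t u) (t (Suc u)) x)" "sets (K (t u) (t (Suc u)) x) = sets borel"
    unfolding space_prob_algebra by auto
qed

text \<open>The stochastic moment condition speaks only of polynomials with measurable coefficients,
  so each iterate must be shown to be one. The identity is confined to \<open>space Q\<close>, where
  the scheme is specified.\<close>

lemma dynamic_chebyshev_coefficients:
  assumes gm: "GM_star Q K n t lo hi N \<Gamma>h \<delta>"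
    and Vh: "random_dynamic_chebyshev Q n t g f lo hi N \<Gamma>h Vh"
    and u: "u \<le> n"
  shows "\<exists>c. (\<forall>j\<in>multi_indices N. c j \<in> borel_measurable Q) \<and>
     (\<forall>w\<in>space Q. Vh u w = random_combination lo hi N c w)"
  using u
proof (induction rule: inc_induct)
  case base
  have "Vh n w = random_combination lo hi N (\<lambda>j _. cheb_coeff N (\<lambda>k. g (t n) (cheb_node lo hi N k)) j) w" if "w \<in> space Q" for w
    using Vh that unfolding random_dynamic_chebyshev_def dynamic_chebyshev_def cheb_interp_def random_combination_def by simp
  then show ?case
    by (intro exI[of _ "\<lambda>j _. cheb_coeff N (\<lambda>k. g (t n) (cheb_node lo hi N k)) j"]) auto
next
  case (step u)
  then obtain c where c: "\<And>j. j \<in> multi_indices N \<Longrightarrow> c j \<in> borel_measurable Q"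
    "\<And>w. w \<in> space Q \<Longrightarrow> Vh (Suc u) w = random_combination lo hi N c w" by blast
  define v where "v w k = f (g (t u) (cheb_node lo hi N k)) (\<Gamma>h u k w (random_combination lo hi N c w))" for w k
  have "(\<lambda>w. v w k) \<in> borel_measurable Q" if "k \<in> multi_indices N" for k
    unfolding v_def by (rule measurable_compose[OF cheb_space_eval_measurable[OF gm step.hyps(2) that c(1)] f_measurable])
  then have m: "(\<lambda>w. cheb_coeff N (v w) j) \<in> borel_measurable Q" for j
    by (rule cheb_coeff_measurable)
  have "Vh u w = random_combination lo hi N (\<lambda>j w. cheb_coeff N (v w) j) w" if "w \<in> space Q" for w
    using Vh that step.hyps c(2)[OF that]
    unfolding random_dynamic_chebyshev_def dynamic_chebyshev_def cheb_interp_def random_combination_def v_def by simp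
  with m show ?case by (intro exI[of _ "\<lambda>j w. cheb_coeff N (v w) j"]) auto
qed

text \<open>The error is the interpolation error of V u plus the interpolant of the nodal
  differences. The nodes are deterministic, so expectations pass through the finite cardinal sum,
  and the absolute cardinal functions sum to at most the Lebesgue constant.\<close>

lemma error_step:
  fixes lo hi :: "real^'d"
  assumes box: "\<And>i. lo $ i < hi $ i" and N: "\<And>i. 0 < N i"
    and tr: "truncation_bound K n t lo hi N V \<epsilon>tr"
    and gm: "GM_star Q K n t lo hi N \<Gamma>h \<delta>"
    and Vh: "random_dynamic_chebyshev Q n t g f lo hi N \<Gamma>h Vh"
    and u: "u < n"
    and interp: "\<And>x. x \<in> cbox lo hi \<Longrightarrow> \<bar>V u x - cheb_interp lo hi N (\<lambda>k. V u (cheb_node lo hi N k)) x\<bar> \<le> \<epsilon>"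
    and Vb: "\<And>x. x \<in> cbox lo hi \<Longrightarrow> \<bar>V (Suc u) x\<bar> \<le> Vb" and Vb0: "0 \<le> Vb"
    and IH: "box_sup_mean Q lo hi (\<lambda>w x. V (Suc u) x - Vh (Suc u) w x) \<le> ennreal b" and b: "0 \<le> b"
  shows "box_sup_mean Q lo hi (\<lambda>w x. V u x - Vh u w x)
     \<le> ennreal (\<epsilon> + lebesgue_const lo hi N * Lf * (\<epsilon>tr + b + \<delta> * (Vb + b)))"
proof -
  interpret Q: prob_space Q using gm unfolding GM_star_def by blast
  have \<delta>: "0 \<le> \<delta>" using gm unfolding GM_star_def by blast
  have \<epsilon>tr: "0 \<le> \<epsilon>tr" using tr unfolding truncation_bound_def by blast
  have \<epsilon>: "0 \<le> \<epsilon>" using interp[of lo] box by (fastforce simp: mem_box_cart less_imp_le intro: order_trans[OF abs_ge_zero])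
  obtain c where c: "\<And>j. j \<in> multi_indices N \<Longrightarrow> c j \<in> borel_measurable Q"
    "\<And>w. w \<in> space Q \<Longrightarrow> Vh (Suc u) w = random_combination lo hi N c w"
    using dynamic_chebyshev_coefficients[OF gm Vh, of "Suc u"] u by auto
  define M where "M = \<epsilon>tr + b + \<delta> * (Vb + b)"
  have M: "0 \<le> M" unfolding M_def using \<delta> \<epsilon>tr b Vb0 by simp
  define D where "D k w = \<bar>(\<integral>y. V (Suc u) y \<partial>K (t u) (t (Suc u)) (cheb_node lo hi N k)) - \<Gamma>h u k w (random_combination lo hi N c w)\<bar>" for k w
  have Dm: "(\<lambda>w. ennreal (D k w)) \<in> borel_measurable Q" if "k \<in> multi_indices N" for k
    unfolding D_def using cheb_space_eval_measurable[OF gm u that c(1)] by measurable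
  have e: "box_sup_mean Q lo hi (\<lambda>w x. V (Suc u) x - random_combination lo hi N c w x) \<le> ennreal b"
  proof -
    have "box_sup_mean Q lo hi (\<lambda>w x. V (Suc u) x - random_combination lo hi N c w x)
        = box_sup_mean Q lo hi (\<lambda>w x. V (Suc u) x - Vh (Suc u) w x)"
      unfolding box_sup_mean_def by (intro SUP_cong refl nn_integral_cong) (simp add: c(2))
    with IH show ?thesis by simp
  qed
  have D: "(\<integral>\<^sup>+w. ennreal (D k w) \<partial>Q) \<le> ennreal M" if k: "k \<in> multi_indices N" for k
  proof -
    have trk: "\<bar>\<integral>y. V (Suc u) y * indicator (UNIV - cbox lo hi) y \<partial>K (t u) (t (Suc u)) (cheb_node lo hi N k)\<bar> \<le> \<epsilon>tr"
      using tr u k unfolding truncation_bound_def gen_moment_def by blast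
    have "(\<integral>\<^sup>+w. ennreal (D k w) \<partial>Q) \<le> ennreal \<epsilon>tr + box_sup_mean Q lo hi (\<lambda>w x. V (Suc u) x - random_combination lo hi N c w x)
        + ennreal \<delta> * (ennreal Vb + box_sup_mean Q lo hi (\<lambda>w x. V (Suc u) x - random_combination lo hi N c w x))"
      unfolding D_def
      by (rule moment_error_bound[OF gm box N u k transition_kernel[OF u] V_integrable[OF u] trk Vb Vb0 c(1)])
    also have "\<dots> \<le> ennreal \<epsilon>tr + ennreal b + ennreal \<delta> * (ennreal Vb + ennreal b)"
      by (intro add_mono mult_left_mono e order_refl) auto
    also have "\<dots> = ennreal M" unfolding M_def using \<delta> \<epsilon>tr b Vb0 by (simp add: ennreal_mult)
    finally show ?thesis .
  qed
  have "(\<integral>\<^sup>+w. ennreal \<bar>V u x - Vh u w x\<bar> \<partial>Q) \<le> ennreal (\<epsilon> + lebesgue_const lo hi N * Lf * M)" if x: "x \<in> cbox lo hi" for x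
  proof -
    define a where "a k = \<bar>tensor_cardinal lo hi N k x\<bar> * Lf" for k
    have a: "0 \<le> a k" for k unfolding a_def using Lf_nonneg by simp
    have "(\<integral>\<^sup>+w. ennreal \<bar>V u x - Vh u w x\<bar> \<partial>Q) \<le> (\<integral>\<^sup>+w. ennreal \<epsilon> + (\<Sum>k\<in>multi_indices N. ennreal (a k) * ennreal (D k w)) \<partial>Q)"
    proof (rule nn_integral_mono)
      fix w assume w: "w \<in> space Q"
      define v where "v k = f (g (t u) (cheb_node lo hi N k)) (\<Gamma>h u k w (random_combination lo hi N c w))" for k
      have "Vh u w = cheb_interp lo hi N v"
        using Vh w u c(2)[OF w] unfolding random_dynamic_chebyshev_def dynamic_chebyshev_def v_def by simp
      then have "\<bar>V u x - Vh u w x\<bar> \<le> \<bar>V u x - cheb_interp lo hi N (\<lambda>k. V u (cheb_node lo hi N k)) x\<bar>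
          + \<bar>cheb_interp lo hi N (\<lambda>k. V u (cheb_node lo hi N k)) x - cheb_interp lo hi N v x\<bar>" by simp
      also have "\<dots> \<le> \<epsilon> + \<bar>\<Sum>k\<in>multi_indices N. (V u (cheb_node lo hi N k) - v k) * tensor_cardinal lo hi N k x\<bar>"
      proof -
        have "cheb_interp lo hi N (\<lambda>k. V u (cheb_node lo hi N k)) x - cheb_interp lo hi N v x
            = (\<Sum>k\<in>multi_indices N. (V u (cheb_node lo hi N k) - v k) * tensor_cardinal lo hi N k x)"
          using cheb_interp_eq_cardinal[OF box x N] by (simp add: sum_subtractf left_diff_distrib)
        then show ?thesis using interp[OF x] by simp
      qed
      also have "\<dots> \<le> \<epsilon> + (\<Sum>k\<in>multi_indices N. a k * D k w)"
      proof (intro add_left_mono order_trans[OF sum_abs] sum_mono)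
        fix k
        \<comment> \<open>Both nodal values contain the same payoff g, so only the second argument
          of f contributes to the Lipschitz bound.\<close>
        have "\<bar>V u (cheb_node lo hi N k) - v k\<bar> \<le> Lf * D k w"
          using f_lipschitz[of "g (t u) (cheb_node lo hi N k)" _ "g (t u) (cheb_node lo hi N k)"]
          unfolding V_step[OF u] v_def D_def by simp
        from mult_right_mono[OF this, of "\<bar>tensor_cardinal lo hi N k x\<bar>"]
        show "\<bar>(V u (cheb_node lo hi N k) - v k) * tensor_cardinal lo hi N k x\<bar> \<le> a k * D k w"
          unfolding abs_mult a_def by (simp add: mult_ac)
      qed
      finally have "\<bar>V u x - Vh u w x\<bar> \<le> \<epsilon> + (\<Sum>k\<in>multi_indices N. a k * D k w)" .
      moreover have D0: "0 \<le> D k w" for k unfolding D_def by simp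
      moreover have "ennreal (\<epsilon> + (\<Sum>k\<in>multi_indices N. a k * D k w)) = ennreal \<epsilon> + (\<Sum>k\<in>multi_indices N. ennreal (a k) * ennreal (D k w))"
        using \<epsilon> a D0 by (simp add: ennreal_plus sum_nonneg ennreal_mult flip: sum_ennreal)
      ultimately show "ennreal \<bar>V u x - Vh u w x\<bar> \<le> ennreal \<epsilon> + (\<Sum>k\<in>multi_indices N. ennreal (a k) * ennreal (D k w))"
        by (metis ennreal_leI)
    qed
    also have "\<dots> = ennreal \<epsilon> + (\<Sum>k\<in>multi_indices N. ennreal (a k) * (\<integral>\<^sup>+w. ennreal (D k w) \<partial>Q))"
    proof -
      have "(\<lambda>w. \<Sum>k\<in>multi_indices N. ennreal (a k) * ennreal (D k w)) \<in> borel_measurable Q"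
        using Dm by (intro borel_measurable_sum borel_measurable_times) auto
      then show ?thesis
        using Dm by (simp add: nn_integral_add nn_integral_sum nn_integral_cmult Q.emeasure_space_1 cong: sum.cong)
    qed
    also have "\<dots> \<le> ennreal \<epsilon> + (\<Sum>k\<in>multi_indices N. ennreal (a k) * ennreal M)"
      by (intro add_left_mono sum_mono mult_left_mono D) auto
    also have "\<dots> = ennreal (\<epsilon> + (\<Sum>k\<in>multi_indices N. a k) * M)"
      using \<epsilon> a M by (simp add: ennreal_plus sum_nonneg ennreal_mult sum_distrib_right flip: sum_ennreal)
    also have "\<dots> \<le> ennreal (\<epsilon> + lebesgue_const lo hi N * Lf * M)"
    proof (intro ennreal_leI add_left_mono mult_right_mono M)
      show "(\<Sum>k\<in>multi_indices N. a k) \<le> lebesgue_const lo hi N * Lf"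
        unfolding a_def sum_distrib_right[symmetric]
        by (intro mult_right_mono lebesgue_const_bounds(2)[OF box N x] Lf_nonneg)
    qed
    finally show ?thesis .
  qed
  then show ?thesis unfolding box_sup_mean_def M_def by (intro SUP_least) blast
qed

lemma stochastic_error_bound:
  fixes lo hi :: "real^'d"
  assumes box: "\<And>i. lo $ i < hi $ i"
    and rho_gt_1: "\<And>u i. u \<in> {1..n} \<Longrightarrow> 1 < \<rho> u $ i"
    and analytic: "\<And>u. u \<in> {1..n} \<Longrightarrow> bounded_analytic_extension lo hi (\<rho> u) (B u) (V u)"
    and N: "\<And>i. 0 < N i"
    and tr: "truncation_bound K n t lo hi N V \<epsilon>tr"
    and gm: "GM_star Q K n t lo hi N \<Gamma>h \<delta>"
    and Vh: "random_dynamic_chebyshev Q n t g f lo hi N \<Gamma>h Vh"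
    and u: "u \<in> {1..n}"
  shows "0 \<le> eps_int (rho_min n \<rho>) N (B_max n B)" and "0 \<le> V_max lo hi n V u"
    and "box_sup_mean Q lo hi (\<lambda>w x. V u x - Vh u w x)
     \<le> ennreal ((eps_int (rho_min n \<rho>) N (B_max n B) + \<epsilon>tr + \<delta> * V_max lo hi n V u) * C_tilde lo hi N Lf \<delta> ^ (n + 1 - u))"
proof -
  interpret Q: prob_space Q using gm unfolding GM_star_def by blast
  have \<delta>: "0 \<le> \<delta>" using gm unfolding GM_star_def by blast
  have \<epsilon>tr: "0 \<le> \<epsilon>tr" using tr unfolding truncation_bound_def by blast
  have lo: "lo \<in> cbox lo hi" using box by (auto simp: mem_box_cart less_imp_le)
  have n: "{1..n} \<noteq> {}" "n \<in> {1..n}" using u by auto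
  have rmin: "1 < rho_min n \<rho> $ i" for i
    unfolding rho_min_def using n rho_gt_1 by simp
  have rle: "rho_min n \<rho> $ i \<le> \<rho> v $ i" if "v \<in> {1..n}" for v i
    unfolding rho_min_def using that by simp
  \<comment> \<open>All time points are brought to one common ellipse and one common bound, so that
    a single interpolation error \<epsilon> serves every step.\<close>
  have ext: "bounded_analytic_extension lo hi (rho_min n \<rho>) (B_max n B) (V v)" if v: "v \<in> {1..n}" for v
    by (rule bounded_analytic_extension_mono[OF analytic[OF v] rmin rle[OF v]]) (use v in \<open>simp add: B_max_def\<close>)
  define \<epsilon> where "\<epsilon> = eps_int (rho_min n \<rho>) N (B_max n B)"
  have interp: "\<bar>V v x - cheb_interp lo hi N (\<lambda>k. V v (cheb_node lo hi N k)) x\<bar> \<le> \<epsilon>"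
    if "v \<in> {1..n}" "x \<in> cbox lo hi" for v x
    unfolding \<epsilon>_def by (rule cheb_interp_error[OF box rmin N ext[OF that(1)] that(2)])
  show \<epsilon>0: "0 \<le> eps_int (rho_min n \<rho>) N (B_max n B)"
    using order_trans[OF abs_ge_zero interp[OF u lo]] unfolding \<epsilon>_def .
  define Vb where "Vb = V_max lo hi n V u"
  have Vb: "\<bar>V v x\<bar> \<le> Vb" if v: "v \<in> {u..n}" and x: "x \<in> cbox lo hi" for v x
  proof -
    have "v \<in> {1..n}" using v u by auto
    then have "bdd_above ((\<lambda>x. \<bar>V v x\<bar>) ` cbox lo hi)"
      using bounded_analytic_extension_bound[OF ext rmin box] by (intro bdd_aboveI2) blast
    then have "\<bar>V v x\<bar> \<le> box_sup lo hi (V v)" unfolding box_sup_def using x by (rule cSUP_upper[rotated])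
    also have "\<dots> \<le> Vb" unfolding Vb_def V_max_def using v by simp
    finally show ?thesis .
  qed
  show "0 \<le> V_max lo hi n V u"
    using order_trans[OF abs_ge_zero Vb[of u lo]] lo u unfolding Vb_def by auto
  then have Vb0: "0 \<le> Vb" unfolding Vb_def .
  define A where "A = \<epsilon>tr + \<delta> * Vb"
  define c where "c = C_tilde lo hi N Lf \<delta>"
  define \<Lambda> where "\<Lambda> = lebesgue_const lo hi N"
  have A: "0 \<le> A" unfolding A_def using \<epsilon>tr \<delta> Vb0 by simp
  have \<Lambda>0: "0 \<le> \<Lambda>" unfolding \<Lambda>_def using lebesgue_const_bounds(2)[OF box N lo] by (meson abs_ge_zero order_trans sum_nonneg)
  have c: "2 \<le> c" "\<Lambda> * Lf * (1 + \<delta>) \<le> c" unfolding c_def C_tilde_def \<Lambda>_def by auto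
  have cL: "\<Lambda> * Lf \<le> c"
  proof -
    have "\<Lambda> * Lf * 1 \<le> \<Lambda> * Lf * (1 + \<delta>)" using \<Lambda>0 Lf_nonneg \<delta> by (intro mult_left_mono) auto
    with c show ?thesis by linarith
  qed
  have cpow: "c \<le> c ^ Suc k" for k using c self_le_power[of c "Suc k"] by simp
  have main: "box_sup_mean Q lo hi (\<lambda>w x. V v x - Vh v w x) \<le> ennreal (\<epsilon> * (c ^ (n + 1 - v) - 1) + A * (c ^ (n + 1 - v) - c))"
    if v: "u \<le> v" "v \<le> n" for v
    using v(2,1)
  proof (induction v rule: inc_induct)
    case base
    have "(\<integral>\<^sup>+w. ennreal \<bar>V n x - Vh n w x\<bar> \<partial>Q) \<le> ennreal \<epsilon>" if x: "x \<in> cbox lo hi" for x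
    proof -
      have "(\<integral>\<^sup>+w. ennreal \<bar>V n x - Vh n w x\<bar> \<partial>Q) \<le> (\<integral>\<^sup>+w. ennreal \<epsilon> \<partial>Q)"
      proof (rule nn_integral_mono)
        fix w assume "w \<in> space Q"
        then have "Vh n w = cheb_interp lo hi N (\<lambda>k. V n (cheb_node lo hi N k))"
          using Vh unfolding random_dynamic_chebyshev_def dynamic_chebyshev_def V_terminal time_n by simp
        then show "ennreal \<bar>V n x - Vh n w x\<bar> \<le> ennreal \<epsilon>" using interp[OF n(2) x] by (simp add: ennreal_leI)
      qed
      then show ?thesis by (simp add: Q.emeasure_space_1)
    qed
    then have "box_sup_mean Q lo hi (\<lambda>w x. V n x - Vh n w x) \<le> ennreal \<epsilon>"
      unfolding box_sup_mean_def by (intro SUP_least) blast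
    \<comment> \<open>At the terminal time only interpolation errs; the invariant with exponent 1
      has no A term and leaves \<open>\<epsilon> * (c - 1)\<close>, enough since c \<ge> 2.\<close>
    also have "\<dots> \<le> ennreal (\<epsilon> * (c - 1))"
      using c \<epsilon>0 mult_left_mono[of 1 "c - 1" \<epsilon>] unfolding \<epsilon>_def by (intro ennreal_leI) simp
    finally show ?case by simp
  next
    case (step v)
    define k where "k = n - v"
    have k: "n + 1 - Suc v = k" "n + 1 - v = Suc k" unfolding k_def using step by auto
    have "0 < k" unfolding k_def using step by simp
    then obtain k' where k': "k = Suc k'" by (cases k) auto
    define b where "b = \<epsilon> * (c ^ k - 1) + A * (c ^ k - c)"
    have "1 \<le> c ^ k" "c \<le> c ^ k" using c one_le_power[of c k] cpow[of k'] unfolding k' by auto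
    then have b: "0 \<le> b" unfolding b_def using \<epsilon>0 A unfolding \<epsilon>_def
      by (intro add_nonneg_nonneg mult_nonneg_nonneg) auto
    have "box_sup_mean Q lo hi (\<lambda>w x. V v x - Vh v w x) \<le> ennreal (\<epsilon> + \<Lambda> * Lf * (\<epsilon>tr + b + \<delta> * (Vb + b)))"
      unfolding \<Lambda>_def
    proof (rule error_step[OF box N tr gm Vh])
      show "v < n" using step by simp
      show "\<bar>V v x - cheb_interp lo hi N (\<lambda>k. V v (cheb_node lo hi N k)) x\<bar> \<le> \<epsilon>" if "x \<in> cbox lo hi" for x
        using step u that by (intro interp) auto
      show "\<bar>V (Suc v) x\<bar> \<le> Vb" if "x \<in> cbox lo hi" for x using step that by (intro Vb) auto
      show "box_sup_mean Q lo hi (\<lambda>w x. V (Suc v) x - Vh (Suc v) w x) \<le> ennreal b"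
        using step unfolding b_def k by simp
    qed (fact Vb0 b)+
    also have "\<dots> \<le> ennreal (\<epsilon> * (c ^ Suc k - 1) + A * (c ^ Suc k - c))"
    proof (rule ennreal_leI)
      have "\<Lambda> * Lf * (\<epsilon>tr + b + \<delta> * (Vb + b)) = \<Lambda> * Lf * A + \<Lambda> * Lf * (1 + \<delta>) * b"
        unfolding A_def by (simp add: algebra_simps)
      also have "\<dots> \<le> c * A + c * b"
        using A b cL c by (intro add_mono mult_right_mono) auto
      finally have "\<epsilon> + \<Lambda> * Lf * (\<epsilon>tr + b + \<delta> * (Vb + b)) \<le> \<epsilon> + c * A + c * b" by simp
      \<comment> \<open>The slack of the invariant is exactly
        \<open>(\<epsilon> + A*c) * (c - 2)\<close>; its sign is the reason for the constant 2 in
        \<open>C_tilde\<close>.\<close>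
      also have "\<dots> = \<epsilon> * (c ^ Suc k - 1) + A * (c ^ Suc k - c) - (\<epsilon> + A * c) * (c - 2)"
        unfolding b_def by (simp add: algebra_simps)
      also have "\<dots> \<le> \<epsilon> * (c ^ Suc k - 1) + A * (c ^ Suc k - c)"
        using \<epsilon>0 A c unfolding \<epsilon>_def by simp
      finally show "\<epsilon> + \<Lambda> * Lf * (\<epsilon>tr + b + \<delta> * (Vb + b)) \<le> \<epsilon> * (c ^ Suc k - 1) + A * (c ^ Suc k - c)" .
    qed
    finally show ?case unfolding k .
  qed
  have "box_sup_mean Q lo hi (\<lambda>w x. V u x - Vh u w x) \<le> ennreal (\<epsilon> * (c ^ (n + 1 - u) - 1) + A * (c ^ (n + 1 - u) - c))"
    using u by (intro main) auto
  also have "\<dots> \<le> ennreal ((\<epsilon> + A) * c ^ (n + 1 - u))"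
  proof (rule ennreal_leI)
    have "0 \<le> \<epsilon> + A * c" using \<epsilon>0 A c unfolding \<epsilon>_def by simp
    then show "\<epsilon> * (c ^ (n + 1 - u) - 1) + A * (c ^ (n + 1 - u) - c) \<le> (\<epsilon> + A) * c ^ (n + 1 - u)"
      by (simp add: algebra_simps)
  qed
  finally show "box_sup_mean Q lo hi (\<lambda>w x. V u x - Vh u w x)
     \<le> ennreal ((eps_int (rho_min n \<rho>) N (B_max n B) + \<epsilon>tr + \<delta> * V_max lo hi n V u) * C_tilde lo hi N Lf \<delta> ^ (n + 1 - u))"
    unfolding A_def \<epsilon>_def Vb_def c_def by (simp add: add.assoc)
qed

end

section \<open>Deterministic schemes and asymptotics\<close>

context dp_problem
begin

lemma deterministic_error_bound:
  fixes lo hi :: "real^'d"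
  assumes box: "\<And>i. lo $ i < hi $ i"
    and rho_gt_1: "\<And>u i. u \<in> {1..n} \<Longrightarrow> 1 < \<rho> u $ i"
    and analytic: "\<And>u. u \<in> {1..n} \<Longrightarrow> bounded_analytic_extension lo hi (\<rho> u) (B u) (V u)"
    and N: "\<And>i. 0 < N i"
    and tr: "truncation_bound K n t lo hi N V \<epsilon>tr"
    and gm: "GM K n t lo hi N \<Gamma>h \<delta>"
    and Vh: "dynamic_chebyshev n t g f lo hi N \<Gamma>h Vh"
    and u: "u \<in> {1..n}"
  shows "0 \<le> \<delta>"
    and "box_sup lo hi (\<lambda>x. V u x - Vh u x)
     \<le> (eps_int (rho_min n \<rho>) N (B_max n B) + \<epsilon>tr + \<delta> * V_max lo hi n V u) * C_tilde lo hi N Lf \<delta> ^ (n + 1 - u)"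
proof -
  \<comment> \<open>On this space every function is measurable and integration is evaluation at the
    single point.\<close>
  define Q where "Q = return (count_space UNIV) ()"
  have lo: "lo \<in> cbox lo hi" using box by (auto simp: mem_box_cart less_imp_le)
  have Qint: "(\<integral>\<^sup>+w. h w \<partial>Q) = h ()" for h unfolding Q_def by (subst nn_integral_return) auto
  have Q: "prob_space Q" unfolding Q_def by (rule prob_space_return) simp
  have Qmeas: "h \<in> borel_measurable Q" for h :: "unit \<Rightarrow> real" unfolding Q_def by simp
  have n0: "0 < n" using u by auto
  show \<delta>: "0 \<le> \<delta>"
  proof -
    \<comment> \<open>Unlike the stochastic condition, \<open>GM\<close> does not state that
      \<delta> is nonnegative. The index 0 gives the constant polynomial 1 on the box, of norm one,
      whose nonnegative defect is at most \<delta>; a time step to apply it to exists because n >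
      0.\<close>
    define k :: "'d \<Rightarrow> nat" where "k = (\<lambda>_. 0)"
    have k: "k \<in> multi_indices N" unfolding k_def multi_indices_def by simp
    have "cheb_basis lo hi k x = 1" if "x \<in> cbox lo hi" for x
      unfolding cheb_basis_box[OF box that] k_def by simp
    then have "box_sup lo hi (cheb_basis lo hi k) = (SUP x\<in>cbox lo hi. 1)" unfolding box_sup_def by (intro SUP_cong) auto
    also have "\<dots> = 1" using lo by (intro cSUP_const) auto
    finally have "\<bar>gen_moment K t lo hi N 0 k (cheb_basis lo hi k) - \<Gamma>h 0 k (cheb_basis lo hi k)\<bar> \<le> \<delta>"
      using gm n0 k cheb_basis_in_space[OF k, of lo hi] unfolding GM_def by blast
    then show ?thesis by linarith
  qed
  have gms: "GM_star Q K n t lo hi N (\<lambda>u k _. \<Gamma>h u k) \<delta>"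
    unfolding GM_star_def
  proof (intro conjI allI impI ballI Q \<delta> Qmeas)
    fix v k assume v: "v < n" and k: "k \<in> multi_indices N"
    show "linear_functional_on (cheb_space lo hi N) (\<Gamma>h v k)" using gm v k unfolding GM_def by blast
    fix p assume p: "p \<in> random_cheb_space Q lo hi N" and p1: "box_sup_mean Q lo hi p = 1"
    have ps: "p () \<in> cheb_space lo hi N" using p unfolding random_cheb_space_def cheb_space_def by auto
    have le1: "\<bar>p () x\<bar> \<le> 1" if "x \<in> cbox lo hi" for x
      using box_sup_mean_upper[OF that, of Q p] unfolding Qint p1 by (simp add: ennreal_le_1)
    \<comment> \<open>The two normalisations use suprema in different orders; boundedness is what
      transfers the value 1 from the extended supremum to the real one.\<close>
    then have bdd: "bdd_above ((\<lambda>x. \<bar>p () x\<bar>) ` cbox lo hi)" by (intro bdd_aboveI2)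
    have "box_sup lo hi (p ()) \<le> 1" unfolding box_sup_def using lo le1 by (intro cSUP_least) auto
    moreover have "1 \<le> ennreal (box_sup lo hi (p ()))"
      unfolding p1[symmetric] box_sup_mean_def Qint box_sup_def
      by (intro SUP_least ennreal_leI cSUP_upper bdd)
    ultimately have "box_sup lo hi (p ()) = 1" by (simp add: ennreal_ge_1)
    then have "\<bar>gen_moment K t lo hi N v k (p ()) - \<Gamma>h v k (p ())\<bar> \<le> \<delta>"
      using gm v k ps unfolding GM_def by blast
    then show "(\<integral>\<^sup>+w. ennreal \<bar>gen_moment K t lo hi N v k (p w) - \<Gamma>h v k (p w)\<bar> \<partial>Q) \<le> ennreal \<delta>"
      unfolding Qint by (rule ennreal_leI)
  qed
  have Vhs: "random_dynamic_chebyshev Q n t g f lo hi N (\<lambda>u k _. \<Gamma>h u k) (\<lambda>u _. Vh u)"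
    using Vh unfolding random_dynamic_chebyshev_def by simp
  note S = stochastic_error_bound[OF box rho_gt_1 analytic N tr gms Vhs u]
  define R where "R = (eps_int (rho_min n \<rho>) N (B_max n B) + \<epsilon>tr + \<delta> * V_max lo hi n V u) * C_tilde lo hi N Lf \<delta> ^ (n + 1 - u)"
  have R: "0 \<le> R"
    unfolding R_def using S(1,2) \<delta> tr unfolding truncation_bound_def C_tilde_def
    by (intro mult_nonneg_nonneg add_nonneg_nonneg zero_le_power) auto
  have "\<bar>V u x - Vh u x\<bar> \<le> R" if "x \<in> cbox lo hi" for x
  proof -
    have "ennreal \<bar>V u x - Vh u x\<bar> \<le> ennreal R"
      using order_trans[OF box_sup_mean_upper[OF that, of Q "\<lambda>w x. V u x - Vh u x"]] S(3) unfolding Qint R_def by blast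
    then show ?thesis using R by simp
  qed
  then show "box_sup lo hi (\<lambda>x. V u x - Vh u x) \<le> (eps_int (rho_min n \<rho>) N (B_max n B) + \<epsilon>tr + \<delta> * V_max lo hi n V u) * C_tilde lo hi N Lf \<delta> ^ (n + 1 - u)"
    unfolding R_def[symmetric] box_sup_def using lo by (intro cSUP_least) auto
qed

end

section \<open>Uniform constants in the degree\<close>

lemma eps_int_geometric:
  fixes \<rho> :: "real^'d"
  assumes \<rho>: "\<And>i. 1 < \<rho> $ i"
  obtains C where "0 \<le> C" "\<And>N. eps_int \<rho> (\<lambda>_. N) B \<le> C * Min (range (\<lambda>i. \<rho> $ i)) powr (- real N)"
proof -
  define m where "m = Min (range (\<lambda>i. \<rho> $ i))"
  have "m \<in> range (\<lambda>i. \<rho> $ i)" unfolding m_def by (intro Min_in) auto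
  then have m: "1 < m" using \<rho> by auto
  have mi: "m \<le> \<rho> $ i" for i unfolding m_def by (intro Min_le) auto
  define P where "P = (\<Prod>i\<in>UNIV. sqrt (2 / (1 - 1 / (\<rho> $ i)\<^sup>2)))"
  have P: "0 \<le> P" unfolding P_def using \<rho>
    by (intro prod_nonneg) (auto simp: divide_le_eq_1 less_imp_le one_le_power)
  show ?thesis
  proof (rule that)
    show "0 \<le> \<bar>B\<bar> * (2 * (P * sqrt (real CARD('d))))" using P by simp
    fix N
    have "(\<Sum>i\<in>UNIV. (1 / (\<rho> $ i)\<^sup>2) ^ N) \<le> (\<Sum>i\<in>(UNIV :: 'd set). (1 / m\<^sup>2) ^ N)"
    proof (rule sum_mono)
      fix i
      have "m\<^sup>2 \<le> (\<rho> $ i)\<^sup>2" using mi[of i] m by (intro power_mono) auto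
      then have "1 / (\<rho> $ i)\<^sup>2 \<le> 1 / m\<^sup>2" using m by (intro frac_le) auto
      then show "(1 / (\<rho> $ i)\<^sup>2) ^ N \<le> (1 / m\<^sup>2) ^ N" by (intro power_mono) auto
    qed
    also have "\<dots> = real CARD('d) * (m powr (- real N))\<^sup>2"
    proof -
      have "(1 / m\<^sup>2) ^ N = ((1 / m) ^ N)\<^sup>2" by (simp add: power_divide power_mult[symmetric] mult.commute)
      moreover have "m powr (- real N) = (1 / m) ^ N" using m by (simp add: powr_minus powr_realpow power_inverse divide_inverse)
      ultimately show ?thesis by simp
    qed
    finally have "sqrt (\<Sum>i\<in>UNIV. (1 / (\<rho> $ i)\<^sup>2) ^ N) \<le> sqrt (real CARD('d)) * m powr (- real N)"
      by (metis real_sqrt_le_iff real_sqrt_mult real_sqrt_abs abs_of_nonneg powr_ge_zero)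
    then have "\<bar>B\<bar> * (2 * (P * sqrt (\<Sum>i\<in>UNIV. (1 / (\<rho> $ i)\<^sup>2) ^ N))) \<le> \<bar>B\<bar> * (2 * (P * (sqrt (real CARD('d)) * m powr (- real N))))"
      using P by (intro mult_left_mono) auto
    moreover have "eps_int \<rho> (\<lambda>_. N) B \<le> \<bar>B\<bar> * (2 * (P * sqrt (\<Sum>i\<in>UNIV. (1 / (\<rho> $ i)\<^sup>2) ^ N)))"
      unfolding eps_int_eq[OF \<rho>] P_def[symmetric] using P by (intro mult_right_mono mult_nonneg_nonneg) (auto intro: sum_nonneg)
    ultimately show "eps_int \<rho> (\<lambda>_. N) B \<le> \<bar>B\<bar> * (2 * (P * sqrt (real CARD('d)))) * Min (range (\<lambda>i. \<rho> $ i)) powr (- real N)"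
      unfolding m_def[symmetric] by (simp add: mult_ac)
  qed
qed

text \<open>For N \<ge> 2 the constant in 1 + ln N is absorbed by 1 \<le> ln N / ln 2, and \<kappa>
  is also chosen large enough to absorb the 2 in \<open>C_tilde\<close>. It depends on the bound d
  for \<delta>, but not on \<delta> itself. The lower bound 1 permits raising the exponent
  later.\<close>

lemma C_tilde_log:
  fixes lo hi :: "real^'d"
  assumes box: "\<And>i. lo $ i < hi $ i"
  obtains \<kappa> where "\<And>N \<delta>. 2 \<le> N \<Longrightarrow> 0 \<le> \<delta> \<Longrightarrow> \<delta> \<le> d \<Longrightarrow>
    C_tilde lo hi (\<lambda>_. N) 1 \<delta> \<le> \<kappa> * ln (real N) ^ CARD('d) \<and> 0 \<le> C_tilde lo hi (\<lambda>_. N) 1 \<delta> \<and> 1 \<le> \<kappa> * ln (real N) ^ CARD('d)"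
proof -
  define a where "a = 2 * (1 / ln 2 + 1 :: real)"
  define \<kappa> where "\<kappa> = max (2 / ln 2 ^ CARD('d)) (a ^ CARD('d) * (1 + d))"
  show ?thesis
  proof (rule that)
    fix N :: nat and \<delta> :: real assume N: "2 \<le> N" and \<delta>: "0 \<le> \<delta>" "\<delta> \<le> d"
    have ln2: "0 < ln (2::real)" "ln 2 \<le> ln (real N)" using N by auto
    have a: "0 \<le> a" unfolding a_def using ln2 by simp
    define l where "l = ln (real N) ^ CARD('d)"
    have "0 < ln (real N)" using ln2 by linarith
    then have l: "ln 2 ^ CARD('d) \<le> l" "0 < l"
      unfolding l_def using ln2 by (intro power_mono zero_less_power; linarith)+
    have "(2::real) = 2 / ln 2 ^ CARD('d) * ln 2 ^ CARD('d)" using ln2 by simp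
    also have "\<dots> \<le> \<kappa> * l" unfolding \<kappa>_def using l ln2 by (intro mult_mono) (auto simp: le_max_iff_disj)
    finally have two: "2 \<le> \<kappa> * l" .
    have "cot_mean N \<le> a * ln (real N)"
    proof -
      have "cot_mean N \<le> 2 * (1 + ln (real N))" using N by (intro cot_mean_le_ln) simp
      also have "\<dots> \<le> 2 * (ln (real N) / ln 2 + ln (real N))"
      proof -
        have "1 \<le> ln (real N) / ln 2" using ln2 by (simp add: le_divide_eq)
        then show ?thesis by (intro mult_left_mono add_right_mono) auto
      qed
      also have "\<dots> = a * ln (real N)" unfolding a_def by (simp add: algebra_simps)
      finally show ?thesis .
    qed
    moreover have "0 \<le> cot_mean N" using cot_mean_ge_1[of N] N by simp
    ultimately have "cot_mean N ^ CARD('d) \<le> (a * ln (real N)) ^ CARD('d)" by (intro power_mono)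
    then have "lebesgue_const lo hi (\<lambda>_. N) \<le> a ^ CARD('d) * l"
      using lebesgue_const_bounds(1)[OF box, of "\<lambda>_. N"] N unfolding l_def by (simp add: power_mult_distrib)
    then have "lebesgue_const lo hi (\<lambda>_. N) * (1 + \<delta>) \<le> (a ^ CARD('d) * l) * (1 + d)"
      using \<delta> a l by (intro mult_mono) auto
    also have "\<dots> = (a ^ CARD('d) * (1 + d)) * l" by (simp add: mult_ac)
    also have "\<dots> \<le> \<kappa> * l" unfolding \<kappa>_def using l by (intro mult_right_mono) auto
    finally show "C_tilde lo hi (\<lambda>_. N) 1 \<delta> \<le> \<kappa> * ln (real N) ^ CARD('d) \<and> 0 \<le> C_tilde lo hi (\<lambda>_. N) 1 \<delta> \<and> 1 \<le> \<kappa> * ln (real N) ^ CARD('d)"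
      unfolding C_tilde_def l_def[symmetric] using two by simp
  qed
qed

lemma error_bound_asymptotics:
  fixes lo hi :: "real^'d" and \<rho> :: "nat \<Rightarrow> real^'d"
  assumes box: "\<And>i. lo $ i < hi $ i" and rho_gt_1: "\<And>u i. u \<in> {1..n} \<Longrightarrow> 1 < \<rho> u $ i"
  obtains c1 c2 where "0 < c1" "0 < c2"
    "\<And>N \<delta> u. 2 \<le> N \<Longrightarrow> 0 \<le> \<delta> \<Longrightarrow> \<delta> \<le> d \<Longrightarrow> u \<in> {1..n} \<Longrightarrow>
      (eps_int (rho_min n \<rho>) (\<lambda>_. N) (B_max n B) + 0 + \<delta> * V_max lo hi n V u) * C_tilde lo hi (\<lambda>_. N) 1 \<delta> ^ (n + 1 - u)
      \<le> c1 * Min (range (\<lambda>i. rho_min n \<rho> $ i)) powr (- real N) * ln (real N) ^ (CARD('d) * n)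
         + c2 * ln (real N) ^ (CARD('d) * n) * \<delta>"
proof (cases "n = 0")
  case True
  \<comment> \<open>For n = 0 no index u exists; the case is split off because
    \<open>rho_min\<close> then ranges over an empty set.\<close>
  show ?thesis by (rule that[of 1 1]) (use True in auto)
next
  case False
  have rmin: "1 < rho_min n \<rho> $ i" for i
    unfolding rho_min_def using False rho_gt_1 by simp
  obtain C where C: "0 \<le> C" "\<And>N. eps_int (rho_min n \<rho>) (\<lambda>_. N) (B_max n B) \<le> C * Min (range (\<lambda>i. rho_min n \<rho> $ i)) powr (- real N)"
    using eps_int_geometric[OF rmin] by blast
  obtain \<kappa> where \<kappa>: "\<And>N \<delta>. 2 \<le> N \<Longrightarrow> 0 \<le> \<delta> \<Longrightarrow> \<delta> \<le> d \<Longrightarrow>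
    C_tilde lo hi (\<lambda>_. N) 1 \<delta> \<le> \<kappa> * ln (real N) ^ CARD('d) \<and> 0 \<le> C_tilde lo hi (\<lambda>_. N) 1 \<delta> \<and> 1 \<le> \<kappa> * ln (real N) ^ CARD('d)"
    using C_tilde_log[OF box] by blast
  define W where "W = \<bar>V_max lo hi n V 1\<bar>"
  show ?thesis
  proof (rule that)
    \<comment> \<open>The added 1 keeps the constants positive even when C or W is zero.\<close>
    show "0 < C * \<bar>\<kappa>\<bar> ^ n + 1" "0 < W * \<bar>\<kappa>\<bar> ^ n + 1" unfolding W_def using C by (auto intro: add_nonneg_pos)
    fix N :: nat and \<delta> :: real and u assume N: "2 \<le> N" and \<delta>: "0 \<le> \<delta>" "\<delta> \<le> d" and u: "u \<in> {1..n}"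
    define p where "p = Min (range (\<lambda>i. rho_min n \<rho> $ i)) powr (- real N)"
    define L where "L = ln (real N) ^ (CARD('d) * n)"
    define e where "e = eps_int (rho_min n \<rho>) (\<lambda>_. N) (B_max n B)"
    have p: "0 \<le> p" unfolding p_def by simp
    have L: "0 \<le> L" unfolding L_def using N by simp
    note k = \<kappa>[OF N \<delta>]
    have "V_max lo hi n V u \<le> V_max lo hi n V 1"
      unfolding V_max_def using u by (intro Max_mono image_mono) auto
    then have "V_max lo hi n V u \<le> W" unfolding W_def by linarith
    then have 1: "e + \<delta> * V_max lo hi n V u \<le> C * p + \<delta> * W"
      unfolding e_def p_def using C(2) \<delta> by (intro add_mono mult_left_mono) auto
    have 2: "C_tilde lo hi (\<lambda>_. N) 1 \<delta> ^ (n + 1 - u) \<le> \<bar>\<kappa>\<bar> ^ n * L"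
    proof -
      have "C_tilde lo hi (\<lambda>_. N) 1 \<delta> ^ (n + 1 - u) \<le> (\<kappa> * ln (real N) ^ CARD('d)) ^ (n + 1 - u)"
        using k by (intro power_mono) auto
      \<comment> \<open>Since u \<ge> 1 the exponent n + 1 - u is at most n, and the base is at
        least 1.\<close>
      also have "\<dots> \<le> (\<kappa> * ln (real N) ^ CARD('d)) ^ n"
        using k u by (intro power_increasing) auto
      also have "\<dots> = \<kappa> ^ n * L" unfolding L_def by (simp add: power_mult_distrib power_mult)
      also have "\<dots> \<le> \<bar>\<kappa>\<bar> ^ n * L" using L by (intro mult_right_mono) (auto simp: power_abs[symmetric])
      finally show ?thesis .
    qed
    have "(e + \<delta> * V_max lo hi n V u) * C_tilde lo hi (\<lambda>_. N) 1 \<delta> ^ (n + 1 - u) \<le> (C * p + \<delta> * W) * (\<bar>\<kappa>\<bar> ^ n * L)"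
      using 1 2 k C p \<delta> unfolding W_def by (intro mult_mono) (auto intro: add_nonneg_nonneg)
    also have "\<dots> \<le> (C * p + \<delta> * W) * (\<bar>\<kappa>\<bar> ^ n * L) + (p * L + L * \<delta>)" using p L \<delta> by simp
    also have "\<dots> = (C * \<bar>\<kappa>\<bar> ^ n + 1) * p * L + (W * \<bar>\<kappa>\<bar> ^ n + 1) * L * \<delta>" by (simp add: algebra_simps)
    finally show "(eps_int (rho_min n \<rho>) (\<lambda>_. N) (B_max n B) + 0 + \<delta> * V_max lo hi n V u) * C_tilde lo hi (\<lambda>_. N) 1 \<delta> ^ (n + 1 - u)
      \<le> (C * \<bar>\<kappa>\<bar> ^ n + 1) * Min (range (\<lambda>i. rho_min n \<rho> $ i)) powr (- real N) * ln (real N) ^ (CARD('d) * n)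
         + (W * \<bar>\<kappa>\<bar> ^ n + 1) * ln (real N) ^ (CARD('d) * n) * \<delta>"
      unfolding e_def p_def L_def by simp
  qed
qed

theorem corollary3p4:
  fixes P :: "'p measure"
    and X :: "real \<Rightarrow> 'p \<Rightarrow> real^'d"
    and T Lf :: real
    and K :: "real \<Rightarrow> real \<Rightarrow> real^'d \<Rightarrow> (real^'d) measure"
    and n :: nat
    and t :: "nat \<Rightarrow> real"
    and g :: "real \<Rightarrow> real^'d \<Rightarrow> real"
    and f :: "real \<Rightarrow> real \<Rightarrow> real"
    and V :: "nat \<Rightarrow> real^'d \<Rightarrow> real"
    and lo hi :: "real^'d"
    and \<rho> :: "nat \<Rightarrow> real^'d"
    and B :: "nat \<Rightarrow> real"
  assumes problem: "dp_problem P X T K n t g f Lf V"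
    and box: "\<And>i. lo $ i < hi $ i"
    and rho_gt_1: "\<And>u i. u \<in> {1..n} \<Longrightarrow> 1 < \<rho> u $ i"
    and analytic: "\<And>u. u \<in> {1..n} \<Longrightarrow> bounded_analytic_extension lo hi (\<rho> u) (B u) (V u)"
  shows
    "(\<forall>N \<epsilon>tr \<delta> \<Gamma>h Vh.
        (\<forall>i. 1 \<le> N i) \<and>
        truncation_bound K n t lo hi N V \<epsilon>tr \<and>
        GM K n t lo hi N \<Gamma>h \<delta> \<and>
        dynamic_chebyshev n t g f lo hi N \<Gamma>h Vh \<longrightarrow>
        (\<forall>u\<in>{1..n}.
           box_sup lo hi (\<lambda>x. V u x - Vh u x)
           \<le> (eps_int (rho_min n \<rho>) N (B_max n B) + \<epsilon>tr + \<delta> * V_max lo hi n V u)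
              * C_tilde lo hi N Lf \<delta> ^ (n + 1 - u)))
     \<and>
     (\<forall>N \<epsilon>tr (M::nat) \<delta>star (Q :: 'w measure) \<Gamma>h Vh.
        (\<forall>i. 1 \<le> N i) \<and> 1 \<le> M \<and>
        truncation_bound K n t lo hi N V \<epsilon>tr \<and>
        GM_star Q K n t lo hi N \<Gamma>h (\<delta>star M) \<and>
        random_dynamic_chebyshev Q n t g f lo hi N \<Gamma>h Vh \<longrightarrow>
        (\<forall>u\<in>{1..n}.
           box_sup_mean Q lo hi (\<lambda>w x. V u x - Vh u w x)
           \<le> ennreal ((eps_int (rho_min n \<rho>) N (B_max n B) + \<epsilon>tr + \<delta>star M * V_max lo hi n V u)
                        * C_tilde lo hi N Lf (\<delta>star M) ^ (n + 1 - u))))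
     \<and>
     (Lf = 1 \<longrightarrow>
       (\<forall>c>0. \<exists>c1>0. \<exists>c2>0. \<forall>\<delta>star :: nat \<Rightarrow> real.
         (\<forall>M\<ge>1. \<delta>star M \<le> c / sqrt (real M)) \<longrightarrow>
         (\<forall>(N::nat)\<ge>2. \<forall>(M::nat)\<ge>1. \<forall>(Q :: 'w measure) \<Gamma>h Vh.
            truncation_bound K n t lo hi (\<lambda>_. N) V 0 \<and>
            GM_star Q K n t lo hi (\<lambda>_. N) \<Gamma>h (\<delta>star M) \<and>
            random_dynamic_chebyshev Q n t g f lo hi (\<lambda>_. N) \<Gamma>h Vh \<longrightarrow>
            (\<forall>u\<in>{1..n}.
               box_sup_mean Q lo hi (\<lambda>w x. V u x - Vh u w x)
               \<le> ennreal (c1 * Min (range (\<lambda>i. rho_min n \<rho> $ i)) powr (- real N)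
                              * ln (real N) ^ (CARD('d) * n)
                          + c2 * ln (real N) ^ (CARD('d) * n) * real M powr (- 0.5))))))
     \<and>
     (Lf = 1 \<longrightarrow>
       (\<forall>\<Delta> :: real set. bounded \<Delta> \<longrightarrow> (\<exists>c1>0. \<exists>c2>0. \<forall>\<delta>\<in>\<Delta>.
         (\<forall>(N::nat)\<ge>2. \<forall>\<Gamma>h Vh.
            truncation_bound K n t lo hi (\<lambda>_. N) V 0 \<and>
            GM K n t lo hi (\<lambda>_. N) \<Gamma>h \<delta> \<and>
            dynamic_chebyshev n t g f lo hi (\<lambda>_. N) \<Gamma>h Vh \<longrightarrow>
            (\<forall>u\<in>{1..n}.
               box_sup lo hi (\<lambda>x. V u x - Vh u x)
               \<le> c1 * Min (range (\<lambda>i. rho_min n \<rho> $ i)) powr (- real N)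
                      * ln (real N) ^ (CARD('d) * n)
                  + c2 * ln (real N) ^ (CARD('d) * n) * \<delta>)))))"
proof -
  interpret dp_problem P X T K n t g f Lf V by (rule problem)
  note stoch = stochastic_error_bound(3)[OF box rho_gt_1 analytic]
  note det = deterministic_error_bound(2)[OF box rho_gt_1 analytic]
  define L where "L N = ln (real N) ^ (CARD('d) * n)" for N
  define R where "R N = Min (range (\<lambda>i. rho_min n \<rho> $ i)) powr (- real N)" for N
  define bound where "bound N \<delta> u = (eps_int (rho_min n \<rho>) (\<lambda>_. N) (B_max n B) + 0 + \<delta> * V_max lo hi n V u)
      * C_tilde lo hi (\<lambda>_. N) 1 \<delta> ^ (n + 1 - u)" for N \<delta> u
  have asym: "\<exists>c1>0. \<exists>c2>0. \<forall>N\<ge>2. \<forall>\<delta>. 0 \<le> \<delta> \<and> \<delta> \<le> d \<longrightarrow>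
      (\<forall>u\<in>{1..n}. bound N \<delta> u \<le> c1 * R N * L N + c2 * L N * \<delta>)" for d
  proof -
    obtain c1 c2 where "0 < c1" "0 < c2" and "\<And>N \<delta> u. 2 \<le> N \<Longrightarrow> 0 \<le> \<delta> \<Longrightarrow> \<delta> \<le> d \<Longrightarrow> u \<in> {1..n} \<Longrightarrow>
        bound N \<delta> u \<le> c1 * R N * L N + c2 * L N * \<delta>"
      unfolding bound_def R_def L_def
      using error_bound_asymptotics[where n = n and \<rho> = \<rho> and d = d and B = B and V = V, OF box rho_gt_1] by blast
    then show ?thesis by (intro exI[of _ c1] exI[of _ c2] conjI allI impI ballI) auto
  qed
  have N0: "0 < N" if "2 \<le> N" for N :: nat using that by simp
  have L0: "0 \<le> L N" if "2 \<le> N" for N unfolding L_def using that by simp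
  show ?thesis
    unfolding L_def[symmetric] R_def[symmetric]
  proof (intro conjI impI allI, goal_cases)
    case 1 then show ?case by (intro ballI det) (auto simp: Suc_le_eq)
  next
    case 2 then show ?case by (intro ballI stoch) (auto simp: Suc_le_eq)
  next
    case (3 c)
    obtain c1 c2 where c12: "0 < c1" "0 < c2" and le: "\<And>N \<delta> u. 2 \<le> N \<Longrightarrow> 0 \<le> \<delta> \<Longrightarrow> \<delta> \<le> c \<Longrightarrow> u \<in> {1..n} \<Longrightarrow>
        bound N \<delta> u \<le> c1 * R N * L N + c2 * L N * \<delta>" using asym[of c] by blast
    show ?case
    \<comment> \<open>The second constant carries the factor c from the hypothesis that
      \<open>\<delta>star M\<close> is at most c / sqrt M.\<close>
    proof (rule exI[of _ c1], intro conjI c12(1), rule exI[of _ "c2 * c"], intro conjI allI impI ballI)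
      show "0 < c2 * c" using c12 3 by simp
      fix \<delta>star :: "nat \<Rightarrow> real" and N M :: nat and Q :: "'w measure" and \<Gamma>h Vh u
      assume \<delta>c: "\<forall>M\<ge>1. \<delta>star M \<le> c / sqrt (real M)" and N: "2 \<le> N" and M: "1 \<le> M"
        and H: "truncation_bound K n t lo hi (\<lambda>_. N) V 0 \<and>
          GM_star Q K n t lo hi (\<lambda>_. N) \<Gamma>h (\<delta>star M) \<and>
          random_dynamic_chebyshev Q n t g f lo hi (\<lambda>_. N) \<Gamma>h Vh" and u: "u \<in> {1..n}"
      have \<delta>0: "0 \<le> \<delta>star M" using H unfolding GM_star_def by blast
      have \<delta>s: "\<delta>star M \<le> c / sqrt (real M)" using \<delta>c M by blast
      have "real M powr (- 0.5) = 1 / sqrt (real M)"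
        using powr_half_sqrt[of "real M"] by (simp add: powr_minus_divide)
      then have \<delta>M: "\<delta>star M \<le> c * real M powr (- 0.5)" using \<delta>s by simp
      \<comment> \<open>As M \<ge> 1, all admissible values of \<open>\<delta>star M\<close> lie
        between 0 and c, so constants chosen for this range do not depend on M.\<close>
      have "c / sqrt (real M) \<le> c / 1" using M 3 by (intro divide_left_mono) auto
      then have \<delta>c': "\<delta>star M \<le> c" using \<delta>s by linarith
      have "box_sup_mean Q lo hi (\<lambda>w x. V u x - Vh u w x) \<le> ennreal (bound N (\<delta>star M) u)"
        unfolding bound_def 3(1)[symmetric] using H N0[OF N] u by (intro stoch) auto
      also have "\<dots> \<le> ennreal (c1 * R N * L N + c2 * L N * \<delta>star M)"
        by (intro ennreal_leI le N \<delta>0 \<delta>c' u)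
      also have "\<dots> \<le> ennreal (c1 * R N * L N + c2 * L N * (c * real M powr (- 0.5)))"
        using \<delta>M c12 L0[OF N] by (intro ennreal_leI add_left_mono mult_left_mono) auto
      finally show "box_sup_mean Q lo hi (\<lambda>w x. V u x - Vh u w x)
          \<le> ennreal (c1 * R N * L N + c2 * c * L N * real M powr (- 0.5))"
        by (simp add: mult_ac)
    qed
  next
    case (4 \<Delta>)
    then obtain d where d: "\<And>\<delta>. \<delta> \<in> \<Delta> \<Longrightarrow> \<bar>\<delta>\<bar> \<le> d" unfolding bounded_iff by auto
    obtain c1 c2 where c12: "0 < c1" "0 < c2" and le: "\<And>N \<delta> u. 2 \<le> N \<Longrightarrow> 0 \<le> \<delta> \<Longrightarrow> \<delta> \<le> d \<Longrightarrow> u \<in> {1..n} \<Longrightarrow>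
        bound N \<delta> u \<le> c1 * R N * L N + c2 * L N * \<delta>" using asym[of d] by blast
    show ?case
    proof (rule exI[of _ c1], intro conjI c12(1), rule exI[of _ c2], intro conjI c12(2) allI impI ballI)
      fix \<delta> and N :: nat and \<Gamma>h Vh u
      assume \<delta>: "\<delta> \<in> \<Delta>" and N: "2 \<le> N"
        and H: "truncation_bound K n t lo hi (\<lambda>_. N) V 0 \<and> GM K n t lo hi (\<lambda>_. N) \<Gamma>h \<delta> \<and>
          dynamic_chebyshev n t g f lo hi (\<lambda>_. N) \<Gamma>h Vh" and u: "u \<in> {1..n}"
      have \<delta>d: "\<delta> \<le> d" using d[OF \<delta>] by linarith
      note D = deterministic_error_bound[OF box rho_gt_1 analytic N0[OF N] conjunct1[OF H] conjunct1[OF conjunct2[OF H]] conjunct2[OF conjunct2[OF H]] u]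
      have "box_sup lo hi (\<lambda>x. V u x - Vh u x) \<le> bound N \<delta> u"
        using D(2) unfolding bound_def 4(1) .
      \<comment> \<open>The set \<Delta> may contain negative numbers; \<open>GM\<close> itself
        excludes them here, through the first part of D.\<close>
      also have "\<dots> \<le> c1 * R N * L N + c2 * L N * \<delta>"
        using D(1) by (intro le N \<delta>d u)
      finally show "box_sup lo hi (\<lambda>x. V u x - Vh u x) \<le> c1 * R N * L N + c2 * L N * \<delta>" .
    qed
  qed
qed

end
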